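(* Let $(\Omega,d,\mu)$ be an $RD$-space with indices $(k,n)$ which satisfies the non-collapsing property. Let $E$ be a parameter, $b\in SV$, $0<\theta<1$ and $X$ an r.i. space on $\Omega$. Then for all $f\in L^1+L^\infty$ such that $f^*(\infty)=0$ we have (with constants implicit in $\preceq$ independent of $f$) $$\left\|\frac{b(t^{1/n})\phi_X(t)}{t^{\theta/n}}O(f,t)\right\|_{\tilde E(0,1)}+\left\|\frac{b(t^{1/k})\phi_X(t)}{t^{\theta/k}}O(f,t)\right\|_{\tilde E(1,\infty)}\preceq\|f\|_{\mathring B^{\theta,b}_{X,E}}.$$ Moreover: (i) If $\underline\beta_X>\frac\theta k$, then $$\left\|\frac{b(t^{1/n})\phi_X(t)}{t^{\theta/n}}f^{**}(t)\right\|_{\tilde E(0,1)}+\left\|\frac{b(t^{1/k})\phi_X(t)}{t^{\theta/k}}f^{**}(t)\right\|_{\tilde E(1,\infty)}\preceq\|f\|_{\mathring B^{\theta,b}_{X,E}}.$$ (ii) If $\frac\theta n<\underline\beta_X\le\frac\theta k$, then $$\left\|\frac{b(t^{1/n})\phi_X(t)}{t^{\theta/n}}f^{**}(t)\right\|_{\tilde E(0,1)}+\left\|\frac{b(t^{1/k})\phi_X(t)}{t^{\theta/k}}O(f,t)\right\|_{\tilde E(1,\infty)}\preceq\|f\|_{\mathring B^{\theta,b}_{X,E}}+\|f\|_{L^1+L^\infty}.$$ (iii) If $\underline\beta_X=\frac\theta n$, then: (a) if $\left\|\frac{t^{\theta/n}}{b(t^{1/n})\phi_X(t)}\right\|_{\tilde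 E'(0,1)}<\infty$, then $\|f\|_{L^\infty}\preceq\|f\|_{\mathring B^{\theta,b}_{X,E}}+\|f\|_{L^1+L^\infty}$; (b) if the function $b(t^{1/n})\phi_X(t)/t^{\theta/n}$ is quasi-increasing and the Boyd indices satisfy $\underline\alpha_E,\overline\alpha_E\in(0,1)$, then $$\left\|\frac{b(t^{1/n})\phi_X(t)}{t^{\theta/n}(1+|\ln t|)}f^{**}(t)\right\|_{\tilde E(0,1)}\preceq\|f\|_{\mathring B^{\theta,b}_{X,E}}+\|f\|_{L^1+L^\infty};$$ (c) if $\sup_{t\in(0,1)}\frac{t^{\theta/n}}{b(t^{1/n})\phi_X(t)}<\infty$, then $\|f\|_{bmo}\preceq\|f\|_{\mathring B^{\theta,b}_{X,L^\infty}}+\|f\|_{L^1+L^\infty}$. (iv) If $\bar\beta_X<\frac\theta n$, then $\|f\|_{L^\infty}\preceq\|f\|_{\mathring B^{\theta,b}_{X,E}}+\|f\|_{L^1+L^\infty}$.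
   Context: Metric measure space: $(\Omega,d)$ is a metric space with a Borel measure $\mu$ (induced by a Borel regular outer measure) such that $0<\mu(B)<\infty$ for every ball $B$ and $\mu(\{x\})=0$ for all $x\in\Omega$; $B(x,r)=\{y:d(x,y)<r\}$. It is an $RD$-space with indices $(k,n)$, $0<k\le n$, if there are constants $0<C_1\le 1\le C_2$ with $C_1\lambda^k\mu(B(x,r))\le\mu(B(x,\lambda r))\le C_2\lambda^n\mu(B(x,r))$ for all $x\in\Omega$, $r>0$, $\lambda\ge1$. Non-collapsing property: $\inf_{x\in\Omega}\mu(B(x,1))>0$. Rearrangements: $f^*(s)=\inf\{t\ge0:\mu\{|f|>t\}\le s\}$, $f^{**}(t)=\frac1t\int_0^tf^*(s)\,ds$, $O(f,t)=f^{**}(t)-f^*(t)$, $f^*(\infty)=\lim_{t\to\infty}f^*(t)$ (so $f^*(\infty)=0$ iff $\mu\{|f|>t\}<\infty$ for all $t>0$). $\|f\|_{L^1+L^\infty}=\int_0^1f^*(s)\,ds=f^{**}(1)$. R.i. space: a Banach function space $X$ on $(\Omega,\mu)$ with the Fatou property such that, if $g\in X$ and $f^*\le g^*$ a.e., then $f\in X$ and $\|f\|_X\le\|g\|_X$. Fundamental function: $\phi_X(t)=\|\chi_F\|_X$ for any measurable $F$ with $\mu(F)=t$. Fundamental indices: with $M(t)=\sup_{s>0}\frac{\phi_X(st)}{\phi_X(s)}$, $\underline\beta_X=\lim_{t\to0}\frac{\log M(t)}{\log t}$ and $\bar\beta_X=\lim_{t\to\infty}\frac{\log M(t)}{\log t}$.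 Quasi-increasing means equivalent, up to multiplicative constants, to an increasing function. Parameter: an r.i. space $E$ on $(0,\infty)$ with Lebesgue measure. One assumes $E=\mathcal F(L^1,L^\infty)$ for an exact interpolation functor $\mathcal F$, and puts $\tilde E:=\mathcal F(\tilde L^1,L^\infty)$ where $\|g\|_{\tilde L^1}=\int_0^\infty|g(t)|\frac{dt}{t}$; $\tilde E$ is an r.i. space with respect to $dt/t$, and concretely $\|g\|_{\tilde E(0,1)}=\|g(e^{-u})\|_{E(0,\infty)}$, $\|g\|_{\tilde E(1,\infty)}=\|g(e^{u})\|_{E(0,\infty)}$, $\|g\|_{\tilde E}\simeq\|g\|_{\tilde E(0,1)}+\|g\|_{\tilde E(1,\infty)}$, where $\|g\|_{\tilde E(I)}=\|g\chi_I\|_{\tilde E}$. $\tilde E'$ is the associate space of $\tilde E$ with respect to $dt/t$: $\|g\|_{\tilde E'}=\sup_{\|h\|_{\tilde E}\le1}\int_0^\infty|g(t)h(t)|\frac{dt}t$. For $E=L^\infty$, $\tilde E=L^\infty$. Boyd indices: $h_E(s)$ is the norm on $E$ of the dilation $f\mapsto f(\cdot/s)$, $\overline\alpha_E=\inf_{s>1}\frac{\ln h_E(s)}{\ln s}$, $\underline\alpha_E=\sup_{s<1}\frac{\ln h_E(s)}{\ln s}$. $b\in SV$ (slowly varying): $b$ is a positive Lebesgue measurable function on $(0,\infty)$ such that for every $\varepsilon>0$, $t^\varepsilon b(t)$ is equivalent (up to multiplicative constants) to an increasing function and $t^{-\varepsilon}b(t)$ to a decreasing function on $(0,\infty)$.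 Homogeneous Besov space: $E_X(f,t)=\left\|x\mapsto\frac1{\mu(B(x,t))}\int_{B(x,t)}|f(x)-f(y)|\,d\mu(y)\right\|_X$ and $\|f\|_{\mathring B^{\theta,b}_{X,E}}=\|t^{-\theta}b(t)E_X(f,t)\|_{\tilde E}$ for $f\in L^1+L^\infty$; $\mathring B^{\theta,b}_{X,E}$ is the set of such $f$ for which this is finite (the inequalities are trivial when the right side is infinite). $bmo$: with $f_B=\frac1{\mu(B)}\int_Bf\,d\mu$ and $B$ ranging over balls of $\Omega$, $\|f\|_{bmo}=\sup_{\mu(B)\le1}\frac1{\mu(B)}\int_B|f-f_B|\,d\mu+\sup_{\mu(B)>1}\frac1{\mu(B)}\int_B|f|\,d\mu$. $A\preceq B$ means $A\le CB$ for a constant $C>0$. *)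

theory Defs
  imports "HOL-Analysis.Analysis" "HOL-Probability.Essential_Supremum"
begin

definition borel_regular_outer_measure :: "('a::metric_space set \<Rightarrow> ennreal) \<Rightarrow> bool" where
  "borel_regular_outer_measure \<nu> \<longleftrightarrow>
     outer_measure_space (Pow UNIV) \<nu> \<and>
     sets borel \<subseteq> lambda_system UNIV (Pow UNIV) \<nu> \<and>
     (\<forall>A. \<exists>B\<in>sets borel. A \<subseteq> B \<and> \<nu> B = \<nu> A)"

text \<open>The measurable sets may be the Borel sets, the Caratheodory-measurable sets of the outer
  measure, or any \<open>\<sigma>\<close>-algebra in between.\<close>

definition metric_measure_space :: "'a::metric_space measure \<Rightarrow> bool" where
  "metric_measure_space M \<longleftrightarrow>
     space M = UNIV \<and>
     (\<exists>\<nu>. borel_regular_outer_measure \<nu> \<and>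
        sets borel \<subseteq> sets M \<and> sets M \<subseteq> lambda_system UNIV (Pow UNIV) \<nu> \<and>
        (\<forall>A\<in>sets M. emeasure M A = \<nu> A)) \<and>
     (\<forall>x r. r > 0 \<longrightarrow> 0 < emeasure M (ball x r) \<and> emeasure M (ball x r) < \<infinity>) \<and>
     (\<forall>x. emeasure M {x} = 0)"

definition RD_space :: "'a::metric_space measure \<Rightarrow> real \<Rightarrow> real \<Rightarrow> bool" where
  "RD_space M k n \<longleftrightarrow>
     metric_measure_space M \<and> 0 < k \<and> k \<le> n \<and>
     (\<exists>C1 C2. 0 < C1 \<and> C1 \<le> 1 \<and> 1 \<le> C2 \<and>
        (\<forall>x r l. r > 0 \<and> l \<ge> 1 \<longrightarrow>
           C1 * l powr k * measure M (ball x r) \<le> measure M (ball x (l * r)) \<and>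
           measure M (ball x (l * r)) \<le> C2 * l powr n * measure M (ball x r)))"

definition non_collapsing :: "'a::metric_space measure \<Rightarrow> bool" where
  "non_collapsing M \<longleftrightarrow> (INF x. emeasure M (ball x 1)) > 0"

text \<open>Rearrangements and function norms act on nonnegative extended-real functions; a real function
  \<open>f\<close> enters through \<open>\<bar>f\<bar>\<close>.\<close>

abbreviation absf :: "('a \<Rightarrow> real) \<Rightarrow> 'a \<Rightarrow> ennreal" where
  "absf f \<equiv> \<lambda>x. ennreal \<bar>f x\<bar>"

definition rearr :: "'a measure \<Rightarrow> ('a \<Rightarrow> ennreal) \<Rightarrow> real \<Rightarrow> ennreal" where
  "rearr M f s = Inf {t. emeasure M {x \<in> space M. t < f x} \<le> ennreal s}"

definition max_rearr :: "'a measure \<Rightarrow> ('a \<Rightarrow> ennreal) \<Rightarrow> real \<Rightarrow> ennreal" where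
  "max_rearr M f t = (\<integral>\<^sup>+ s\<in>{0<..<t}. rearr M f s \<partial>lborel) / ennreal t"

definition osc :: "'a measure \<Rightarrow> ('a \<Rightarrow> ennreal) \<Rightarrow> real \<Rightarrow> ennreal" where
  "osc M f t = max_rearr M f t - rearr M f t"

text \<open>This is the \<open>K\<close>-functional of \<open>(L\<^sup>1, L\<^sup>\<infinity>)\<close> at \<open>1\<close>, i.e. the usual norm of the sum space.\<close>

definition L1_plus_Linf_norm :: "'a measure \<Rightarrow> ('a \<Rightarrow> ennreal) \<Rightarrow> ennreal" where
  "L1_plus_Linf_norm M f = (\<integral>\<^sup>+ s\<in>{0<..<1}. rearr M f s \<partial>lborel)"

definition L1_plus_Linf :: "'a measure \<Rightarrow> ('a \<Rightarrow> real) set" where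
  "L1_plus_Linf M = {f \<in> borel_measurable M. L1_plus_Linf_norm M (absf f) < \<infinity>}"

definition vanishes_at_infinity :: "'a measure \<Rightarrow> ('a \<Rightarrow> ennreal) \<Rightarrow> bool" where
  "vanishes_at_infinity M f \<longleftrightarrow> (rearr M f \<longlongrightarrow> 0) at_top"

abbreviation half_line :: "real measure" where
  "half_line \<equiv> lebesgue_on {0<..}"

definition log_measure :: "real measure" where
  "log_measure = density half_line (\<lambda>t. ennreal (1 / t))"

text \<open>A Banach function space is given by its function norm on nonnegative measurable functions
  (Bennett and Sharpley); the space consists of the measurable \<open>f\<close> with \<open>\<rho> \<bar>f\<bar> < \<infinity>\<close>. The fifth
  clause is the Fatou property.\<close>

definition banach_function_norm :: "'a measure \<Rightarrow> (('a \<Rightarrow> ennreal) \<Rightarrow> ennreal) \<Rightarrow> bool" where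
  "banach_function_norm M \<rho> \<longleftrightarrow>
     (\<forall>f\<in>borel_measurable M. \<rho> f = 0 \<longleftrightarrow> (AE x in M. f x = 0)) \<and>
     (\<forall>f\<in>borel_measurable M. \<forall>a::real. a \<ge> 0 \<longrightarrow> \<rho> (\<lambda>x. ennreal a * f x) = ennreal a * \<rho> f) \<and>
     (\<forall>f\<in>borel_measurable M. \<forall>g\<in>borel_measurable M. \<rho> (\<lambda>x. f x + g x) \<le> \<rho> f + \<rho> g) \<and>
     (\<forall>f\<in>borel_measurable M. \<forall>g\<in>borel_measurable M. (AE x in M. f x \<le> g x) \<longrightarrow> \<rho> f \<le> \<rho> g) \<and>
     (\<forall>F. \<forall>f\<in>borel_measurable M. (\<forall>i::nat. F i \<in> borel_measurable M) \<and>
        (AE x in M. incseq (\<lambda>i. F i x) \<and> (\<lambda>i. F i x) \<longlonglongrightarrow> f x) \<longrightarrow> (\<lambda>i. \<rho> (F i)) \<longlonglongrightarrow> \<rho> f) \<and>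
     (\<forall>A\<in>sets M. emeasure M A < \<infinity> \<longrightarrow> \<rho> (indicator A) < \<infinity>) \<and>
     (\<forall>A\<in>sets M. emeasure M A < \<infinity> \<longrightarrow>
        (\<exists>C::real. \<forall>f\<in>borel_measurable M. \<rho> f < \<infinity> \<longrightarrow> (\<integral>\<^sup>+ x\<in>A. f x \<partial>M) \<le> ennreal C * \<rho> f))"

definition ri_norm :: "'a measure \<Rightarrow> (('a \<Rightarrow> ennreal) \<Rightarrow> ennreal) \<Rightarrow> bool" where
  "ri_norm M \<rho> \<longleftrightarrow>
     banach_function_norm M \<rho> \<and>
     (\<forall>f\<in>borel_measurable M. \<forall>g\<in>borel_measurable M.
        \<rho> g < \<infinity> \<and> (AE s in half_line. rearr M f s \<le> rearr M g s) \<longrightarrow> \<rho> f \<le> \<rho> g)"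

text \<open>For rearrangement invariant norms the choice of the set is irrelevant, and the value is
  finite.\<close>

definition fund_fun :: "'a measure \<Rightarrow> (('a \<Rightarrow> ennreal) \<Rightarrow> ennreal) \<Rightarrow> real \<Rightarrow> real" where
  "fund_fun M \<rho> t = enn2real (\<rho> (indicator (SOME A. A \<in> sets M \<and> emeasure M A = ennreal t)))"

text \<open>Fundamental functions are quasi-concave, so this supremum is at most \<open>max 1 t\<close>.\<close>

definition fund_dil :: "(real \<Rightarrow> real) \<Rightarrow> real \<Rightarrow> real" where
  "fund_dil \<phi> t = (SUP s\<in>{0<..}. \<phi> (s * t) / \<phi> s)"

definition lower_fund_index :: "(real \<Rightarrow> real) \<Rightarrow> real" where
  "lower_fund_index \<phi> = Lim (at_right 0) (\<lambda>t. ln (fund_dil \<phi> t) / ln t)"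

definition upper_fund_index :: "(real \<Rightarrow> real) \<Rightarrow> real" where
  "upper_fund_index \<phi> = Lim at_top (\<lambda>t. ln (fund_dil \<phi> t) / ln t)"

text \<open>For rearrangement invariant \<open>E\<close> one has \<open>dil_norm E s \<le> max 1 s\<close>; in particular it is finite.\<close>

definition dil_norm :: "((real \<Rightarrow> ennreal) \<Rightarrow> ennreal) \<Rightarrow> real \<Rightarrow> ennreal" where
  "dil_norm E s = (SUP f\<in>{f \<in> borel_measurable half_line. E f \<le> 1}. E (\<lambda>t. f (t / s)))"

definition upper_boyd_index :: "((real \<Rightarrow> ennreal) \<Rightarrow> ennreal) \<Rightarrow> real" where
  "upper_boyd_index E = (INF s\<in>{1<..}. ln (enn2real (dil_norm E s)) / ln s)"

definition lower_boyd_index :: "((real \<Rightarrow> ennreal) \<Rightarrow> ennreal) \<Rightarrow> real" where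
  "lower_boyd_index E = (SUP s\<in>{0<..<1}. ln (enn2real (dil_norm E s)) / ln s)"

text \<open>A Banach space of (classes of) functions is encoded by a complete extended seminorm \<open>N\<close> on all
  real functions: the space is \<open>{f. N f < \<infinity>}\<close> modulo \<open>{f. N f = 0}\<close>.\<close>

type_synonym fnorm = "(real \<Rightarrow> real) \<Rightarrow> ennreal"

definition banach_norm :: "fnorm \<Rightarrow> bool" where
  "banach_norm N \<longleftrightarrow>
     (\<forall>c f. N (\<lambda>t. c * f t) = ennreal \<bar>c\<bar> * N f) \<and>
     (\<forall>f g. N (\<lambda>t. f t + g t) \<le> N f + N g) \<and>
     (\<forall>F::nat \<Rightarrow> real \<Rightarrow> real. (\<forall>i. N (F i) < \<infinity>) \<and>
        (\<forall>e>0. \<exists>m. \<forall>i\<ge>m. \<forall>j\<ge>m. N (\<lambda>t. F i t - F j t) < e) \<longrightarrow>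
        (\<exists>f. N f < \<infinity> \<and> (\<lambda>i. N (\<lambda>t. F i t - f t)) \<longlonglongrightarrow> 0))"

definition sum_norm :: "fnorm \<Rightarrow> fnorm \<Rightarrow> fnorm" where
  "sum_norm N0 N1 f = (INF g. N0 g + N1 (\<lambda>t. f t - g t))"

text \<open>The last clause says that the two spaces have the same null functions and that their sum is
  Hausdorff, i.e. that the couple is compatible.\<close>

definition banach_couple :: "fnorm \<Rightarrow> fnorm \<Rightarrow> bool" where
  "banach_couple N0 N1 \<longleftrightarrow>
     banach_norm N0 \<and> banach_norm N1 \<and>
     (\<forall>f. sum_norm N0 N1 f = 0 \<longrightarrow> N0 f = 0 \<and> N1 f = 0)"

text \<open>Every linear map between the sums (spaces of classes) of two couples lifts to a linear map on
  all functions, so it suffices to consider the latter.\<close>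

definition linear_op :: "((real \<Rightarrow> real) \<Rightarrow> (real \<Rightarrow> real)) \<Rightarrow> bool" where
  "linear_op T \<longleftrightarrow> (\<forall>a b f g. T (\<lambda>t. a * f t + b * g t) = (\<lambda>t. a * T f t + b * T g t))"

text \<open>Functors are defined on the couples that can be realised on functions on the reals. By the
  Aronszajn-Gagliardo construction every such functor extends to all Banach couples with unchanged
  values on the couples \<open>(L\<^sup>1, L\<^sup>\<infinity>)\<close> for \<open>dt\<close> and \<open>dt/t\<close>.\<close>

definition exact_interpolation_functor :: "(fnorm \<Rightarrow> fnorm \<Rightarrow> fnorm) \<Rightarrow> bool" where
  "exact_interpolation_functor \<F> \<longleftrightarrow>
     (\<forall>A0 A1. banach_couple A0 A1 \<longrightarrow>
        banach_norm (\<F> A0 A1) \<and>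
        (\<exists>C::real. C > 0 \<and> (\<forall>f. \<F> A0 A1 f \<le> ennreal C * max (A0 f) (A1 f))) \<and>
        (\<exists>C::real. C > 0 \<and> (\<forall>f. sum_norm A0 A1 f \<le> ennreal C * \<F> A0 A1 f))) \<and>
     (\<forall>A0 A1 B0 B1 T. \<forall>c::real. banach_couple A0 A1 \<and> banach_couple B0 B1 \<and> linear_op T \<and> c > 0 \<and>
        (\<forall>f. B0 (T f) \<le> ennreal c * A0 f) \<and> (\<forall>f. B1 (T f) \<le> ennreal c * A1 f) \<longrightarrow>
        (\<forall>f. \<F> B0 B1 (T f) \<le> ennreal c * \<F> A0 A1 f))"

definition fnorm_of :: "real measure \<Rightarrow> ((real \<Rightarrow> ennreal) \<Rightarrow> ennreal) \<Rightarrow> fnorm" where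
  "fnorm_of M \<rho> f = (if f \<in> borel_measurable M then \<rho> (absf f) else \<infinity>)"

definition parameter :: "((real \<Rightarrow> ennreal) \<Rightarrow> ennreal) \<Rightarrow> (fnorm \<Rightarrow> fnorm \<Rightarrow> fnorm) \<Rightarrow> bool" where
  "parameter E \<F> \<longleftrightarrow>
     ri_norm half_line E \<and> exact_interpolation_functor \<F> \<and>
     \<F> (fnorm_of half_line (nn_integral half_line)) (fnorm_of half_line (esssup half_line))
       = fnorm_of half_line E"

text \<open>The norm of \<open>\<F>(L\<^sup>1(dt/t), L\<^sup>\<infinity>)\<close>, extended to functions with values in \<open>[0,\<infinity>]\<close>.\<close>

definition tilde_norm :: "(fnorm \<Rightarrow> fnorm \<Rightarrow> fnorm) \<Rightarrow> (real \<Rightarrow> ennreal) \<Rightarrow> ennreal" where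
  "tilde_norm \<F> g =
     (if AE t in log_measure. g t < \<infinity>
      then \<F> (fnorm_of log_measure (nn_integral log_measure)) (fnorm_of log_measure (esssup log_measure))
             (\<lambda>t. enn2real (g t))
      else \<infinity>)"

definition assoc_norm :: "((real \<Rightarrow> ennreal) \<Rightarrow> ennreal) \<Rightarrow> (real \<Rightarrow> ennreal) \<Rightarrow> ennreal" where
  "assoc_norm N g =
     (SUP h\<in>{h \<in> borel_measurable log_measure. N h \<le> 1}. \<integral>\<^sup>+ t. g t * h t \<partial>log_measure)"

definition norm_on :: "((real \<Rightarrow> ennreal) \<Rightarrow> ennreal) \<Rightarrow> real set \<Rightarrow> (real \<Rightarrow> ennreal) \<Rightarrow> ennreal" where
  "norm_on N I g = N (\<lambda>t. g t * indicator I t)"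

definition equivalent_on :: "real set \<Rightarrow> (real \<Rightarrow> real) \<Rightarrow> (real \<Rightarrow> real) \<Rightarrow> bool" where
  "equivalent_on S f g \<longleftrightarrow> (\<exists>c C. 0 < c \<and> 0 < C \<and> (\<forall>t\<in>S. c * g t \<le> f t \<and> f t \<le> C * g t))"

definition quasi_increasing_on :: "real set \<Rightarrow> (real \<Rightarrow> real) \<Rightarrow> bool" where
  "quasi_increasing_on S f \<longleftrightarrow> (\<exists>g. mono_on S g \<and> equivalent_on S f g)"

definition quasi_decreasing_on :: "real set \<Rightarrow> (real \<Rightarrow> real) \<Rightarrow> bool" where
  "quasi_decreasing_on S f \<longleftrightarrow> (\<exists>g. antimono_on S g \<and> equivalent_on S f g)"

definition SV :: "(real \<Rightarrow> real) set" where
  "SV = {b \<in> borel_measurable half_line. (\<forall>t>0. b t > 0) \<and>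
     (\<forall>\<epsilon>>0. quasi_increasing_on {0<..} (\<lambda>t. t powr \<epsilon> * b t) \<and>
             quasi_decreasing_on {0<..} (\<lambda>t. t powr (-\<epsilon>) * b t))}"

definition modulus ::
  "'a::metric_space measure \<Rightarrow> (('a \<Rightarrow> ennreal) \<Rightarrow> ennreal) \<Rightarrow> ('a \<Rightarrow> real) \<Rightarrow> real \<Rightarrow> ennreal" where
  "modulus M X f t =
     X (\<lambda>x. (\<integral>\<^sup>+ y\<in>ball x t. ennreal \<bar>f x - f y\<bar> \<partial>M) / emeasure M (ball x t))"

text \<open>\<open>N\<close> is a function norm with respect to \<open>dt/t\<close>.\<close>

definition besov_norm ::
  "'a::metric_space measure \<Rightarrow> (('a \<Rightarrow> ennreal) \<Rightarrow> ennreal) \<Rightarrow> ((real \<Rightarrow> ennreal) \<Rightarrow> ennreal) \<Rightarrow>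
   real \<Rightarrow> (real \<Rightarrow> real) \<Rightarrow> ('a \<Rightarrow> real) \<Rightarrow> ennreal" where
  "besov_norm M X N \<theta> b f = N (\<lambda>t. ennreal (t powr (-\<theta>) * b t) * modulus M X f t)"

definition mean :: "'a measure \<Rightarrow> 'a set \<Rightarrow> ('a \<Rightarrow> real) \<Rightarrow> real" where
  "mean M B f = (LINT y:B|M. f y) / measure M B"

definition bmo_norm :: "'a::metric_space measure \<Rightarrow> ('a \<Rightarrow> real) \<Rightarrow> ennreal" where
  "bmo_norm M f =
     (SUP B\<in>{B. (\<exists>x r. r > 0 \<and> B = ball x r) \<and> emeasure M B \<le> 1}.
        (\<integral>\<^sup>+ x\<in>B. ennreal \<bar>f x - mean M B f\<bar> \<partial>M) / emeasure M B) +
     (SUP B\<in>{B. (\<exists>x r. r > 0 \<and> B = ball x r) \<and> emeasure M B > 1}.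
        (\<integral>\<^sup>+ x\<in>B. ennreal \<bar>f x\<bar> \<partial>M) / emeasure M B)"

definition weight :: "(real \<Rightarrow> real) \<Rightarrow> (real \<Rightarrow> real) \<Rightarrow> real \<Rightarrow> real \<Rightarrow> real \<Rightarrow> real" where
  "weight b \<phi> \<theta> d t = b (t powr (1 / d)) * \<phi> t / t powr (\<theta> / d)"

end

theory Submission
  imports Defs "HOL-Probability.Distribution_Functions"
begin

text \<open>
  Put \<open>c = f\<^sup>*(t)\<close>. If every ball of radius \<open>r\<close> has measure at least \<open>2t\<close>, then at least half of each such
  ball lies in \<open>{\<bar>f\<bar> \<le> c}\<close>, so the average of \<open>\<bar>f x - f y\<bar>\<close> over \<open>y \<in> B(x, r)\<close> is at least
  \<open>(\<bar>f x\<bar> - c)\<^sub>+ / 2\<close>. Taking norms in \<open>X\<close> gives \<open>\<phi>\<^sub>X(t) O(f, t) \<le> 2 E\<^sub>X(f, r)\<close>. Non-collapsing and the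
  RD-condition allow \<open>r = A t\<^bsup>1/n\<^esup>\<close> for small and \<open>r = A t\<^bsup>1/k\<^esup>\<close> for large \<open>t\<close>, and the substitution
  \<open>t \<mapsto> A t\<^bsup>1/d\<^esup>\<close> is bounded on the space of the parameter by interpolation; this is the first inequality.

  The remaining estimates use \<open>f\<^sup>*\<^sup>*(t) \<le> f\<^sup>*\<^sup>*(2\<^sup>J t) + \<Sum>\<^bsub>j=1..J\<^esub> O(f, 2\<^sup>j t)\<close>. In (i) and (ii) the weight satisfies
  \<open>w(t) \<le> K 2\<^sup>-\<^sup>j\<^sup>\<epsilon> w(2\<^sup>j t)\<close>, and the dilates are summed with the triangle inequality. In (iii)(a) and (iv) the sum
  is bounded by \<open>\<integral> O(f, s) ds/s\<close> over the unit interval, since \<open>s O(f, s)\<close> increases, and estimated by duality. In (iii)(b)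
  the same integral becomes, after \<open>t = exp (-u)\<close>, a Hardy average on \<open>E\<close>. For (iii)(c) the mean oscillation over a
  ball is compared with the average of \<open>\<bar>f x - f y\<bar>\<close> at the scale of its radius.
\<close>

section \<open>Rearrangements\<close>

text \<open>Facts that are usually quoted have to be derived here, and this shapes the proof. The
  inequality \<phi>(t) f**(t) <= X f is not read off a representation of X on the half line: X lives
  on the space itself, so step functions with a prescribed rearrangement must be built there. That
  requires nested sets of every measure, hence separability of the space, obtained from
  non-collapsing and doubling, and an injective measurable function on it. The space of the
  parameter is known only as a value of an interpolation functor, so its order properties and all
  changes of variable are obtained by interpolating operators. The Fatou property is assumed for E
  alone; infinite sums in the companion norm are therefore carried to E by t = exp (-u), after t ->
  1/t has brought (1, \<infinity>) to the unit interval. The modulus is not shown to be measurable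
  in the radius; in the companion norm it enters only as the larger of two functions, where
  monotonicity asks no measurability.\<close>

lemma rearr_antimono: "s \<le> t \<Longrightarrow> rearr M f t \<le> rearr M f s"
  unfolding rearr_def by (intro Inf_superset_mono) (auto intro: order_trans ennreal_leI)

lemma rearr_le_rearrI:
  assumes "\<And>l. emeasure M {x \<in> space M. l < f x} \<le> emeasure N {x \<in> space N. l < g x}"
  shows "rearr M f s \<le> rearr N g s"
  unfolding rearr_def using assms by (intro Inf_superset_mono) (auto intro: order_trans)

text \<open>The infimum defining \<open>rearr\<close> is attained: for levels decreasing to it, the
  sets where \<open>f\<close> exceeds the level increase to the set where \<open>f\<close> exceeds
  the infimum. The equivalence turns comparisons of rearrangements into comparisons of distribution
  functions.\<close>

lemma less_rearr_iff:
  assumes f [measurable]: "f \<in> borel_measurable M"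
  shows "l < rearr M f s \<longleftrightarrow> ennreal s < emeasure M {x \<in> space M. l < f x}"
proof
  assume "l < rearr M f s"
  then have "l \<notin> {t. emeasure M {x \<in> space M. t < f x} \<le> ennreal s}"
    unfolding rearr_def by (rule contrapos_pn) (rule leD[OF Inf_lower])
  then show "ennreal s < emeasure M {x \<in> space M. l < f x}" by simp
next
  assume *: "ennreal s < emeasure M {x \<in> space M. l < f x}"
  define T where "T = {t. emeasure M {x \<in> space M. t < f x} \<le> ennreal s}"
  have "top \<in> T" by (simp add: T_def)
  then obtain u where u: "decseq u" "range u \<subseteq> T" "Inf T = (INF i. u i)"
    using ennreal_Inf_countable_INF[of T] by blast
  show "l < rearr M f s"
  proof (rule ccontr)
    assume "\<not> l < rearr M f s"
    then have le: "Inf T \<le> l" by (simp add: rearr_def T_def)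
    have "emeasure M {x \<in> space M. l < f x} \<le> emeasure M (\<Union>i. {x \<in> space M. u i < f x})"
      using le u(3) by (intro emeasure_mono) (auto simp: INF_less_iff dest: le_less_trans)
    also have "\<dots> = (SUP i. emeasure M {x \<in> space M. u i < f x})"
      using u(1) by (intro SUP_emeasure_incseq[symmetric])
        (auto simp: incseq_def decseq_def intro: le_less_trans)
    also have "\<dots> \<le> ennreal s" using u(2) by (intro SUP_least) (auto simp: T_def)
    finally show False using * by simp
  qed
qed

lemma emeasure_greater_rearr_le:
  "f \<in> borel_measurable M \<Longrightarrow> emeasure M {x \<in> space M. rearr M f s < f x} \<le> ennreal s"
  using less_rearr_iff[of f M "rearr M f s" s] by (simp add: not_less)

lemma borel_measurable_rearr [measurable]:
  assumes "f \<in> borel_measurable M"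
  shows "rearr M f \<in> borel_measurable borel"
proof (rule borel_measurableI_greater)
  fix l
  have "{s \<in> space borel. l < rearr M f s}
      = {s \<in> space borel. ennreal s < emeasure M {x \<in> space M. l < f x}}"
    using less_rearr_iff[OF assms] by auto
  also have "\<dots> \<in> sets borel" by measurable
  finally show "{x \<in> space borel. l < rearr M f x} \<in> sets borel" .
qed

text \<open>This is t f**(t), the K-functional of the couple (L1, Linf) at t. It is concave with
  slope f*(t), and using it postpones the division by t in [0, \<infinity>].\<close>

definition rearr_int :: "'a measure \<Rightarrow> ('a \<Rightarrow> ennreal) \<Rightarrow> real \<Rightarrow> ennreal" where
  "rearr_int M f t = (\<integral>\<^sup>+ s\<in>{0<..<t}. rearr M f s \<partial>lborel)"

lemma rearr_int_split:
  assumes [measurable]: "f \<in> borel_measurable M" and "0 < s" "s \<le> t"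
  shows "rearr_int M f t = rearr_int M f s + (\<integral>\<^sup>+ u\<in>{s..<t}. rearr M f u \<partial>lborel)"
proof -
  have "indicator {0<..<t} u = (indicator {0<..<s} u + indicator {s..<t} u :: ennreal)" for u
    using assms(2,3) by (auto simp: indicator_def)
  then show ?thesis unfolding rearr_int_def
    by (simp add: distrib_left nn_integral_add)
qed

lemma rearr_int_ge:
  assumes f: "f \<in> borel_measurable M" and "0 < s" "s \<le> t"
  shows "rearr_int M f s + ennreal (t - s) * rearr M f t \<le> rearr_int M f t"
proof -
  have "ennreal (t - s) * rearr M f t = (\<integral>\<^sup>+ u\<in>{s..<t}. rearr M f t \<partial>lborel)"
    using assms(3) by (simp add: nn_integral_cmult mult.commute)
  also have "\<dots> \<le> (\<integral>\<^sup>+ u\<in>{s..<t}. rearr M f u \<partial>lborel)"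
    by (intro nn_integral_mono) (auto simp: indicator_def intro: rearr_antimono)
  finally show ?thesis using rearr_int_split[OF assms] by (simp add: add_left_mono)
qed

lemma rearr_int_le:
  assumes f: "f \<in> borel_measurable M" and "0 < s" "s \<le> t"
  shows "rearr_int M f t \<le> rearr_int M f s + ennreal (t - s) * rearr M f s"
proof -
  have "(\<integral>\<^sup>+ u\<in>{s..<t}. rearr M f u \<partial>lborel) \<le> (\<integral>\<^sup>+ u\<in>{s..<t}. rearr M f s \<partial>lborel)"
    by (intro nn_integral_mono) (auto simp: indicator_def intro: rearr_antimono)
  also have "\<dots> = ennreal (t - s) * rearr M f s"
    using assms(3) by (simp add: nn_integral_cmult mult.commute)
  finally show ?thesis using rearr_int_split[OF assms] by (simp add: add_left_mono)
qed

lemma rearr_int_ge0: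
  assumes f: "f \<in> borel_measurable M" and "0 < t"
  shows "ennreal t * rearr M f t \<le> rearr_int M f t"
proof -
  have "ennreal t * rearr M f t = (\<integral>\<^sup>+ u\<in>{0<..<t}. rearr M f t \<partial>lborel)"
    using assms(2) by (simp add: nn_integral_cmult mult.commute)
  also have "\<dots> \<le> rearr_int M f t" unfolding rearr_int_def
    by (intro nn_integral_mono) (auto simp: indicator_def intro: rearr_antimono)
  finally show ?thesis .
qed

lemma max_rearr_eq: "max_rearr M f t = rearr_int M f t / ennreal t"
  by (simp add: max_rearr_def rearr_int_def)

lemma L1_plus_Linf_norm_eq:
  "L1_plus_Linf_norm M f = rearr_int M f 1" "L1_plus_Linf_norm M f = max_rearr M f 1"
  by (simp_all add: max_rearr_eq L1_plus_Linf_norm_def rearr_int_def divide_ennreal_def)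

text \<open>Since f* decreases, s f*(s) is at most the integral over (0, 1) for s <= 1; beyond 1 the
  integral grows at most linearly, with slope f*(1).\<close>

lemma
  assumes f: "f \<in> borel_measurable M" and fin: "L1_plus_Linf_norm M f < \<infinity>" and t: "0 < t"
  shows rearr_finite: "rearr M f t < \<infinity>" and rearr_int_finite: "rearr_int M f t < \<infinity>"
proof -
  have *: "rearr M f s < \<infinity>" if "0 < s" "s \<le> 1" for s
  proof -
    have "ennreal s * rearr M f s \<le> rearr_int M f 1"
      using rearr_int_ge0[OF f, of s] rearr_int_ge[OF f, of s 1] that
      by (meson add_increasing2 dual_order.trans zero_le le_add_same_cancel1 add_leD1)
    then have "ennreal s * rearr M f s < \<infinity>"
      using fin by (simp add: L1_plus_Linf_norm_eq)
    then show ?thesis using that by (auto simp: ennreal_mult_less_top)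
  qed
  show r: "rearr M f t < \<infinity>"
  proof (cases "t \<le> 1")
    case False
    then show ?thesis using *[of 1] rearr_antimono[of 1 t M f] by (auto intro: le_less_trans)
  qed (use * t in auto)
  show "rearr_int M f t < \<infinity>"
  proof (cases "t \<le> 1")
    case True
    then have "rearr_int M f t \<le> rearr_int M f 1"
      using rearr_int_ge[OF f t True] by (meson add_leD1 zero_le add_increasing2 order_trans le_iff_add)
    then show ?thesis using fin by (simp add: L1_plus_Linf_norm_eq)
  next
    case False
    then have "rearr_int M f t \<le> rearr_int M f 1 + ennreal (t - 1) * rearr M f 1"
      by (intro rearr_int_le f) auto
    then show ?thesis using fin *[of 1]
      by (auto simp: L1_plus_Linf_norm_eq ennreal_mult_less_top intro: le_less_trans)
  qed
qed

text \<open>Finiteness allows real arithmetic with a(t) = f*(t) and F(t) = t f**(t), so that the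
  truncated subtraction in \<open>osc\<close> becomes a true one. The doubling bound is F(t) + t
  a(2t) <= F(2t) divided by t; the comparison of oscillations holds because t O(f,t) = F(t) - t a(t)
  increases.\<close>

lemma
  assumes f: "f \<in> borel_measurable M" and fin: "L1_plus_Linf_norm M f < \<infinity>" and t: "0 < t"
  shows max_rearr_le_double: "max_rearr M f t \<le> max_rearr M f (2 * t) + osc M f (2 * t)"
    and osc_le_double: "t \<le> s \<Longrightarrow> s \<le> 2 * t \<Longrightarrow> osc M f t \<le> 2 * osc M f s"
    and max_rearr_antimono: "t \<le> s \<Longrightarrow> max_rearr M f s \<le> max_rearr M f t"
    and max_rearr_le_two: "t \<le> s \<Longrightarrow> s \<le> 2 * t \<Longrightarrow> max_rearr M f t \<le> 2 * max_rearr M f s"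
    and rearr_le_max_rearr: "rearr M f t \<le> max_rearr M f t"
proof -
  define a where "a s = enn2real (rearr M f s)" for s
  define F where "F s = enn2real (rearr_int M f s)" for s
  have a: "rearr M f s = ennreal (a s)" "0 \<le> a s" if "s > 0" for s
    using rearr_finite[OF f fin that] by (auto simp: a_def)
  have F: "rearr_int M f s = ennreal (F s)" "0 \<le> F s" if "s > 0" for s
    using rearr_int_finite[OF f fin that] by (auto simp: F_def)
  have ge: "F s + (u - s) * a u \<le> F u" if "0 < s" "s \<le> u" for s u
    using rearr_int_ge[OF f that] that a[of u] F[of u] F[of s]
    by (simp add: ennreal_mult[symmetric] ennreal_plus[symmetric] del: ennreal_plus)
  have le: "F u \<le> F s + (u - s) * a s" if "0 < s" "s \<le> u" for s u
    using rearr_int_le[OF f that] that a[of s] F[of u] F[of s]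
    by (simp add: ennreal_mult[symmetric] ennreal_plus[symmetric] del: ennreal_plus)
  have ge0: "s * a s \<le> F s" if "0 < s" for s
    using rearr_int_ge0[OF f that] that a[of s] F[of s]
    by (simp add: ennreal_mult[symmetric])
  have am: "a u \<le> a s" if "0 < s" "s \<le> u" for s u
    using rearr_antimono[OF that(2), of M f] a[of s] a[of u] that by simp
  have m: "max_rearr M f s = ennreal (F s / s)" if "s > 0" for s
    using F[OF that] that by (simp add: max_rearr_eq divide_ennreal)
  have o: "osc M f s = ennreal (F s / s - a s)" if "s > 0" for s
    using m[OF that] a[OF that] ge0[OF that] that by (simp add: osc_def ennreal_minus)
  have onn: "0 \<le> F s / s - a s" if "s > 0" for s
    using ge0[OF that] that by (simp add: field_simps)
  have "F t / t \<le> F (2*t) / (2*t) + (F (2*t) / (2*t) - a (2*t))"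
    using ge[of t "2*t"] t by (simp add: field_simps)
  then have "ennreal (F t / t) \<le> ennreal (F (2*t) / (2*t)) + ennreal (F (2*t) / (2*t) - a (2*t))"
    using t onn[of "2*t"] F[of "2*t"] by (subst ennreal_plus[symmetric]) (auto intro!: ennreal_leI)
  then show "max_rearr M f t \<le> max_rearr M f (2 * t) + osc M f (2 * t)"
    using m[of t] m[of "2 * t"] o[of "2 * t"] t by (simp del: ennreal_plus)
  show "osc M f t \<le> 2 * osc M f s" if "t \<le> s" "s \<le> 2 * t"
  proof -
    have "t * a s \<le> t * a t" using am[OF t that(1)] t by simp
    then have *: "F t - t * a t \<le> F s - s * a s" using ge[OF t that(1)] by (simp add: algebra_simps)
    have "F t / t - a t = (F t - t * a t) / t" using t by (simp add: field_simps)
    also have "\<dots> \<le> (F s - s * a s) / t"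
      using t * by (intro divide_right_mono) auto
    also have "\<dots> \<le> (F s - s * a s) / (s / 2)"
      using t that ge0[of s] by (intro divide_left_mono) auto
    also have "\<dots> = 2 * (F s / s - a s)" using t that by (simp add: field_simps)
    finally have "F t / t - a t \<le> 2 * (F s / s - a s)" .
    then show ?thesis using o[of t] o[of s] onn[of s] that t
      by (simp add: ennreal_mult''[symmetric] flip: ennreal_numeral)
  qed
  show "max_rearr M f s \<le> max_rearr M f t" if "t \<le> s"
  proof -
    have "t * (F t + (s - t) * a t) \<le> s * F t"
      using mult_left_mono[OF ge0[OF t], of "s - t"] that by (simp add: algebra_simps)
    then have "t * F s \<le> s * F t" using mult_left_mono[OF le[OF t that], of t] t by linarith
    then have "F s / s \<le> F t / t" using t that by (simp add: field_simps)
    then show ?thesis using m t that F by simp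
  qed
  show "max_rearr M f t \<le> 2 * max_rearr M f s" if "t \<le> s" "s \<le> 2 * t"
  proof -
    have "F t \<le> F s" using ge[OF t that(1)] a[of s] that t
      by (smt (verit) mult_nonneg_nonneg)
    then have "s * F t \<le> 2 * t * F s" using that t F by (intro mult_mono) auto
    then have "F t / t \<le> 2 * (F s / s)" using t that by (simp add: field_simps)
    then show ?thesis using m[of t] m[of s] F[of s] that t
      by (simp add: ennreal_mult''[symmetric] flip: ennreal_numeral)
  qed
  show "rearr M f t \<le> max_rearr M f t" using onn[OF t] m[OF t] a[OF t] by simp
qed

lemma max_rearr_le_sum_osc:
  assumes f: "f \<in> borel_measurable M" and fin: "L1_plus_Linf_norm M f < \<infinity>" and t: "0 < t"
  shows "max_rearr M f t \<le> max_rearr M f (2 ^ J * t) + (\<Sum>j=1..J. osc M f (2 ^ j * t))"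
proof (induction J)
  case (Suc J)
  have "max_rearr M f (2 ^ J * t) \<le> max_rearr M f (2 ^ Suc J * t) + osc M f (2 ^ Suc J * t)"
    using max_rearr_le_double[OF f fin, of "2 ^ J * t"] t by (simp add: mult.assoc)
  then have "max_rearr M f (2 ^ J * t) + (\<Sum>j=1..J. osc M f (2 ^ j * t))
    \<le> (max_rearr M f (2 ^ Suc J * t) + osc M f (2 ^ Suc J * t)) + (\<Sum>j=1..J. osc M f (2 ^ j * t))"
    by (rule add_right_mono)
  also have "\<dots> = max_rearr M f (2 ^ Suc J * t) + (\<Sum>j=1..Suc J. osc M f (2 ^ j * t))"
    by (simp add: ac_simps)
  finally show ?case using Suc by (rule order_trans[rotated])
qed simp

section \<open>Layer cake formula and integrals over sets\<close>

lemma nn_integral_layer_cake: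
  assumes "sigma_finite_measure M" and [measurable]: "f \<in> borel_measurable M"
  shows "(\<integral>\<^sup>+ x. f x \<partial>M)
    = (\<integral>\<^sup>+ l. emeasure M {x \<in> space M. ennreal l < f x} * indicator {0..} l \<partial>lborel)"
proof -
  interpret sigma_finite_measure M by fact
  interpret pair_sigma_finite lborel M ..
  have *: "f x = (\<integral>\<^sup>+ l. indicator {l. 0 \<le> l \<and> ennreal l < f x} l \<partial>lborel)" for x
  proof (cases "f x")
    case (real r)
    then have "{l. 0 \<le> l \<and> ennreal l < f x} = {0..<r}" by (auto simp: ennreal_less_iff)
    then show ?thesis using real by simp
  next
    case top
    then have "{l::real. 0 \<le> l \<and> ennreal l < f x} = {0..}" by auto
    moreover have "emeasure lborel {0::real..} = top"
    proof (rule ccontr)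
      assume "emeasure lborel {0::real..} \<noteq> top"
      then obtain r where r: "emeasure lborel {0::real..} = ennreal r" "0 \<le> r"
        by (cases "emeasure lborel {0::real..}") auto
      have "emeasure lborel {0..r + 1} \<le> emeasure lborel {0::real..}"
        by (intro emeasure_mono) auto
      then show False using r by simp
    qed
    ultimately show ?thesis using top by simp
  qed
  have [measurable]: "{l. 0 \<le> l \<and> ennreal l < f x} \<in> sets borel" for x by measurable
  have "(\<integral>\<^sup>+ x. f x \<partial>M)
      = (\<integral>\<^sup>+ x. (\<integral>\<^sup>+ l. indicator {l. 0 \<le> l \<and> ennreal l < f x} l \<partial>lborel) \<partial>M)"
    by (subst *) simp
  also have "\<dots> = (\<integral>\<^sup>+ l. (\<integral>\<^sup>+ x. indicator {l. 0 \<le> l \<and> ennreal l < f x} l \<partial>M) \<partial>lborel)"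
  proof (rule Fubini')
    have "(\<lambda>(l, x). indicator {l. 0 \<le> l \<and> ennreal l < f x} l :: ennreal)
       = (\<lambda>p. if 0 \<le> fst p \<and> ennreal (fst p) < f (snd p) then 1 else 0)"
      by (auto simp: fun_eq_iff indicator_def)
    moreover have "(\<lambda>p. if 0 \<le> fst p \<and> ennreal (fst p) < f (snd p) then 1 else 0 :: ennreal)
        \<in> borel_measurable (lborel \<Otimes>\<^sub>M M)"
      by measurable
    ultimately show "(\<lambda>(l, x). indicator {l. 0 \<le> l \<and> ennreal l < f x} l :: ennreal)
        \<in> borel_measurable (lborel \<Otimes>\<^sub>M M)"
      by (simp only:)
  qed
  also have "\<dots> = (\<integral>\<^sup>+ l. emeasure M {x \<in> space M. ennreal l < f x} * indicator {0..} l \<partial>lborel)"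
  proof (intro nn_integral_cong)
    fix l :: real
    have "(\<integral>\<^sup>+ x. indicator {l. 0 \<le> l \<and> ennreal l < f x} l \<partial>M)
      = (\<integral>\<^sup>+ x. indicator {x \<in> space M. ennreal l < f x} x * indicator {0..} l \<partial>M)"
      by (intro nn_integral_cong) (auto simp: indicator_def)
    also have "\<dots> = emeasure M {x \<in> space M. ennreal l < f x} * indicator {0..} l"
      by (subst nn_integral_multc) auto
    finally show "(\<integral>\<^sup>+ x. indicator {l. 0 \<le> l \<and> ennreal l < f x} l \<partial>M) = \<dots>" .
  qed
  finally show ?thesis .
qed

text \<open>The layer cake formula on both sides leaves distribution functions to compare at each
  level l: the left one is at most the minimum of \<open>a\<close> and the measure of the set where
  f > l, and this minimum is the length of the interval of all s < a with f*(s) > l.\<close>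

theorem hardy_littlewood_set:
  assumes "sigma_finite_measure M" and f [measurable]: "f \<in> borel_measurable M"
    and A [measurable]: "A \<in> sets M" and a: "emeasure M A = ennreal a" "0 \<le> a"
  shows "(\<integral>\<^sup>+ x\<in>A. f x \<partial>M) \<le> rearr_int M f a"
proof -
  have "(\<integral>\<^sup>+ x\<in>A. f x \<partial>M) = (\<integral>\<^sup>+ l. emeasure M {x \<in> space M. ennreal l < f x * indicator A x} * indicator {0..} l \<partial>lborel)"
    by (rule nn_integral_layer_cake[OF assms(1)]) measurable
  also have "\<dots> \<le> (\<integral>\<^sup>+ l. emeasure lborel {s \<in> space lborel. ennreal l < rearr M f s * indicator {0<..<a} s} * indicator {0..} l \<partial>lborel)"
  proof (intro nn_integral_mono mult_right_mono)
    fix l :: real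
    let ?D = "emeasure M {x \<in> space M. ennreal l < f x}"
    have eq: "{s \<in> space lborel. ennreal l < rearr M f s * indicator {0<..<a} s}
      = {s. 0 < s \<and> s < a \<and> ennreal s < ?D}"
      by (auto simp: less_rearr_iff[OF f] indicator_def)
    have 1: "emeasure M {x \<in> space M. ennreal l < f x * indicator A x} \<le> ?D"
      by (intro emeasure_mono) (auto simp: indicator_def split: if_splits)
    have 2: "emeasure M {x \<in> space M. ennreal l < f x * indicator A x} \<le> ennreal a"
      unfolding a(1)[symmetric] by (intro emeasure_mono) (auto simp: indicator_def split: if_splits)
    show "emeasure M {x \<in> space M. ennreal l < f x * indicator A x}
      \<le> emeasure lborel {s \<in> space lborel. ennreal l < rearr M f s * indicator {0<..<a} s}"
    proof (cases "?D < ennreal a")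
      case True
      then obtain d where d: "?D = ennreal d" "0 \<le> d" by (cases ?D) auto
      then have "{s. 0 < s \<and> s < a \<and> ennreal s < ?D} = {0<..<d}"
        using True by (auto simp: ennreal_less_iff)
      then show ?thesis using d 1 eq by simp
    next
      case False
      then have "{s. 0 < s \<and> s < a \<and> ennreal s < ?D} = {0<..<a}"
        by (auto simp: ennreal_less_iff not_less intro: less_le_trans[of _ "ennreal a"])
      then show ?thesis using a 2 eq by simp
    qed
  qed auto
  also have "\<dots> = rearr_int M f a" unfolding rearr_int_def
    by (rule nn_integral_layer_cake[symmetric]) (auto intro: lborel.sigma_finite_measure_axioms)
  finally show ?thesis .
qed

section \<open>Geometry of non-collapsing RD-spaces\<close>

locale rd_noncollapsing =
  fixes M :: "'a::metric_space measure" and k n :: real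
  assumes RD: "RD_space M k n" and NC: "non_collapsing M"
begin

lemma space_M [simp]: "space M = UNIV"
  using RD by (simp add: RD_space_def metric_measure_space_def)

lemma borel_subset_M: "A \<in> sets borel \<Longrightarrow> A \<in> sets M"
  using RD by (auto simp: RD_space_def metric_measure_space_def)

lemma ball_sets [measurable]: "ball x r \<in> sets M"
  by (rule borel_subset_M) simp

lemma singleton_null: "emeasure M {x} = 0"
  using RD by (auto simp: RD_space_def metric_measure_space_def)

lemma k_pos: "0 < k" and k_le_n: "k \<le> n" and n_pos: "0 < n"
  using RD by (auto simp: RD_space_def)

lemma emeasure_ball: "emeasure M (ball x r) = ennreal (measure M (ball x r))"
proof (cases "r > 0")
  case True
  then show ?thesis using RD
    by (intro emeasure_eq_ennreal_measure) (auto simp: RD_space_def metric_measure_space_def less_top)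
qed (simp add: ball_empty not_less)

lemma emeasure_ball_fin: "emeasure M (ball x r) < \<infinity>"
  by (simp add: emeasure_ball)

lemma measure_ball_pos: "r > 0 \<Longrightarrow> 0 < measure M (ball x r)"
proof -
  assume "r > 0"
  then have "0 < emeasure M (ball x r)" using RD by (simp add: RD_space_def metric_measure_space_def)
  then show ?thesis by (simp add: emeasure_ball)
qed

lemma measure_ball_mono: "ball x r \<subseteq> ball y s \<Longrightarrow> measure M (ball x r) \<le> measure M (ball y s)"
  using emeasure_mono[of "ball x r" "ball y s" M] ball_sets by (simp add: emeasure_ball)

lemma RD_constants:
  obtains C1 C2 c0 where "0 < C1" "C1 \<le> 1" "1 \<le> C2" "0 < c0"
    "\<And>x r l. r > 0 \<Longrightarrow> l \<ge> 1 \<Longrightarrow> C1 * l powr k * measure M (ball x r) \<le> measure M (ball x (l * r))"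
    "\<And>x r l. r > 0 \<Longrightarrow> l \<ge> 1 \<Longrightarrow> measure M (ball x (l * r)) \<le> C2 * l powr n * measure M (ball x r)"
    "\<And>x. c0 \<le> measure M (ball x 1)"
proof -
  let ?I = "INF x. emeasure M (ball x 1)"
  have I: "0 < ?I" using NC by (simp add: non_collapsing_def)
  have le: "?I \<le> ennreal (measure M (ball x 1))" for x
    using INF_lower[of x UNIV "\<lambda>x. emeasure M (ball x 1)"] by (simp add: emeasure_ball)
  then have "?I < \<infinity>" using le_less_trans ennreal_less_top unfolding infinity_ennreal_def by metis
  then obtain c0 where c0: "?I = ennreal c0" "0 \<le> c0" by (cases ?I) auto
  then have "0 < c0" using I by (simp add: ennreal_less_zero_iff)
  moreover have "c0 \<le> measure M (ball x 1)" for x using le[of x] c0 by simp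
  ultimately show ?thesis using RD that unfolding RD_space_def by blast
qed

text \<open>Small t: the upper growth bound from radius t^(1/n) to 1 gives measure at least c0 t /
  C2. Large t: the lower growth bound from 1 to t^(1/k) gives at least C1 c0 t. This is why n
  governs small and k large scales. A further enlargement by A raises the constant to 2.\<close>

lemma ball_measure_lower:
  obtains A where "A \<ge> 1"
    "\<And>x t. 0 < t \<Longrightarrow> t \<le> 1 \<Longrightarrow> 2 * t \<le> measure M (ball x (A * t powr (1 / n)))"
    "\<And>x t. 1 \<le> t \<Longrightarrow> 2 * t \<le> measure M (ball x (A * t powr (1 / k)))"
proof -
  obtain C1 C2 c0 where C: "0 < C1" "C1 \<le> 1" "1 \<le> C2" "0 < c0"
    and lo: "\<And>x r l. r > 0 \<Longrightarrow> l \<ge> 1 \<Longrightarrow> C1 * l powr k * measure M (ball x r) \<le> measure M (ball x (l * r))"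
    and up: "\<And>x r l. r > 0 \<Longrightarrow> l \<ge> 1 \<Longrightarrow> measure M (ball x (l * r)) \<le> C2 * l powr n * measure M (ball x r)"
    and nc: "\<And>x. c0 \<le> measure M (ball x 1)" by (rule RD_constants) blast
  \<comment> \<open>The lower growth bound multiplies measures by C1 A^k. Small t then needs C1 A^k
    c0 / C2 >= 2 and large t needs C1^2 A^k c0 >= 2; this A serves both because C1 <= 1 <=
    C2.\<close>
  define A where "A = max 1 ((2 * C2 / (C1 * C1 * c0)) powr (1 / k))"
  have A1: "A \<ge> 1" by (simp add: A_def)
  have "(2 * C2 / (C1 * C1 * c0)) = ((2 * C2 / (C1 * C1 * c0)) powr (1 / k)) powr k"
    using C k_pos by (simp add: powr_powr)
  also have "\<dots> \<le> A powr k" using k_pos by (intro powr_mono2) (auto simp: A_def)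
  finally have Ak: "2 * C2 \<le> C1 * C1 * A powr k * c0" using C by (simp add: field_simps)
  show ?thesis
  proof (rule that[OF A1])
    fix x and t :: real assume t: "0 < t" "t \<le> 1"
    define r where "r = t powr (1 / n)"
    have r: "0 < r" "r \<le> 1" using t n_pos by (auto simp: r_def powr_le1)
    have "(1 / r) powr n = 1 / t" using t n_pos by (simp add: r_def powr_divide powr_powr)
    then have "c0 \<le> C2 * (1 / t) * measure M (ball x r)"
      using up[of r "1 / r" x] nc[of x] r by simp
    then have "c0 * t \<le> C2 * measure M (ball x r)" using t by (simp add: field_simps)
    then have "C1 * A powr k * (c0 * t) \<le> C1 * A powr k * (C2 * measure M (ball x r))"
      using C by (intro mult_left_mono) auto
    also have "\<dots> = C2 * (C1 * A powr k * measure M (ball x r))" by simp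
    also have "\<dots> \<le> C2 * measure M (ball x (A * r))"
      using lo[OF r(1) A1, of x] C by (intro mult_left_mono) auto
    finally have 1: "C1 * A powr k * (c0 * t) \<le> C2 * measure M (ball x (A * r))" .
    have "2 * C2 * t \<le> C1 * (C1 * A powr k * (c0 * t))"
      using mult_right_mono[OF Ak, of t] t by (simp add: ac_simps)
    also have "\<dots> \<le> 1 * (C1 * A powr k * (c0 * t))" using C t by (intro mult_right_mono) auto
    finally have "C2 * (2 * t) \<le> C2 * measure M (ball x (A * r))" using 1 by simp
    then show "2 * t \<le> measure M (ball x (A * t powr (1 / n)))"
      using C by (simp add: r_def)
  next
    fix x and t :: real assume t: "1 \<le> t"
    define r where "r = t powr (1 / k)"
    have r: "1 \<le> r" using t k_pos by (auto simp: r_def ge_one_powr_ge_zero)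
    have "r powr k = t" using t k_pos by (simp add: r_def powr_powr)
    then have "C1 * t * measure M (ball x 1) \<le> measure M (ball x r)"
      using lo[of 1 r x] r by simp
    moreover have "C1 * t * c0 \<le> C1 * t * measure M (ball x 1)"
      using nc[of x] C t by (intro mult_left_mono) auto
    ultimately have "C1 * t * c0 \<le> measure M (ball x r)" by simp
    then have "C1 * A powr k * (C1 * t * c0) \<le> C1 * A powr k * measure M (ball x r)"
      using C by (intro mult_left_mono) auto
    also have "\<dots> \<le> measure M (ball x (A * r))" using lo[of r A x] A1 r by simp
    finally have 1: "C1 * C1 * A powr k * c0 * t \<le> measure M (ball x (A * r))" by (simp add: ac_simps)
    have "2 * t \<le> 2 * C2 * t" using C t by simp
    also have "\<dots> \<le> C1 * C1 * A powr k * c0 * t" using mult_right_mono[OF Ak, of t] t by simp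
    finally show "2 * t \<le> measure M (ball x (A * t powr (1 / k)))"
      using 1 by (simp add: r_def)
  qed
qed

lemma ball_measure_dilate:
  assumes "l \<ge> 1"
  obtains D where "D \<ge> 1" "\<And>x r. r > 0 \<Longrightarrow> measure M (ball x (l * r)) \<le> D * measure M (ball x r)"
proof -
  obtain C1 C2 c0 where C: "1 \<le> C2"
    and up: "\<And>x r l. r > 0 \<Longrightarrow> l \<ge> 1 \<Longrightarrow> measure M (ball x (l * r)) \<le> C2 * l powr n * measure M (ball x r)"
    by (rule RD_constants) blast
  have "l powr n \<ge> 1" using assms n_pos by (intro ge_one_powr_ge_zero) auto
  then have "1 \<le> C2 * l powr n" using C mult_mono[of 1 C2 1 "l powr n"] by simp
  then show ?thesis using up[OF _ assms] by (rule that)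
qed

text \<open>A ball of measure at most 1 cannot have radius above a constant R, since the lower
  growth bound starts from unit balls of measure at least c0. The upper growth bound from r to R
  then bounds r^n by a multiple of the measure.\<close>

lemma radius_le_measure:
  obtains K where "K > 0" "\<And>x r. r > 0 \<Longrightarrow> measure M (ball x r) \<le> 1 \<Longrightarrow> r \<le> K * measure M (ball x r) powr (1 / n)"
proof -
  obtain C1 C2 c0 where C: "0 < C1" "C1 \<le> 1" "1 \<le> C2" "0 < c0"
    and lo: "\<And>x r l. r > 0 \<Longrightarrow> l \<ge> 1 \<Longrightarrow> C1 * l powr k * measure M (ball x r) \<le> measure M (ball x (l * r))"
    and up: "\<And>x r l. r > 0 \<Longrightarrow> l \<ge> 1 \<Longrightarrow> measure M (ball x (l * r)) \<le> C2 * l powr n * measure M (ball x r)"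
    and nc: "\<And>x. c0 \<le> measure M (ball x 1)" by (rule RD_constants) blast
  define R where "R = max 1 ((1 / (C1 * c0)) powr (1 / k))"
  have R1: "1 \<le> R" by (simp add: R_def)
  have rR: "r \<le> R" if "r > 0" "measure M (ball x r) \<le> 1" for x r
  proof (cases "r \<le> 1")
    case False
    then have "C1 * r powr k * c0 \<le> C1 * r powr k * measure M (ball x 1)"
      using C nc[of x] by (intro mult_left_mono) auto
    also have "\<dots> \<le> 1" using lo[of 1 r x] False that by simp
    finally have "r powr k \<le> 1 / (C1 * c0)" using C by (simp add: field_simps)
    then have "(r powr k) powr (1 / k) \<le> (1 / (C1 * c0)) powr (1 / k)"
      using k_pos by (intro powr_mono2) auto
    then show ?thesis using that k_pos by (simp add: powr_powr R_def)
  qed (use R1 in simp)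
  have *: "c0 * r powr n \<le> C2 * R powr n * measure M (ball x r)" if r: "r > 0" "measure M (ball x r) \<le> 1" for x r
  proof -
    have "measure M (ball x 1) \<le> measure M (ball x R)" using R1 by (intro measure_ball_mono subset_ball)
    then have "c0 \<le> measure M (ball x R)" using nc[of x] by simp
    also have "\<dots> \<le> C2 * (R / r) powr n * measure M (ball x r)"
      using up[of r "R / r" x] rR[OF r] r by simp
    finally show ?thesis using r R1 by (simp add: powr_divide field_simps)
  qed
  define K where "K = (C2 * R powr n / c0) powr (1 / n)"
  show ?thesis
  proof (rule that)
    show "K > 0" using C R1 by (simp add: K_def)
    fix x and r :: real assume r: "r > 0" "measure M (ball x r) \<le> 1"
    have "r powr n \<le> C2 * R powr n / c0 * measure M (ball x r)" using *[OF r] C by (simp add: field_simps)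
    then have "(r powr n) powr (1 / n) \<le> (C2 * R powr n / c0 * measure M (ball x r)) powr (1 / n)"
      using n_pos by (intro powr_mono2) auto
    also have "\<dots> = K * measure M (ball x r) powr (1 / n)"
      unfolding K_def by (rule powr_mult)
    finally show "r \<le> K * measure M (ball x r) powr (1 / n)"
      using r n_pos by (simp add: powr_powr)
  qed
qed

text \<open>The total mass is infinite, which is what later provides sets of arbitrarily large
  prescribed measure.\<close>

lemma large_ball:
  obtains x r where "r > 0" "T \<le> measure M (ball x r)"
proof -
  obtain A where A: "A \<ge> 1" "\<And>x t. 1 \<le> t \<Longrightarrow> 2 * t \<le> measure M (ball x (A * t powr (1 / k)))"
    by (rule ball_measure_lower) blast
  have "2 * max 1 T \<le> measure M (ball undefined (A * (max 1 T) powr (1 / k)))"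
    by (rule A) simp
  moreover have "T \<le> 2 * max 1 T" by linarith
  moreover have "A * (max 1 T) powr (1 / k) > 0" using A by simp
  ultimately show ?thesis using that by (meson order_trans)
qed

lemma sigma_finite_M: "sigma_finite_measure M"
proof
  let ?A = "range (\<lambda>i::nat. ball (undefined::'a) (real i))"
  have "\<Union>?A = UNIV"
  proof (intro equalityI subsetI)
    fix y :: 'a assume "y \<in> UNIV"
    obtain i :: nat where "dist undefined y < real i" using reals_Archimedean2 by blast
    then show "y \<in> \<Union>?A" by auto
  qed simp
  then show "\<exists>A. countable A \<and> A \<subseteq> sets M \<and> \<Union>A = space M \<and> (\<forall>a\<in>A. emeasure M a \<noteq> \<infinity>)"
    using emeasure_ball_fin by (intro exI[of _ ?A]) (auto simp: less_top[symmetric])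
qed

section \<open>Separability and measurability of ball averages\<close>

lemma ball_measure_uniform:
  assumes "e > 0"
  obtains c where "c > 0" "\<And>x. c \<le> measure M (ball x e)"
proof -
  obtain C1 C2 c0 where C: "1 \<le> C2" "0 < c0"
    and up: "\<And>x r l. r > 0 \<Longrightarrow> l \<ge> 1 \<Longrightarrow> measure M (ball x (l * r)) \<le> C2 * l powr n * measure M (ball x r)"
    and nc: "\<And>x. c0 \<le> measure M (ball x 1)" by (rule RD_constants) blast
  define e' where "e' = min e 1"
  have e': "0 < e'" "e' \<le> 1" using assms by (auto simp: e'_def)
  show ?thesis
  proof (rule that)
    show "c0 / (C2 * (1 / e') powr n) > 0" using C e' by simp
    fix x
    have "c0 \<le> C2 * (1 / e') powr n * measure M (ball x e')"
      using up[of e' "1 / e'" x] nc[of x] e' by simp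
    then have "c0 / (C2 * (1 / e') powr n) \<le> measure M (ball x e')"
      using C e' by (simp add: field_simps)
    also have "\<dots> \<le> measure M (ball x e)" by (rule measure_ball_mono) (auto simp: e'_def)
    finally show "c0 / (C2 * (1 / e') powr n) \<le> measure M (ball x e)" .
  qed
qed

text \<open>A maximal separated subset of a ball exists since its balls of fixed radius are disjoint and
  have measure bounded below.\<close>

lemma finite_net:
  assumes "e > 0"
  obtains S :: "'a set" where "finite S" "\<And>x. x \<in> ball z R \<Longrightarrow> \<exists>y\<in>S. dist x y < e"
proof -
  obtain c where c: "c > 0" "\<And>x. c \<le> measure M (ball x (e / 2))"
    using ball_measure_uniform[of "e / 2"] assms by auto
  define P where "P S \<longleftrightarrow> finite S \<and> S \<subseteq> ball z R \<and> (\<forall>x\<in>S. \<forall>y\<in>S. x \<noteq> y \<longrightarrow> e \<le> dist x y)" for S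
  have bound: "real (card S) * c \<le> measure M (ball z (R + e))" if "P S" for S
  proof -
    have fin: "finite S" using that by (simp add: P_def)
    have dj: "disjoint_family_on (\<lambda>x. ball x (e / 2)) S"
    proof (unfold disjoint_family_on_def, intro ballI impI equals0I)
      fix x y w assume *: "x \<in> S" "y \<in> S" "x \<noteq> y" "w \<in> ball x (e / 2) \<inter> ball y (e / 2)"
      then have "dist x y < e" using dist_triangle2[of x y w] by (auto simp: dist_commute)
      moreover have "e \<le> dist x y" using * that by (simp add: P_def)
      ultimately show False by simp
    qed
    have "real (card S) * c = (\<Sum>x\<in>S. c)" by simp
    also have "\<dots> \<le> (\<Sum>x\<in>S. measure M (ball x (e / 2)))" by (intro sum_mono c)
    also have "\<dots> = measure M (\<Union>x\<in>S. ball x (e / 2))"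
      using fin dj emeasure_ball_fin by (intro measure_finite_Union[symmetric]) (auto simp: less_top)
    also have "\<dots> \<le> measure M (ball z (R + e))"
    proof -
      have "(\<Union>x\<in>S. ball x (e / 2)) \<subseteq> ball z (R + e)"
      proof
        fix w assume "w \<in> (\<Union>x\<in>S. ball x (e / 2))"
        then obtain x where x: "x \<in> S" "dist x w < e / 2" by auto
        then have "dist z x < R" using that by (auto simp: P_def)
        then show "w \<in> ball z (R + e)" using x dist_triangle[of z w x] assms by simp
      qed
      then show ?thesis using emeasure_ball_fin[of z "R + e"] fin
        by (intro measure_mono_fmeasurable) (auto simp: fmeasurable_def)
    qed
    finally show ?thesis .
  qed
  have "\<exists>S. P S \<and> (\<forall>T. P T \<longrightarrow> card T \<le> card S)"
  proof (rule ex_has_greatest_nat)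
    show "P {}" by (simp add: P_def)
    show "\<forall>T. P T \<longrightarrow> card T < Suc (nat \<lceil>measure M (ball z (R + e)) / c\<rceil>)"
    proof (intro allI impI)
      fix T assume "P T"
      then have "real (card T) \<le> measure M (ball z (R + e)) / c" using bound[of T] c by (simp add: field_simps)
      then show "card T < Suc (nat \<lceil>measure M (ball z (R + e)) / c\<rceil>)" by linarith
    qed
  qed
  then obtain S where S: "P S" and max: "\<And>T. P T \<Longrightarrow> card T \<le> card S" by blast
  show ?thesis
  proof (rule that)
    show "finite S" using S by (simp add: P_def)
    fix x assume x: "x \<in> ball z R"
    show "\<exists>y\<in>S. dist x y < e"
    proof (rule ccontr)
      assume no: "\<not> (\<exists>y\<in>S. dist x y < e)"
      then have "x \<notin> S" using assms by force
      moreover have "P (insert x S)" using S x no by (auto simp: P_def dist_commute not_less)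
      ultimately show False using max[of "insert x S"] S by (simp add: P_def)
    qed
  qed
qed

text \<open>The union of finite nets of mesh 1/(j+1) for the balls of radius i around one
  point.\<close>

lemma countable_dense:
  obtains D :: "'a set" where "countable D" "D \<noteq> {}" "\<And>x e. e > 0 \<Longrightarrow> \<exists>d\<in>D. dist x d < e"
proof -
  have "\<exists>S. finite S \<and> (\<forall>x \<in> ball (undefined::'a) (real i). \<exists>y\<in>S. dist x y < 1 / real (Suc j))" for i j :: nat
  proof -
    have "0 < 1 / real (Suc j)" by simp
    then obtain S :: "'a set" where "finite S" "\<And>x. x \<in> ball undefined (real i) \<Longrightarrow> \<exists>y\<in>S. dist x y < 1 / real (Suc j)"
      using finite_net[of "1 / real (Suc j)" undefined "real i"] by blast
    then show ?thesis by blast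
  qed
  then obtain S where S: "\<And>i j. finite (S i j)"
    "\<And>i j x. x \<in> ball (undefined::'a) (real i) \<Longrightarrow> \<exists>y\<in>S i j. dist x y < 1 / real (Suc j)" by metis
  define D where "D = (\<Union>i. \<Union>j. S i j)"
  have dense: "\<exists>d\<in>D. dist x d < e" if e: "e > 0" for x e
  proof -
    obtain i :: nat where "dist undefined x < real i" using reals_Archimedean2 by blast
    then have "x \<in> ball undefined (real i)" by simp
    moreover obtain j :: nat where j: "1 / real (Suc j) < e" using e by (rule nat_approx_posE)
    ultimately obtain y where "y \<in> S i j" "dist x y < 1 / real (Suc j)" using S(2) by blast
    then show ?thesis using j unfolding D_def by (intro bexI[of _ y]) auto
  qed
  show ?thesis
  proof (rule that[OF _ _ dense])
    show "countable D" unfolding D_def using S(1) by (intro countable_UN) (auto intro: countable_finite)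
    show "D \<noteq> {}" using dense[of 1] by auto
  qed
qed

text \<open>On a general metric space the product of the Borel sigma-algebras can miss open subsets
  of the product. With a countable dense set this one is a countable union of products of balls B(d,
  q) and B(d, t - q) with rational q.\<close>

lemma dist_less_sets [measurable]: "{p. dist (fst p) (snd p) < t} \<in> sets (M \<Otimes>\<^sub>M M)"
proof -
  obtain D :: "'a set" where D: "countable D" "\<And>x e. e > 0 \<Longrightarrow> \<exists>d\<in>D. dist x d < e"
    by (rule countable_dense) blast
  have "{p :: 'a \<times> 'a. dist (fst p) (snd p) < t} = (\<Union>d\<in>D. \<Union>q\<in>\<rat>. ball d q \<times> ball d (t - q))"
  proof (intro equalityI subsetI)
    fix p :: "'a \<times> 'a" assume "p \<in> {p. dist (fst p) (snd p) < t}"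
    then have lt: "dist (fst p) (snd p) < t" by simp
    \<comment> \<open>Thirds: the dense point d lies within e of the first point and the rational q
      is below e, which leaves room in t - q for the distance from d to the second point.\<close>
    define e where "e = (t - dist (fst p) (snd p)) / 3"
    have "e > 0" using lt by (simp add: e_def)
    then obtain d where d: "d \<in> D" "dist (fst p) d < e" using D by blast
    obtain q where q: "q \<in> \<rat>" "dist (fst p) d < q" "q < e" using Rats_dense_in_real[OF d(2)] by blast
    have "dist d (snd p) \<le> dist (fst p) d + dist (fst p) (snd p)" by (metis dist_commute dist_triangle2 dist_triangle)
    also have "\<dots> < e + (t - 3 * e)"
    proof -
      have "dist (fst p) (snd p) = t - 3 * e" by (simp add: e_def field_simps)
      then show ?thesis using d by linarith
    qed
    also have "\<dots> < t - q" using q \<open>e > 0\<close> by simp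
    finally have "p \<in> ball d q \<times> ball d (t - q)" using q by (cases p) (auto simp: dist_commute)
    then show "p \<in> (\<Union>d\<in>D. \<Union>q\<in>\<rat>. ball d q \<times> ball d (t - q))" using d q by blast
  next
    fix p :: "'a \<times> 'a" assume "p \<in> (\<Union>d\<in>D. \<Union>q\<in>\<rat>. ball d q \<times> ball d (t - q))"
    then obtain d q where "dist d (fst p) < q" "dist d (snd p) < t - q" by (cases p) auto
    then show "p \<in> {p. dist (fst p) (snd p) < t}" using dist_triangle3[of "fst p" "snd p" d] by simp
  qed
  also have "\<dots> \<in> sets (M \<Otimes>\<^sub>M M)"
    using D countable_rat by (intro sets.countable_UN'' pair_measureI ball_sets) auto
  finally show ?thesis .
qed

lemma ball_indicator_measurable [measurable]:
  "(\<lambda>p. indicator (ball (fst p) t) (snd p) :: ennreal) \<in> borel_measurable (M \<Otimes>\<^sub>M M)"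
proof -
  have "(\<lambda>p :: 'a \<times> 'a. indicator (ball (fst p) t) (snd p) :: ennreal) = indicator {p. dist (fst p) (snd p) < t}"
    by (auto simp: fun_eq_iff indicator_def)
  then show ?thesis by (simp only:) (intro borel_measurable_indicator dist_less_sets)
qed

text \<open>Numerator and denominator are integrals over sections of a kernel on the product,
  measurable by Fubini once the set of pairs at distance below t is.\<close>

lemma ball_average_measurable [measurable]:
  fixes f :: "'a \<Rightarrow> real"
  assumes [measurable]: "f \<in> borel_measurable M"
  shows "(\<lambda>x. (\<integral>\<^sup>+ y\<in>ball x t. ennreal \<bar>f x - f y\<bar> \<partial>M) / emeasure M (ball x t)) \<in> borel_measurable M"
proof -
  interpret sigma_finite_measure M by (rule sigma_finite_M)
  have "(\<lambda>x. \<integral>\<^sup>+ y. indicator (ball x t) y \<partial>M) \<in> borel_measurable M"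
    by (intro borel_measurable_nn_integral) (simp add: case_prod_beta')
  then have [measurable]: "(\<lambda>x. emeasure M (ball x t)) \<in> borel_measurable M" by simp
  have [measurable]: "(\<lambda>x. \<integral>\<^sup>+ y\<in>ball x t. ennreal \<bar>f x - f y\<bar> \<partial>M) \<in> borel_measurable M"
    by (intro borel_measurable_nn_integral) (simp add: case_prod_beta')
  show ?thesis by measurable
qed

section \<open>Sets of every prescribed measure\<close>

lemma separating_function:
  obtains \<Psi> :: "'a \<Rightarrow> real" where "\<Psi> \<in> borel_measurable M" "inj \<Psi>" "\<And>x. 0 \<le> \<Psi> x" "\<And>x. \<Psi> x \<le> 2"
proof -
  obtain D :: "'a set" where D: "countable D" "D \<noteq> {}" "\<And>x e. e > 0 \<Longrightarrow> \<exists>d\<in>D. dist x d < e"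
    by (rule countable_dense) blast
  define B where "B i = ball (from_nat_into D (fst (prod_decode i))) (1 / real (Suc (snd (prod_decode i))))" for i
  have B: "\<exists>i. x \<in> B i \<and> y \<notin> B i" if "x \<noteq> y" for x y
  proof -
    have "0 < dist x y / 2" using that by simp
    then obtain j where j: "1 / real (Suc j) < dist x y / 2" by (rule nat_approx_posE)
    obtain d where d: "d \<in> D" "dist x d < 1 / real (Suc j)" using D(3)[of "1 / real (Suc j)" x] by auto
    obtain i where i: "from_nat_into D i = d" using d D by (metis from_nat_into_surj)
    have "\<not> dist d y < 1 / real (Suc j)" using d(2) j dist_triangle[of x y d] by linarith
    then show ?thesis using d i by (intro exI[of _ "prod_encode (i, j)"]) (auto simp: B_def dist_commute)
  qed
  have [measurable]: "B i \<in> sets M" for i by (simp add: B_def)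
  \<comment> \<open>A point is coded by the balls that contain it and the code is read as a base 3
    expansion. With ratio 1/3, as in the Cantor set, the tail after the first differing digit i is
    at most half of 3^-i, so distinct codes give distinct values.\<close>
  define \<Psi> where "\<Psi> x = (\<Sum>i. (1 / 3 :: real) ^ i * indicator (B i) x)" for x
  have geo: "summable (\<lambda>i. (1 / 3 :: real) ^ i)" by simp
  have sm: "summable (\<lambda>i. (1 / 3 :: real) ^ i * indicator (B i) x)" for x
    by (rule summable_comparison_test'[OF geo]) (auto simp: indicator_def)
  show ?thesis
  proof (rule that)
    show "\<Psi> \<in> borel_measurable M" unfolding \<Psi>_def by measurable
    show "0 \<le> \<Psi> x" for x unfolding \<Psi>_def by (intro suminf_nonneg sm) auto
    show "\<Psi> x \<le> 2" for x
    proof -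
      have "\<Psi> x \<le> (\<Sum>i. (1 / 3 :: real) ^ i)" unfolding \<Psi>_def
        by (intro suminf_le sm geo) (auto simp: indicator_def)
      also have "\<dots> \<le> 2" by (simp add: suminf_geometric)
      finally show ?thesis .
    qed
    show "inj \<Psi>"
    proof (rule injI, rule ccontr)
      fix x y assume eq: "\<Psi> x = \<Psi> y" and ne: "x \<noteq> y"
      define d where "d i = indicator (B i) x - (indicator (B i) y :: real)" for i
      obtain i0 where "x \<in> B i0" "y \<notin> B i0" using B[OF ne] by blast
      then have "\<exists>i. d i \<noteq> 0" by (intro exI[of _ i0]) (simp add: d_def)
      define i where "i = (LEAST i. d i \<noteq> 0)"
      have di: "d i \<noteq> 0" unfolding i_def by (rule LeastI_ex) fact
      have lt: "d j = 0" if "j < i" for j using not_less_Least[of j "\<lambda>i. d i \<noteq> 0"] that by (auto simp: i_def)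
      have d1: "\<bar>d j\<bar> \<le> 1" for j by (auto simp: d_def indicator_def)
      have dabs: "\<bar>d i\<bar> = 1" using di by (auto simp: d_def indicator_def split: if_splits)
      have s: "summable (\<lambda>j. (1 / 3) ^ j * d j)"
        using summable_diff[OF sm[of x] sm[of y]] by (simp add: d_def algebra_simps)
      have "0 = (\<Sum>j. (1 / 3) ^ j * d j)"
        using eq suminf_diff[OF sm[of x] sm[of y]] by (simp add: \<Psi>_def d_def algebra_simps)
      also have "\<dots> = (\<Sum>j. (1 / 3) ^ (j + Suc i) * d (j + Suc i)) + (\<Sum>j<Suc i. (1 / 3) ^ j * d j)"
        by (rule suminf_split_initial_segment[OF s])
      also have "(\<Sum>j<Suc i. (1 / 3) ^ j * d j) = (1 / 3) ^ i * d i" using lt by simp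
      finally have "(\<Sum>j. (1 / 3) ^ (j + Suc i) * d (j + Suc i)) = - ((1 / 3) ^ i * d i)" by linarith
      then have "(1 / 3) ^ i = \<bar>\<Sum>j. (1 / 3) ^ (j + Suc i) * d (j + Suc i)\<bar>"
        using dabs by (simp add: abs_mult)
      also have "\<dots> \<le> (\<Sum>j. \<bar>(1 / 3) ^ (j + Suc i) * d (j + Suc i)\<bar>)"
      proof (rule summable_rabs)
        have "summable (\<lambda>j. (1 / 3 :: real) ^ (j + Suc i))" using geo by (rule summable_ignore_initial_segment)
        then show "summable (\<lambda>j. \<bar>(1 / 3) ^ (j + Suc i) * d (j + Suc i)\<bar>)"
          by (rule summable_comparison_test') (auto simp: abs_mult intro: mult_left_le d1)
      qed
      also have "\<dots> \<le> (\<Sum>j. (1 / 3) ^ (j + Suc i))"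
      proof (rule suminf_le)
        show 1: "summable (\<lambda>j. (1 / 3 :: real) ^ (j + Suc i))" using geo by (rule summable_ignore_initial_segment)
        then show "summable (\<lambda>j. \<bar>(1 / 3) ^ (j + Suc i) * d (j + Suc i)\<bar>)"
          by (rule summable_comparison_test') (auto simp: abs_mult intro: mult_left_le d1)
      qed (auto simp: abs_mult intro: mult_left_le d1)
      also have "\<dots> = (1 / 3) ^ Suc i * (\<Sum>j. (1 / 3) ^ j)"
        unfolding power_add using suminf_mult[OF geo, of "(1 / 3) ^ Suc i"] by (simp add: mult.commute)
      also have "\<dots> = (1 / 3) ^ i * (1 / 2)" by (simp add: suminf_geometric)
      finally show False by simp
    qed
  qed
qed

text \<open>Points are null, so the distribution of an injective function on a ball has no atoms and its
  distribution function takes every value.\<close>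

lemma nested_sets_of_measure:
  obtains U :: "real \<Rightarrow> 'a set" where
    "\<And>s. 0 \<le> s \<Longrightarrow> s \<le> T \<Longrightarrow> U s \<in> sets M" "\<And>s. 0 \<le> s \<Longrightarrow> s \<le> T \<Longrightarrow> emeasure M (U s) = ennreal s"
    "\<And>s t. 0 \<le> s \<Longrightarrow> s \<le> t \<Longrightarrow> t \<le> T \<Longrightarrow> U s \<subseteq> U t"
proof -
  obtain x r where B: "T \<le> measure M (ball x r)" using large_ball by blast
  define B where "B = ball x r"
  have [measurable]: "B \<in> sets M" by (simp add: B_def)
  obtain \<Psi> :: "'a \<Rightarrow> real" where \<Psi> [measurable]: "\<Psi> \<in> borel_measurable M"
    and inj: "inj \<Psi>" "\<And>x. 0 \<le> \<Psi> x" "\<And>x. \<Psi> x \<le> 2" by (rule separating_function) blast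
  \<comment> \<open>The distribution of \<Psi> on a ball of measure at least T. By injectivity each
    fibre has at most one point and is null; the values lie in [0, 2], so the distribution function
    runs continuously from 0 at -1 to the full measure at 2.\<close>
  define N where "N = distr (restrict_space M B) borel \<Psi>"
  have [measurable]: "\<Psi> \<in> borel_measurable (restrict_space M B)" by (rule measurable_restrict_space1) simp
  have em: "emeasure N A = emeasure M (B \<inter> \<Psi> -` A)" if A: "A \<in> sets borel" for A
  proof -
    have "\<Psi> -` A \<in> sets M" using measurable_sets[OF \<Psi> A] by simp
    then show ?thesis unfolding N_def using A
      by (simp add: emeasure_distr emeasure_restrict_space space_restrict_space Int_commute)
  qed
  have fin: "emeasure M B < \<infinity>" unfolding B_def by (rule emeasure_ball_fin)
  have "finite_measure N"
    using em[of UNIV] fin by (intro finite_measureI) (simp add: N_def less_top[symmetric])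
  then interpret N: finite_borel_measure N
    unfolding finite_borel_measure_def finite_borel_measure_axioms_def by (simp add: N_def)
  have "measure N {q} = 0" for q
  proof -
    obtain z where "B \<inter> \<Psi> -` {q} \<subseteq> {z}" using inj(1) by (auto dest: injD)
    then have "emeasure M (B \<inter> \<Psi> -` {q}) \<le> emeasure M {z}"
      by (intro emeasure_mono borel_subset_M) auto
    then show ?thesis using em[of "{q}"] singleton_null[of z] by (simp add: measure_def)
  qed
  then have cont: "isCont (cdf N) q" for q by (simp add: N.isCont_cdf)
  have lo: "cdf N (-1) = 0"
  proof -
    have "\<not> \<Psi> x \<le> - 1" for x using inj(2)[of x] by linarith
    then have "\<Psi> -` {..- 1} = {}" by auto
    then show ?thesis using em[of "{..-1}"] by (simp add: cdf_def measure_def)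
  qed
  have hi: "cdf N 2 = measure M B"
  proof -
    have "\<Psi> -` {..2} = UNIV" using inj(3) by auto
    then show ?thesis using em[of "{..2}"] by (simp add: cdf_def measure_def)
  qed
  have "\<exists>q. cdf N q = s" if "0 \<le> s" "s \<le> T" for s
    using IVT[of "cdf N" "-1" s 2] lo hi cont that B by (auto simp: B_def)
  then obtain q where q: "\<And>s. 0 \<le> s \<Longrightarrow> s \<le> T \<Longrightarrow> cdf N (q s) = s" by metis
  define U where "U s = B \<inter> \<Psi> -` {..q s}" for s
  show ?thesis
  proof (rule that)
    fix s assume s: "0 \<le> s" "s \<le> T"
    have "\<Psi> -` {..q s} \<in> sets M" using measurable_sets[OF \<Psi>, of "{..q s}"] by simp
    then show "U s \<in> sets M" by (simp add: U_def)
    show "emeasure M (U s) = ennreal s"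
      using q[OF s] em[of "{..q s}"] N.emeasure_eq_measure by (simp add: cdf_def U_def)
  next
    fix s t assume st: "0 \<le> s" "s \<le> t" "t \<le> T"
    \<comment> \<open>The levels q are arbitrary choices. For s < t they are still ordered, because
      the distribution function is monotone, and this nests the sets.\<close>
    have "q s \<le> q t \<or> s = t"
    proof (rule ccontr)
      assume "\<not> (q s \<le> q t \<or> s = t)"
      then have "cdf N (q t) \<le> cdf N (q s)" "s < t" using st by (auto intro: N.cdf_nondecreasing)
      then show False using q[of s] q[of t] st by simp
    qed
    then show "U s \<subseteq> U t" by (auto simp: U_def)
  qed
qed

end

section \<open>Fundamental functions and the modulus of smoothness\<close>

lemma add_mod_cancel_left:
  fixes i j j' N :: nat
  assumes "j < N" "j' < N" "(i + j) mod N = (i + j') mod N"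
  shows "j = j'"
proof -
  have "int N dvd int j - int j'"
    using assms(3) by (metis add_diff_cancel_left mod_eq_dvd_iff of_nat_add of_nat_mod)
  moreover have "\<bar>int j - int j'\<bar> < int N" using assms(1,2) by auto
  ultimately show ?thesis using zdvd_not_zless[of "\<bar>int j - int j'\<bar>" "int N"] by auto
qed

lemma sum_cyclic_shift:
  fixes f :: "nat \<Rightarrow> 'a::comm_monoid_add"
  shows "(\<Sum>j<N. f ((i + j) mod N)) = (\<Sum>j<N. f j)"
proof -
  have "inj_on (\<lambda>j. (i + j) mod N) {..<N}"
    by (rule inj_onI) (auto dest: add_mod_cancel_left)
  moreover have "(\<lambda>j. (i + j) mod N) ` {..<N} \<subseteq> {..<N}" by (cases "N = 0") auto
  ultimately have "bij_betw (\<lambda>j. (i + j) mod N) {..<N} {..<N}"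
    by (simp add: bij_betw_def endo_inj_surj)
  then show ?thesis by (rule sum.reindex_bij_betw)
qed

lemma rearr_indicator_ge_1:
  assumes [measurable]: "A \<in> sets M" and "ennreal s < emeasure M A"
  shows "1 \<le> rearr M (indicator A) s"
proof (rule dense_le)
  fix l :: ennreal assume l: "l < 1"
  have "{x \<in> space M. l < indicator A x} = A"
    using l sets.sets_into_space[OF assms(1)] by (auto simp: indicator_def split: if_splits)
  then have "l < rearr M (indicator A) s" using assms by (subst less_rearr_iff) auto
  then show "l \<le> rearr M (indicator A) s" by simp
qed

locale ri_on_rd = rd_noncollapsing M k n
  for M :: "'a::metric_space measure" and k n :: real +
  fixes X :: "('a \<Rightarrow> ennreal) \<Rightarrow> ennreal"
  assumes X: "ri_norm M X"
begin

abbreviation "\<phi> \<equiv> fund_fun M X"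

lemma X_mono:
  assumes "f \<in> borel_measurable M" "g \<in> borel_measurable M" "\<And>x. f x \<le> g x"
  shows "X f \<le> X g"
proof -
  have "AE x in M. f x \<le> g x" using assms(3) by simp
  then show ?thesis using X assms(1,2) unfolding ri_norm_def banach_function_norm_def by blast
qed

lemma X_cmult: "f \<in> borel_measurable M \<Longrightarrow> 0 \<le> a \<Longrightarrow> X (\<lambda>x. ennreal a * f x) = ennreal a * X f"
  using X unfolding ri_norm_def banach_function_norm_def by blast

lemma X_add: "f \<in> borel_measurable M \<Longrightarrow> g \<in> borel_measurable M \<Longrightarrow> X (\<lambda>x. f x + g x) \<le> X f + X g"
  using X unfolding ri_norm_def banach_function_norm_def by blast

lemma X_zero_iff: "f \<in> borel_measurable M \<Longrightarrow> X f = 0 \<longleftrightarrow> (AE x in M. f x = 0)"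
  using X unfolding ri_norm_def banach_function_norm_def by blast

lemma X_sum:
  assumes "finite I" "\<And>i. i \<in> I \<Longrightarrow> f i \<in> borel_measurable M"
  shows "X (\<lambda>x. \<Sum>i\<in>I. f i x) \<le> (\<Sum>i\<in>I. X (f i))"
  using assms
proof (induction I rule: finite_induct)
  case empty
  then show ?case using X_zero_iff[of "\<lambda>x. 0"] by simp
next
  case (insert i I)
  then have "X (\<lambda>x. f i x + (\<Sum>i\<in>I. f i x)) \<le> X (f i) + X (\<lambda>x. \<Sum>i\<in>I. f i x)"
    by (intro X_add borel_measurable_sum) auto
  also have "\<dots> \<le> X (f i) + (\<Sum>i\<in>I. X (f i))" using insert by (intro add_left_mono) auto
  finally show ?case using insert by simp
qed

lemma X_rearr_mono:
  assumes "f \<in> borel_measurable M" "g \<in> borel_measurable M" "\<And>s. rearr M f s \<le> rearr M g s"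
  shows "X f \<le> X g"
proof (cases "X g < \<infinity>")
  case True
  moreover have "AE s in half_line. rearr M f s \<le> rearr M g s" using assms(3) by simp
  ultimately show ?thesis using X assms(1,2) unfolding ri_norm_def by blast
qed (simp add: not_less top_unique)

lemma X_indicator_mono:
  assumes [measurable]: "A \<in> sets M" "B \<in> sets M" and le: "emeasure M A \<le> emeasure M B"
  shows "X (indicator A) \<le> X (indicator B)"
proof (rule X_rearr_mono)
  have *: "{x \<in> space M. l < indicator C x} = (if l < 1 then C else {})" if "C \<in> sets M" for C and l :: ennreal
    using sets.sets_into_space[OF that] le_less_trans[of 1 l 1]
    by (auto simp: indicator_def not_less split: if_splits)
  show "rearr M (indicator A) s \<le> rearr M (indicator B) s" for s
    by (rule rearr_le_rearrI, unfold *[OF assms(1)] *[OF assms(2)]) (simp add: le)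
qed auto

text \<open>Indicators of sets of equal measure have equal rearrangements, so the choice made in
  \<open>fund_fun\<close> does not affect the value; finiteness of X on these indicators makes
  \<open>enn2real\<close> faithful.\<close>

lemma fund_fun_eq:
  assumes A: "A \<in> sets M" "emeasure M A = ennreal t"
  shows "ennreal (\<phi> t) = X (indicator A)"
proof -
  define B where "B = (SOME A. A \<in> sets M \<and> emeasure M A = ennreal t)"
  have B: "B \<in> sets M" "emeasure M B = ennreal t"
    using someI[of "\<lambda>A. A \<in> sets M \<and> emeasure M A = ennreal t" A] A by (auto simp: B_def)
  have "X (indicator B) < \<infinity>"
    using X B unfolding ri_norm_def banach_function_norm_def by (metis ennreal_less_top infinity_ennreal_def)
  then have "ennreal (\<phi> t) = X (indicator B)" by (simp add: fund_fun_def B_def[symmetric])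
  also have "\<dots> = X (indicator A)" using A B by (intro antisym X_indicator_mono) auto
  finally show ?thesis .
qed

lemma set_of_measure: 
  assumes "0 \<le> t" obtains A where "A \<in> sets M" "emeasure M A = ennreal t"
  using nested_sets_of_measure[of t] assms by (metis order_refl)

lemma fund_fun_mono: 
  assumes "0 \<le> s" "s \<le> t" shows "\<phi> s \<le> \<phi> t"
proof -
  obtain A where A: "A \<in> sets M" "emeasure M A = ennreal s" using assms(1) by (rule set_of_measure)
  obtain B where B: "B \<in> sets M" "emeasure M B = ennreal t" using assms by (meson order_trans set_of_measure)
  have "ennreal (\<phi> s) \<le> ennreal (\<phi> t)"
    unfolding fund_fun_eq[OF A] fund_fun_eq[OF B] using A B assms by (intro X_indicator_mono) (auto intro: ennreal_leI)
  moreover have "0 \<le> \<phi> t" by (simp add: fund_fun_def)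
  ultimately show ?thesis by simp
qed

lemma fund_fun_pos: 
  assumes "0 < t" shows "0 < \<phi> t"
proof -
  obtain A where A: "A \<in> sets M" "emeasure M A = ennreal t" using assms by (meson less_imp_le set_of_measure)
  have "X (indicator A) \<noteq> 0"
  proof
    assume "X (indicator A) = 0"
    then have "AE x in M. indicator A x = (0 :: ennreal)" using A X_zero_iff[of "indicator A"] by simp
    then have "AE x in M. x \<notin> A" by eventually_elim (auto simp: indicator_def split: if_splits)
    then have "emeasure M A = 0" using A(1) AE_iff_measurable[of A M "\<lambda>x. x \<notin> A"] by simp
    then show False using A assms by simp
  qed
  then have "ennreal (\<phi> t) \<noteq> 0" using fund_fun_eq[OF A] by simp
  then show ?thesis by (simp add: ennreal_eq_0_iff not_le)
qed

text \<open>The cyclic shifts of the step function with values \<open>min K (g\<^sup>* (i t / N))\<close> on \<open>N\<close> disjoint sets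
  of measure \<open>t / N\<close> all have a rearrangement below \<open>g\<^sup>*\<close>, and their sum is constant.\<close>

lemma fund_fun_step:
  assumes [measurable]: "g \<in> borel_measurable M" and t: "0 < t" and N: "0 < N"
  shows "ennreal (\<phi> t) * (\<Sum>i<N. min (of_nat K) (rearr M g (real (Suc i) * t / N))) \<le> of_nat N * X g"
proof -
  obtain U :: "real \<Rightarrow> 'a set" where
    U1: "\<And>s. 0 \<le> s \<Longrightarrow> s \<le> t \<Longrightarrow> U s \<in> sets M" and U2: "\<And>s. 0 \<le> s \<Longrightarrow> s \<le> t \<Longrightarrow> emeasure M (U s) = ennreal s"
    and U3: "\<And>s s'. 0 \<le> s \<Longrightarrow> s \<le> s' \<Longrightarrow> s' \<le> t \<Longrightarrow> U s \<subseteq> U s'" using nested_sets_of_measure[of t] by blast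
  define p where "p i = real i * t / N" for i :: nat
  have p0: "0 \<le> p i" for i using t by (simp add: p_def)
  have pm: "p i \<le> p j" if "i \<le> j" for i j using that t by (auto simp: p_def divide_right_mono)
  have pN: "p N = t" using N by (simp add: p_def)
  have pt: "p i \<le> t" if "i \<le> N" for i using pm[OF that] pN by simp
  define A where "A i = U (p (Suc i)) - U (p i)" for i
  have As: "A i \<in> sets M" if "i < N" for i using that p0 pt unfolding A_def by (intro sets.Diff U1) auto
  have Am: "emeasure M (A i) = ennreal (t / N)" if "i < N" for i
  proof -
    have "emeasure M (A i) = emeasure M (U (p (Suc i))) - emeasure M (U (p i))"
      unfolding A_def using that p0 pt pm by (intro emeasure_Diff U1 U3) (auto simp: U2)
    also have "\<dots> = ennreal (p (Suc i) - p i)" using that p0 pt by (simp add: U2 ennreal_minus)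
    also have "p (Suc i) - p i = t / N" by (simp add: p_def add_divide_distrib distrib_right)
    finally show ?thesis .
  qed
  have dj: "A i \<inter> A j = {}" if "i < j" "j < N" for i j
    using U3[OF p0 pm, of "Suc i" j] pt[of j] that unfolding A_def by auto
  have dj': "A i \<inter> A j = {}" if "i \<noteq> j" "i < N" "j < N" for i j
    using dj[of i j] dj[of j i] that by (cases "i < j") auto
  \<comment> \<open>The value of g* at the right end point of the i-th cell, so that the step
    function stays below g*; the truncation keeps it real where g* is infinite.\<close>
  define a where "a i = enn2real (min (of_nat K) (rearr M g (p (Suc i))))" for i
  have a: "ennreal (a i) = min (of_nat K) (rearr M g (p (Suc i)))" for i
    unfolding a_def by (intro ennreal_enn2real) (auto simp: min_less_iff_disj of_nat_less_top)
  have a0: "0 \<le> a i" for i by (simp add: a_def)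
  define h where "h j x = (\<Sum>i<N. ennreal (a i) * indicator (A ((i + j) mod N)) x)" for j x
  have hm [measurable]: "h j \<in> borel_measurable M" for j
    unfolding h_def using N by (intro borel_measurable_sum borel_measurable_times_ennreal borel_measurable_indicator As) auto
  have inj: "i = i'" if "i < N" "i' < N" "(i + j) mod N = (i' + j) mod N" for i i' j
    using that add_mod_cancel_left[of i N i' j] by (simp add: add.commute)
  have Xh: "X (h j) \<le> X g" for j
  proof (rule X_rearr_mono)
    fix s
    show "rearr M (h j) s \<le> rearr M g s"
    proof (rule rearr_le_rearrI)
      fix l
      define I where "I = {i. i < N \<and> l < ennreal (a i)}"
      have fin: "finite I" by (simp add: I_def)
      have sub: "{x \<in> space M. l < h j x} \<subseteq> (\<Union>i\<in>I. A ((i + j) mod N))"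
      proof
        fix x assume "x \<in> {x \<in> space M. l < h j x}"
        then have l: "l < h j x" by simp
        then have "h j x \<noteq> 0" by (auto simp: not_less_zero)
        then obtain i where i: "i < N" "x \<in> A ((i + j) mod N)"
          unfolding h_def by (metis (no_types, lifting) indicator_simps(2) lessThan_iff mult_zero_right sum.neutral)
        have "h j x = (\<Sum>i\<in>{i}. ennreal (a i) * indicator (A ((i + j) mod N)) x)"
          unfolding h_def
        proof (rule sum.mono_neutral_right)
          show "\<forall>i'\<in>{..<N} - {i}. ennreal (a i') * indicator (A ((i' + j) mod N)) x = 0"
          proof
            fix i' assume i': "i' \<in> {..<N} - {i}"
            then have "(i' + j) mod N \<noteq> (i + j) mod N" using inj[of i' i j] i by auto
            then have "x \<notin> A ((i' + j) mod N)" using dj'[of "(i' + j) mod N" "(i + j) mod N"] i N by auto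
            then show "ennreal (a i') * indicator (A ((i' + j) mod N)) x = 0" by simp
          qed
        qed (use i in auto)
        then have "l < ennreal (a i)" using l i by simp
        then show "x \<in> (\<Union>i\<in>I. A ((i + j) mod N))" using i by (auto simp: I_def)
      qed
      show "emeasure M {x \<in> space M. l < h j x} \<le> emeasure M {x \<in> space M. l < g x}"
      proof (cases "I = {}")
        case True
        then show ?thesis using sub by simp
      next
        case False
        \<comment> \<open>\<open>h j\<close> exceeds l on at most i0 + 1 cells, of total measure p
          (Suc i0). As a value above l is taken at the index i0, g* exceeds l at p (Suc i0), that
          is, g exceeds l on a set of larger measure.\<close>
        define i0 where "i0 = Max I"
        have i0: "i0 \<in> I" unfolding i0_def using fin False by (rule Max_in)
        have "I \<subseteq> {..i0}" using fin by (auto simp: i0_def)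
        then have card: "card I \<le> Suc i0" using card_mono[of "{..i0}" I] by simp
        have "emeasure M {x \<in> space M. l < h j x} \<le> emeasure M (\<Union>i\<in>I. A ((i + j) mod N))"
          using sub fin N by (intro emeasure_mono sets.finite_UN As) auto
        also have "\<dots> \<le> (\<Sum>i\<in>I. emeasure M (A ((i + j) mod N)))"
          using fin N As by (intro emeasure_subadditive_finite) auto
        also have "\<dots> = of_nat (card I) * ennreal (t / N)" using N by (simp add: Am)
        also have "\<dots> \<le> of_nat (Suc i0) * ennreal (t / N)" using card by (intro mult_right_mono of_nat_mono) auto
        also have "\<dots> = ennreal (p (Suc i0))"
          using t by (simp add: p_def ennreal_of_nat_eq_real_of_nat ennreal_mult[symmetric] del: of_nat_Suc)
        also have "\<dots> \<le> emeasure M {x \<in> space M. l < g x}"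
        proof -
          have "l < rearr M g (p (Suc i0))" using i0 by (auto simp: I_def a)
          then show ?thesis by (simp add: less_rearr_iff)
        qed
        finally show ?thesis .
      qed
    qed
  qed auto
  define V where "V = (\<Union>i<N. A i)"
  have V: "V \<in> sets M" unfolding V_def using As by (intro sets.finite_UN) auto
  have indV: "indicator V x = (\<Sum>i<N. indicator (A i) x :: ennreal)" for x
    unfolding V_def using dj' by (intro indicator_UN_disjoint) (auto simp: disjoint_family_on_def)
  have mV: "emeasure M V = ennreal t"
  proof -
    have "emeasure M V = (\<Sum>i<N. emeasure M (A i))"
      unfolding V_def using dj' As by (intro sum_emeasure[symmetric]) (auto simp: disjoint_family_on_def)
    also have "\<dots> = of_nat N * ennreal (t / N)" by (simp add: Am)
    also have "\<dots> = ennreal t"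
      using t N by (simp add: ennreal_of_nat_eq_real_of_nat ennreal_mult[symmetric])
    finally show ?thesis .
  qed
  \<comment> \<open>Over the N shifts each cell receives each of the N values exactly once.\<close>
  have "(\<Sum>j<N. h j x) = ennreal (\<Sum>i<N. a i) * indicator V x" for x
  proof -
    have "(\<Sum>j<N. h j x) = (\<Sum>i<N. \<Sum>j<N. ennreal (a i) * indicator (A ((i + j) mod N)) x)"
      unfolding h_def by (rule sum.swap)
    also have "\<dots> = (\<Sum>i<N. ennreal (a i) * (\<Sum>j<N. indicator (A ((i + j) mod N)) x))"
      by (simp add: sum_distrib_left)
    also have "\<dots> = (\<Sum>i<N. ennreal (a i) * indicator V x)"
      unfolding indV by (subst sum_cyclic_shift) simp
    also have "\<dots> = ennreal (\<Sum>i<N. a i) * indicator V x"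
      using a0 by (cases "x \<in> V") (simp_all add: sum_ennreal)
    finally show ?thesis .
  qed
  then have "ennreal (\<Sum>i<N. a i) * X (indicator V) = X (\<lambda>x. \<Sum>j<N. h j x)"
    using V a0 by (simp add: X_cmult sum_nonneg)
  also have "\<dots> \<le> (\<Sum>j<N. X (h j))" by (intro X_sum) auto
  also have "\<dots> \<le> (\<Sum>j<N. X g)" by (intro sum_mono Xh)
  finally have "ennreal (\<Sum>i<N. a i) * ennreal (\<phi> t) \<le> of_nat N * X g"
    using fund_fun_eq[OF V mV] by simp
  then show ?thesis using a0 by (simp add: sum_ennreal[symmetric] a p_def mult.commute)
qed

text \<open>Riemann sums for the integral of g* over (0, t): the step function inequality bounds
  them, and the truncations \<open>f m\<close> of g*, in height at m and away from 0, increase to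
  g*. Height and mesh are refined with the same parameter m.\<close>

theorem fund_fun_max_rearr_le:
  assumes [measurable]: "g \<in> borel_measurable M" and t: "0 < t"
  shows "ennreal (\<phi> t) * max_rearr M g t \<le> X g"
proof -
  let ?r = "rearr M g"
  define f where "f m s = min (of_nat m) (?r s) * indicator {t / Suc m..<t} s" for m :: nat and s
  have [measurable]: "f m \<in> borel_measurable borel" for m unfolding f_def by measurable
  have step: "ennreal (\<phi> t) * (\<integral>\<^sup>+ s. f m s \<partial>lborel) \<le> ennreal t * X g" for m
  proof -
    let ?N = "Suc m"
    define a where "a i = min (of_nat m) (?r (real (Suc i) * t / ?N))" for i
    \<comment> \<open>The value \<open>a i\<close> is taken at the right end point of the i-th cell,
      which is the left end point of \<open>J i\<close>; on \<open>J i\<close> it bounds the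
      truncated g* from above. The shift loses the first cell, of length t/(m+1), and this is why
      \<open>f m\<close> vanishes there.\<close>
    define J where "J i = {real (Suc i) * t / ?N..<real (Suc (Suc i)) * t / ?N}" for i
    have "f m s \<le> (\<Sum>i<?N. a i * indicator (J i) s)" for s
    proof (cases "s \<in> {t / ?N..<t}")
      case True
      define q where "q = s * ?N / t"
      have "s * ?N < t * ?N" using True by (intro mult_strict_right_mono) auto
      then have q: "1 \<le> q" "q < ?N" using True t by (auto simp: q_def field_simps)
      define i where "i = nat \<lfloor>q\<rfloor> - 1"
      have i: "real (Suc i) \<le> q" "q < real (Suc (Suc i))" "i < ?N"
        using q by (auto simp: i_def) linarith+
      then have iJ: "s \<in> J i" using t by (auto simp: J_def q_def field_simps)
      have "f m s \<le> a i * indicator (J i) s"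
      proof -
        have "?r s \<le> ?r (real (Suc i) * t / ?N)" using iJ by (intro rearr_antimono) (simp add: J_def)
        then have "min (of_nat m) (?r s) \<le> a i" unfolding a_def by (intro min.mono) auto
        then show ?thesis using iJ True by (simp add: f_def)
      qed
      also have "\<dots> \<le> (\<Sum>i<?N. a i * indicator (J i) s)" using i by (intro member_le_sum) auto
      finally show ?thesis .
    qed (simp add: f_def)
    then have "(\<integral>\<^sup>+ s. f m s \<partial>lborel) \<le> (\<integral>\<^sup>+ s. (\<Sum>i<?N. a i * indicator (J i) s) \<partial>lborel)"
      by (intro nn_integral_mono) auto
    also have "\<dots> = (\<Sum>i<?N. a i * emeasure lborel (J i))"
      by (subst nn_integral_sum) (auto simp: J_def nn_integral_cmult)
    also have "\<dots> = (\<Sum>i<?N. a i * ennreal (t / ?N))"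
    proof (intro sum.cong refl arg_cong2[of _ _ _ _ "(*)"])
      fix i
      have "real (Suc (Suc i)) * t / ?N - real (Suc i) * t / ?N = t / ?N"
        by (simp add: diff_divide_distrib[symmetric] left_diff_distrib[symmetric])
      moreover have "real (Suc i) * t / ?N \<le> real (Suc (Suc i)) * t / ?N" using t by (simp add: divide_right_mono)
      ultimately show "emeasure lborel (J i) = ennreal (t / ?N)" unfolding J_def by simp
    qed
    also have "\<dots> = (\<Sum>i<?N. a i) * ennreal (t / ?N)" by (simp only: sum_distrib_right)
    finally have "ennreal (\<phi> t) * (\<integral>\<^sup>+ s. f m s \<partial>lborel) \<le> ennreal (\<phi> t) * ((\<Sum>i<?N. a i) * ennreal (t / ?N))"
      by (rule mult_left_mono) simp
    also have "\<dots> = (ennreal (\<phi> t) * (\<Sum>i<?N. a i)) * ennreal (t / ?N)" by (simp only: mult.assoc)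
    also have "\<dots> \<le> (of_nat ?N * X g) * ennreal (t / ?N)"
      using fund_fun_step[of g t ?N m] t unfolding a_def by (intro mult_right_mono) auto
    also have "\<dots> = (of_nat ?N * ennreal (t / ?N)) * X g" by (simp only: ac_simps)
    also have "of_nat ?N * ennreal (t / ?N) = ennreal (real ?N * (t / real ?N))"
      unfolding ennreal_of_nat_eq_real_of_nat using t by (intro ennreal_mult[symmetric]) auto
    also have "real ?N * (t / real ?N) = t" by simp
    finally show ?thesis .
  qed
  have "rearr_int M g t \<le> (\<integral>\<^sup>+ s. (SUP m. f m s) \<partial>lborel)"
    unfolding rearr_int_def
  proof (intro nn_integral_mono)
    fix s
    show "?r s * indicator {0<..<t} s \<le> (SUP m. f m s)"
    proof (cases "s \<in> {0<..<t}")
      case True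
      then have "0 < s / t" using t by simp
      then obtain m0 where m0: "1 / real (Suc m0) < s / t" by (rule nat_approx_posE)
      have "?r s \<le> (SUP m. f m s)"
      proof (rule dense_le)
        fix y assume y: "y < ?r s"
        then have "y < top" by (rule less_le_trans) simp
        then obtain n where n: "y < of_nat n" using ennreal_Ex_less_of_nat by auto
        let ?m = "max m0 n"
        have "t / Suc ?m \<le> t / Suc m0" using t by (intro divide_left_mono) auto
        also have "\<dots> \<le> s" using m0 t by (simp add: field_simps)
        finally have "f ?m s = min (of_nat ?m) (?r s)" using True by (simp add: f_def)
        moreover have "y < of_nat ?m" by (rule less_le_trans[OF n]) simp
        ultimately have "y \<le> f ?m s" using y by (auto intro: less_imp_le)
        then show "y \<le> (SUP m. f m s)" by (rule SUP_upper2[rotated]) simp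
      qed
      then show ?thesis using True by simp
    qed simp
  qed
  also have "\<dots> = (SUP m. \<integral>\<^sup>+ s. f m s \<partial>lborel)"
  proof (rule nn_integral_monotone_convergence_SUP)
    show "incseq f"
    proof (intro incseq_SucI le_funI)
      fix m s
      have "t / Suc (Suc m) \<le> t / Suc m" using t by (intro divide_left_mono) auto
      then have "indicator {t / Suc m..<t} s \<le> (indicator {t / Suc (Suc m)..<t} s :: ennreal)"
        by (auto simp: indicator_def)
      moreover have "min (of_nat m) (?r s) \<le> min (of_nat (Suc m)) (?r s)"
        by (intro min.mono) (auto intro: of_nat_mono simp del: of_nat_Suc)
      ultimately show "f m s \<le> f (Suc m) s" unfolding f_def by (intro mult_mono) auto
    qed
  qed simp
  finally have "ennreal (\<phi> t) * rearr_int M g t \<le> ennreal (\<phi> t) * (SUP m. \<integral>\<^sup>+ s. f m s \<partial>lborel)"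
    by (rule mult_left_mono) simp
  also have "\<dots> = (SUP m. ennreal (\<phi> t) * (\<integral>\<^sup>+ s. f m s \<partial>lborel))" by (simp add: SUP_mult_left_ennreal)
  also have "\<dots> \<le> ennreal t * X g" by (intro SUP_least step)
  finally have "ennreal (\<phi> t) * rearr_int M g t / ennreal t \<le> ennreal t * X g / ennreal t"
    by (rule divide_right_mono_ennreal)
  also have "\<dots> = X g"
    using t by (subst mult.commute) (simp add: ennreal_mult_divide_eq)
  finally show ?thesis by (simp add: max_rearr_eq ennreal_times_divide)
qed

text \<open>The preceding bound for the indicator of a set of measure s, whose maximal average at t
  is at least s/t.\<close>

lemma fund_fun_quasi_concave:
  assumes "0 < s" "s \<le> t" shows "s * \<phi> t \<le> t * \<phi> s"
proof -
  obtain A where A: "A \<in> sets M" "emeasure M A = ennreal s" using assms by (meson less_imp_le set_of_measure)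
  have "ennreal s = (\<integral>\<^sup>+ u\<in>{0<..<s}. 1 \<partial>lborel)" using assms by simp
  also have "\<dots> \<le> rearr_int M (indicator A) t" unfolding rearr_int_def
  proof (intro nn_integral_mono)
    fix u
    show "1 * indicator {0<..<s} u \<le> rearr M (indicator A) u * indicator {0<..<t} u"
    proof (cases "u \<in> {0<..<s}")
      case True
      then have "1 \<le> rearr M (indicator A) u"
        using A by (intro rearr_indicator_ge_1) (auto simp: ennreal_less_iff)
      then show ?thesis using True assms by simp
    qed simp
  qed
  finally have "ennreal (\<phi> t) * (ennreal s / ennreal t) \<le> ennreal (\<phi> t) * max_rearr M (indicator A) t"
    unfolding max_rearr_eq by (intro mult_left_mono divide_right_mono_ennreal) auto
  also have "\<dots> \<le> ennreal (\<phi> s)" unfolding fund_fun_eq[OF A] using A assms by (intro fund_fun_max_rearr_le) auto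
  finally have "\<phi> t * (s / t) \<le> \<phi> s"
    using assms fund_fun_pos[of s] fund_fun_pos[of t] by (simp add: divide_ennreal ennreal_mult[symmetric])
  then show ?thesis using assms by (simp add: field_simps)
qed

text \<open>With h = (|f| - c)_+ one has f*(s) <= h*(s) + c for all s, and averaging over (0, t)
  gives O(f,t) <= h**(t). The oscillation is thus controlled by the norm of h through the
  fundamental function, and h is at most twice the average difference over balls of radius
  r.\<close>

theorem osc_le_modulus:
  fixes f :: "'a \<Rightarrow> real"
  assumes [measurable]: "f \<in> borel_measurable M" and fin: "L1_plus_Linf_norm M (absf f) < \<infinity>"
    and t: "0 < t" and r: "\<And>x. 2 * t \<le> measure M (ball x r)"
  shows "ennreal (\<phi> t) * osc M (absf f) t \<le> 2 * modulus M X f r"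
proof -
  define c where "c = enn2real (rearr M (absf f) t)"
  have c: "rearr M (absf f) t = ennreal c" "0 \<le> c"
    using rearr_finite[OF _ fin t] by (auto simp: c_def)
  define G where "G x = (\<integral>\<^sup>+ y\<in>ball x r. ennreal \<bar>f x - f y\<bar> \<partial>M) / emeasure M (ball x r)" for x
  define h where "h x = ennreal (\<bar>f x\<bar> - c)" for x
  have [measurable]: "G \<in> borel_measurable M" "h \<in> borel_measurable M"
    unfolding G_def h_def by (rule ball_average_measurable) measurable
  have hG: "h x \<le> 2 * G x" for x
  proof (cases "\<bar>f x\<bar> \<le> c")
    case False
    define B where "B = ball x r"
    define P where "P = {y \<in> space M. \<bar>f y\<bar> \<le> c} \<inter> B"
    define Q where "Q = {y \<in> space M. rearr M (absf f) t < absf f y}"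
    have [measurable]: "B \<in> sets M" "P \<in> sets M" "Q \<in> sets M" unfolding P_def B_def Q_def by measurable
    define m where "m = measure M B"
    have m: "emeasure M B = ennreal m" "2 * t \<le> m" using r[of x] emeasure_ball by (auto simp: B_def m_def)
    have "emeasure M P \<le> emeasure M B" by (intro emeasure_mono) (auto simp: P_def)
    then have "emeasure M P < top" using m le_less_trans by fastforce
    then obtain q where q: "emeasure M P = ennreal q" "0 \<le> q" by (cases "emeasure M P") auto
    have Qt: "emeasure M Q \<le> ennreal t" unfolding Q_def by (rule emeasure_greater_rearr_le) measurable
    have "B \<subseteq> P \<union> Q" using c by (auto simp: P_def Q_def ennreal_less_iff)
    then have "ennreal m \<le> emeasure M (P \<union> Q)"
      unfolding m(1)[symmetric] by (intro emeasure_mono) auto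
    also have "\<dots> \<le> emeasure M P + emeasure M Q" by (rule emeasure_subadditive) auto
    also have "\<dots> \<le> ennreal q + ennreal t" using q Qt by (intro add_mono) auto
    finally have "m \<le> q + t" using q t by (simp flip: ennreal_plus)
    then have mq: "m \<le> 2 * q" using m by linarith
    have "ennreal (\<bar>f x\<bar> - c) * emeasure M P = (\<integral>\<^sup>+ y. ennreal (\<bar>f x\<bar> - c) * indicator P y \<partial>M)"
      by (simp add: nn_integral_cmult)
    also have "\<dots> \<le> (\<integral>\<^sup>+ y\<in>B. ennreal \<bar>f x - f y\<bar> \<partial>M)"
      by (intro nn_integral_mono) (auto simp: P_def indicator_def intro!: ennreal_leI)
    finally have "ennreal ((\<bar>f x\<bar> - c) * q) \<le> (\<integral>\<^sup>+ y\<in>B. ennreal \<bar>f x - f y\<bar> \<partial>M)"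
      using False q by (simp add: ennreal_mult)
    then have "ennreal ((\<bar>f x\<bar> - c) * q) / ennreal m \<le> G x"
      unfolding G_def B_def[symmetric] m(1) by (rule divide_right_mono_ennreal)
    moreover have "ennreal ((\<bar>f x\<bar> - c) * q) / ennreal m = ennreal ((\<bar>f x\<bar> - c) * q / m)"
      using False q m t by (intro divide_ennreal) auto
    moreover have "(\<bar>f x\<bar> - c) / 2 \<le> (\<bar>f x\<bar> - c) * q / m"
      using mult_left_mono[OF mq, of "\<bar>f x\<bar> - c"] False m t by (simp add: field_simps)
    ultimately have "ennreal ((\<bar>f x\<bar> - c) / 2) \<le> G x" by (metis ennreal_leI order_trans)
    then have "2 * ennreal ((\<bar>f x\<bar> - c) / 2) \<le> 2 * G x" by (rule mult_left_mono) simp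
    moreover have "2 * ennreal ((\<bar>f x\<bar> - c) / 2) = h x"
      using False by (simp add: h_def ennreal_mult'[symmetric] flip: ennreal_numeral)
    ultimately show ?thesis by simp
  qed (simp add: h_def ennreal_neg)
  have rr: "rearr M (absf f) s \<le> rearr M h s + ennreal c" for s
  proof (rule ccontr)
    assume "\<not> ?thesis"
    then have "ennreal s < emeasure M {x \<in> space M. rearr M h s + ennreal c < absf f x}"
      by (subst less_rearr_iff[symmetric]) auto
    also have "\<dots> \<le> emeasure M {x \<in> space M. rearr M h s < h x}"
    proof (intro emeasure_mono subsetI)
      fix x assume "x \<in> {x \<in> space M. rearr M h s + ennreal c < absf f x}"
      then have *: "rearr M h s + ennreal c < ennreal \<bar>f x\<bar>" by simp
      then have "rearr M h s + ennreal c < top" by (rule less_le_trans) simp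
      then obtain v where v: "rearr M h s = ennreal v" "0 \<le> v" by (cases "rearr M h s") auto
      then have "v + c < \<bar>f x\<bar>" using * c by (simp add: ennreal_plus[symmetric] ennreal_less_iff del: ennreal_plus)
      then show "x \<in> {x \<in> space M. rearr M h s < h x}" using v by (simp add: h_def ennreal_less_iff)
    qed measurable
    also have "\<dots> \<le> ennreal s" by (rule emeasure_greater_rearr_le) measurable
    finally show False by simp
  qed
  have "rearr_int M (absf f) t \<le> (\<integral>\<^sup>+ s. rearr M h s * indicator {0<..<t} s + ennreal c * indicator {0<..<t} s \<partial>lborel)"
    unfolding rearr_int_def distrib_right[symmetric] by (intro nn_integral_mono mult_right_mono rr) auto
  also have "\<dots> = rearr_int M h t + ennreal c * ennreal t"
    unfolding rearr_int_def using t by (subst nn_integral_add) (auto simp: nn_integral_cmult)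
  finally have "max_rearr M (absf f) t \<le> (rearr_int M h t + ennreal c * ennreal t) / ennreal t"
    unfolding max_rearr_eq by (rule divide_right_mono_ennreal)
  also have "\<dots> = max_rearr M h t + ennreal c"
    using t by (simp add: max_rearr_eq add_divide_distrib_ennreal ennreal_mult_divide_eq)
  finally have "osc M (absf f) t \<le> max_rearr M h t"
    unfolding osc_def c(1) by (subst ennreal_minus_le_iff) (auto simp: add.commute)
  then have "ennreal (\<phi> t) * osc M (absf f) t \<le> ennreal (\<phi> t) * max_rearr M h t" by (rule mult_left_mono) simp
  also have "\<dots> \<le> X h" using t by (intro fund_fun_max_rearr_le) auto
  also have "\<dots> \<le> X (\<lambda>x. ennreal 2 * G x)" using hG by (intro X_mono) (auto simp flip: ennreal_numeral)
  also have "\<dots> = ennreal 2 * X G" by (intro X_cmult) auto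
  also have "X G = modulus M X f r" by (simp add: modulus_def G_def[abs_def])
  finally show ?thesis by simp
qed

end

section \<open>Couples of Lebesgue spaces and interpolation\<close>

lemma esssup_le_iff:
  fixes f :: "'a \<Rightarrow> ennreal"
  assumes "f \<in> borel_measurable M"
  shows "esssup M f \<le> c \<longleftrightarrow> (AE x in M. f x \<le> c)"
proof
  assume "esssup M f \<le> c"
  then show "AE x in M. f x \<le> c" using esssup_AE[of f M] by (auto elim: eventually_mono intro: order_trans)
qed (rule esssup_I[OF assms])

lemma esssup_cmult_le:
  fixes f :: "'a \<Rightarrow> ennreal"
  assumes [measurable]: "f \<in> borel_measurable M"
  shows "esssup M (\<lambda>x. a * f x) \<le> a * esssup M f"
proof (rule esssup_I)
  show "AE x in M. a * f x \<le> a * esssup M f"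
    using esssup_AE[of f M] by eventually_elim (rule mult_left_mono, auto)
qed simp

lemma esssup_cmult_ennreal:
  fixes f :: "'a \<Rightarrow> ennreal"
  assumes [measurable]: "f \<in> borel_measurable M" and a: "0 < (a::real)"
  shows "esssup M (\<lambda>x. ennreal a * f x) = ennreal a * esssup M f"
proof (rule antisym[OF esssup_cmult_le])
  have e: "ennreal (1 / a) * (ennreal a * y) = y" "ennreal a * (ennreal (1 / a) * y) = y" for y
    using a by (simp_all add: mult.assoc[symmetric] ennreal_mult[symmetric])
  have "esssup M f = esssup M (\<lambda>x. ennreal (1 / a) * (ennreal a * f x))" by (simp add: e)
  also have "\<dots> \<le> ennreal (1 / a) * esssup M (\<lambda>x. ennreal a * f x)" by (rule esssup_cmult_le) simp
  finally have "ennreal a * esssup M f \<le> ennreal a * (ennreal (1 / a) * esssup M (\<lambda>x. ennreal a * f x))"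
    by (rule mult_left_mono) simp
  then show "ennreal a * esssup M f \<le> esssup M (\<lambda>x. ennreal a * f x)" by (simp only: e)
qed simp

text \<open>The Riesz-Fischer argument from countable subadditivity: a subsequence with increments
  of norm at most 2^-k has an almost everywhere absolutely convergent telescoping series, and its
  tails control the distance to the limit.\<close>

lemma banach_norm_fnorm_of:
  assumes hom: "\<And>f a. f \<in> borel_measurable M \<Longrightarrow> 0 < (a::real) \<Longrightarrow> \<rho> (\<lambda>x. ennreal a * f x) = ennreal a * \<rho> f"
    and zero: "\<rho> (\<lambda>x. 0) = 0"
    and mono: "\<And>f g. f \<in> borel_measurable M \<Longrightarrow> g \<in> borel_measurable M \<Longrightarrow> (AE x in M. f x \<le> g x) \<Longrightarrow> \<rho> f \<le> \<rho> g"
    and add: "\<And>f g. f \<in> borel_measurable M \<Longrightarrow> g \<in> borel_measurable M \<Longrightarrow> \<rho> (\<lambda>x. f x + g x) \<le> \<rho> f + \<rho> g"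
    and sub: "\<And>F. (\<And>i::nat. F i \<in> borel_measurable M) \<Longrightarrow> \<rho> (\<lambda>x. \<Sum>i. F i x) \<le> (\<Sum>i. \<rho> (F i))"
    and fin: "\<And>f. f \<in> borel_measurable M \<Longrightarrow> \<rho> f < \<infinity> \<Longrightarrow> AE x in M. f x < \<infinity>"
  shows "banach_norm (fnorm_of M \<rho>)"
  unfolding banach_norm_def
proof (intro conjI allI impI)
  let ?N = "fnorm_of M \<rho>"
  have meas: "f \<in> borel_measurable M" if "?N f < \<infinity>" for f
    using that by (auto simp: fnorm_of_def split: if_splits)
  have le: "?N f \<le> \<rho> g"
    if "f \<in> borel_measurable M" "g \<in> borel_measurable M" "AE x in M. absf f x \<le> g x" for f g
    using that by (auto simp: fnorm_of_def intro!: mono)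
  show hom': "?N (\<lambda>t. c * f t) = ennreal \<bar>c\<bar> * ?N f" for c f
  proof (cases "c = 0")
    case True
    then show ?thesis by (simp add: fnorm_of_def zero)
  next
    case False
    have "(\<lambda>t. c * f t) \<in> borel_measurable M \<longleftrightarrow> f \<in> borel_measurable M"
    proof
      assume "(\<lambda>t. c * f t) \<in> borel_measurable M"
      then have "(\<lambda>t. (1 / c) * (c * f t)) \<in> borel_measurable M" by measurable
      then show "f \<in> borel_measurable M" using False by simp
    qed measurable
    then show ?thesis using False
      by (auto simp: fnorm_of_def abs_mult ennreal_mult hom ennreal_mult_top)
  qed
  show tri: "?N (\<lambda>t. f t + g t) \<le> ?N f + ?N g" for f g
  proof (cases "f \<in> borel_measurable M \<and> g \<in> borel_measurable M")
    case True
    then have [measurable]: "f \<in> borel_measurable M" "g \<in> borel_measurable M" by auto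
    have "?N (\<lambda>t. f t + g t) \<le> \<rho> (\<lambda>t. absf f t + absf g t)"
      by (intro le) (auto simp flip: ennreal_plus intro!: AE_I2 ennreal_leI)
    also have "\<dots> \<le> \<rho> (absf f) + \<rho> (absf g)" by (intro add) auto
    finally show ?thesis using True by (simp add: fnorm_of_def)
  qed (auto simp: fnorm_of_def)
  fix F :: "nat \<Rightarrow> real \<Rightarrow> real"
  assume F: "(\<forall>i. ?N (F i) < \<infinity>) \<and> (\<forall>e>0. \<exists>m. \<forall>i\<ge>m. \<forall>j\<ge>m. ?N (\<lambda>t. F i t - F j t) < e)"
  have [measurable]: "F i \<in> borel_measurable M" for i using F meas by blast
  have "\<exists>m. \<forall>i\<ge>m. \<forall>j\<ge>m. ?N (\<lambda>t. F i t - F j t) < ennreal ((1/2) ^ k)" for k :: nat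
    using F by (auto simp: ennreal_zero_less_one)
  then obtain m where m: "\<And>k i j. i \<ge> m k \<Longrightarrow> j \<ge> m k \<Longrightarrow> ?N (\<lambda>t. F i t - F j t) < ennreal ((1/2) ^ k)" by metis
  \<comment> \<open>Summing the thresholds gives indices that increase and stay above
    \<open>m k\<close>.\<close>
  define r where "r k = (\<Sum>l\<le>k. m l)" for k :: nat
  have rm: "m k \<le> r k" and rS: "r k \<le> r (Suc k)" for k by (simp_all add: r_def member_le_sum)
  define D where "D k x = ennreal \<bar>F (r (Suc k)) x - F (r k) x\<bar>" for k x
  have [measurable]: "D k \<in> borel_measurable M" for k unfolding D_def by measurable
  have Dk: "\<rho> (D k) \<le> ennreal ((1/2) ^ k)" for k
    using m[of k "r (Suc k)" "r k"] rm[of k] rS[of k] by (auto simp: fnorm_of_def D_def[abs_def])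
  have tail: "\<rho> (\<lambda>x. \<Sum>i. D (i + k) x) \<le> ennreal (2 * (1/2) ^ k)" for k
  proof -
    have "\<rho> (\<lambda>x. \<Sum>i. D (i + k) x) \<le> (\<Sum>i. \<rho> (D (i + k)))" by (rule sub) simp
    also have "\<dots> \<le> (\<Sum>i. ennreal ((1/2) ^ (i + k)))" by (intro suminf_le Dk) auto
    also have "\<dots> = ennreal (\<Sum>i. (1/2) ^ (i + k))"
      by (intro suminf_ennreal2) (auto intro: summable_ignore_initial_segment)
    also have "(\<Sum>i. (1/2::real) ^ (i + k)) = 2 * (1/2) ^ k"
      by (simp add: power_add suminf_mult2[symmetric] suminf_geometric)
    finally show ?thesis .
  qed
  \<comment> \<open>\<open>lim\<close> is unspecified at points of divergence but still a measurable
    function; these points form a null set.\<close>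
  define f where "f x = lim (\<lambda>k. F (r k) x)" for x
  have fm [measurable]: "f \<in> borel_measurable M" unfolding f_def by measurable
  have "AE x in M. (\<Sum>i. D i x) < \<infinity>"
    using tail[of 0] by (intro fin) (auto simp: less_top[symmetric] top_unique)
  then have dist: "AE x in M. \<forall>k. ennreal \<bar>F (r k) x - f x\<bar> \<le> (\<Sum>i. D (i + k) x)"
  proof eventually_elim
    fix x assume S: "(\<Sum>i. D i x) < \<infinity>"
    then have sm: "summable (\<lambda>i. \<bar>F (r (Suc i)) x - F (r i) x\<bar>)"
      unfolding D_def by (intro summable_suminf_not_top) auto
    then have "summable (\<lambda>i. F (r (Suc i)) x - F (r i) x)" by (rule summable_rabs_cancel)
    then have cv: "convergent (\<lambda>n. \<Sum>i<n. F (r (Suc i)) x - F (r i) x)" by (simp add: summable_iff_convergent)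
    have "(\<lambda>n. (\<Sum>i<n. F (r (Suc i)) x - F (r i) x) + F (r 0) x) = (\<lambda>n. F (r n) x)"
      using sum_lessThan_telescope[of "\<lambda>i. F (r i) x"] by (simp add: fun_eq_iff)
    then have "convergent (\<lambda>n. F (r n) x)"
      using convergent_add[OF cv convergent_const[of "F (r 0) x"]] by simp
    then have lim: "(\<lambda>n. F (r n) x) \<longlonglongrightarrow> f x" unfolding f_def by (simp add: convergent_LIMSEQ_iff)
    show "\<forall>k. ennreal \<bar>F (r k) x - f x\<bar> \<le> (\<Sum>i. D (i + k) x)"
    proof
      fix k
      have "ennreal \<bar>F (r k) x - F (r (n + k)) x\<bar> \<le> (\<Sum>i. D (i + k) x)" for n
      proof -
        have "\<bar>F (r k) x - F (r (n + k)) x\<bar> = \<bar>\<Sum>i<n. F (r (Suc (i + k))) x - F (r (i + k)) x\<bar>"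
          using sum_lessThan_telescope[of "\<lambda>i. F (r (i + k)) x" n] by simp
        also have "\<dots> \<le> (\<Sum>i<n. \<bar>F (r (Suc (i + k))) x - F (r (i + k)) x\<bar>)" by (rule sum_abs)
        finally have "ennreal \<bar>F (r k) x - F (r (n + k)) x\<bar> \<le> (\<Sum>i<n. D (i + k) x)"
          unfolding D_def by (simp add: sum_ennreal ennreal_leI)
        also have "\<dots> \<le> (\<Sum>i. D (i + k) x)" by (intro sum_le_suminf) auto
        finally show ?thesis .
      qed
      moreover have "(\<lambda>n. ennreal \<bar>F (r k) x - F (r (n + k)) x\<bar>) \<longlonglongrightarrow> ennreal \<bar>F (r k) x - f x\<bar>"
        by (intro tendsto_ennrealI tendsto_intros LIMSEQ_ignore_initial_segment lim)
      ultimately show "ennreal \<bar>F (r k) x - f x\<bar> \<le> (\<Sum>i. D (i + k) x)" by (blast intro: LIMSEQ_le_const2)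
    qed
  qed
  have conv: "?N (\<lambda>t. F i t - f t) \<le> ennreal (3 * (1/2) ^ k)" if i: "i \<ge> r k" for i k
  proof -
    have "?N (\<lambda>t. F i t - f t) = ?N (\<lambda>t. (F i t - F (r k) t) + (F (r k) t - f t))" by simp
    also have "\<dots> \<le> ?N (\<lambda>t. F i t - F (r k) t) + ?N (\<lambda>t. F (r k) t - f t)" by (rule tri)
    also have "\<dots> \<le> ennreal ((1/2) ^ k) + ennreal (2 * (1/2) ^ k)"
    proof (intro add_mono)
      show "?N (\<lambda>t. F i t - F (r k) t) \<le> ennreal ((1/2) ^ k)"
        using m[of k i "r k"] i rm[of k] by (intro less_imp_le) simp
      have "?N (\<lambda>t. F (r k) t - f t) \<le> \<rho> (\<lambda>x. \<Sum>i. D (i + k) x)"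
        using dist by (intro le) auto
      then show "?N (\<lambda>t. F (r k) t - f t) \<le> ennreal (2 * (1/2) ^ k)" using tail order_trans by blast
    qed
    finally show ?thesis by (simp flip: ennreal_plus)
  qed
  show "\<exists>f. ?N f < \<infinity> \<and> (\<lambda>i. ?N (\<lambda>t. F i t - f t)) \<longlonglongrightarrow> 0"
  proof (intro exI conjI)
    have "?N f = ?N (\<lambda>t. F (r 0) t + (-1) * (F (r 0) t - f t))" by simp
    also have "\<dots> \<le> ?N (F (r 0)) + ?N (\<lambda>t. (-1) * (F (r 0) t - f t))" by (rule tri)
    also have "\<dots> = ?N (F (r 0)) + ?N (\<lambda>t. F (r 0) t - f t)" unfolding hom' by simp
    also have "\<dots> < \<infinity>" using F conv[of 0 "r 0"] by (auto simp: less_top[symmetric] top_unique)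
    finally show "?N f < \<infinity>" .
    show "(\<lambda>i. ?N (\<lambda>t. F i t - f t)) \<longlonglongrightarrow> 0"
    proof (rule order_tendstoI)
      fix e :: ennreal assume "0 < e"
      have "(\<lambda>k. ennreal (3 * (1/2) ^ k)) \<longlonglongrightarrow> ennreal (3 * 0)"
        by (intro tendsto_ennrealI tendsto_intros LIMSEQ_power_zero) simp
      then have "(\<lambda>k. ennreal (3 * (1/2) ^ k)) \<longlonglongrightarrow> 0" by simp
      then have "\<forall>\<^sub>F k in sequentially. ennreal (3 * (1/2) ^ k) < e" using \<open>0 < e\<close> by (rule order_tendstoD(2))
      then obtain k where "ennreal (3 * (1/2) ^ k) < e" by (auto simp: eventually_sequentially)
      then show "\<forall>\<^sub>F i in sequentially. ?N (\<lambda>t. F i t - f t) < e"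
        using conv[of k] by (auto simp: eventually_sequentially intro!: exI[of _ "r k"] intro: le_less_trans)
    qed simp
  qed
qed

section \<open>The couple of L1 and Linf\<close>

abbreviation "L1n M \<equiv> fnorm_of M (nn_integral M)"
abbreviation "Linfn M \<equiv> fnorm_of M (esssup M)"

lemma banach_norm_L1: "banach_norm (L1n M)"
proof (rule banach_norm_fnorm_of)
  show "AE x in M. f x < \<infinity>" if "f \<in> borel_measurable M" "integral\<^sup>N M f < \<infinity>" for f
    using nn_integral_PInf_AE[OF that(1)] that(2) by (auto simp: less_top)
qed (auto simp: nn_integral_cmult nn_integral_add nn_integral_suminf intro: nn_integral_mono_AE)

lemma esssup_add_le:
  fixes f g :: "'a \<Rightarrow> ennreal"
  assumes [measurable]: "f \<in> borel_measurable M" "g \<in> borel_measurable M"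
  shows "esssup M (\<lambda>x. f x + g x) \<le> esssup M f + esssup M g"
proof (rule esssup_I)
  show "AE x in M. f x + g x \<le> esssup M f + esssup M g"
    using esssup_AE[of f M] esssup_AE[of g M] by eventually_elim (rule add_mono)
qed simp

lemma banach_norm_Linf: "banach_norm (Linfn M)"
proof (rule banach_norm_fnorm_of)
  show "esssup M (\<lambda>x. 0 :: ennreal) = 0"
    using esssup_I[of "\<lambda>x. 0 :: ennreal" M 0] by simp
  show "esssup M f \<le> esssup M g" if "f \<in> borel_measurable M" "AE x in M. f x \<le> g x"
    for f g :: "real \<Rightarrow> ennreal" using that by (rule esssup_AE_mono)
  show "esssup M (\<lambda>x. \<Sum>i. F i x) \<le> (\<Sum>i. esssup M (F i))"
    if [measurable]: "\<And>i::nat. F i \<in> borel_measurable M" for F :: "nat \<Rightarrow> real \<Rightarrow> ennreal"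
  proof (rule esssup_I)
    have "AE x in M. \<forall>i. F i x \<le> esssup M (F i)" by (simp add: AE_all_countable esssup_AE)
    then show "AE x in M. (\<Sum>i. F i x) \<le> (\<Sum>i. esssup M (F i))"
      by eventually_elim (auto intro!: suminf_le)
  qed simp
  show "AE x in M. f x < \<infinity>" if "esssup M f < \<infinity>" for f :: "real \<Rightarrow> ennreal"
    using esssup_AE[of f M] by eventually_elim (rule le_less_trans[OF _ that])
qed (auto intro: esssup_cmult_ennreal esssup_add_le)

text \<open>If the sum norm vanishes, then for every e > 0 there is g with L1 norm at most e and |f
  - g| <= e almost everywhere. Where |f| > d >= 2e this forces |g| >= d/2, and Chebyshev gives
  measure at most 2e/d; so f = 0 almost everywhere.\<close>

lemma banach_couple_L1_Linf: "banach_couple (L1n M) (Linfn M)"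
  unfolding banach_couple_def
proof (intro conjI allI impI banach_norm_L1 banach_norm_Linf)
  fix f assume s0: "sum_norm (L1n M) (Linfn M) f = 0"
  have split: "\<exists>g. g \<in> borel_measurable M \<and> f \<in> borel_measurable M \<and>
      (\<integral>\<^sup>+ x. absf g x \<partial>M) \<le> ennreal e \<and> (AE x in M. \<bar>f x - g x\<bar> \<le> e)" if "e > 0" for e :: real
  proof -
    have "(INF g. L1n M g + Linfn M (\<lambda>t. f t - g t)) < ennreal e"
      using s0 that by (simp add: sum_norm_def)
    then obtain g where g: "L1n M g + Linfn M (\<lambda>t. f t - g t) < ennreal e" by (auto simp: INF_less_iff)
    then have "L1n M g < \<infinity>" "Linfn M (\<lambda>t. f t - g t) < \<infinity>"
      by (auto simp: less_top[symmetric])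
    then have gm [measurable]: "g \<in> borel_measurable M" and d [measurable]: "(\<lambda>t. f t - g t) \<in> borel_measurable M"
      by (auto simp: fnorm_of_def split: if_splits)
    have "(\<lambda>t. (f t - g t) + g t) \<in> borel_measurable M" by measurable
    then have fm: "f \<in> borel_measurable M" by simp
    have le: "(\<integral>\<^sup>+ x. absf g x \<partial>M) \<le> ennreal e" "esssup M (absf (\<lambda>t. f t - g t)) \<le> ennreal e"
      using g le_less_trans[OF _ g] by (auto simp: fnorm_of_def intro!: less_imp_le)
    have "AE x in M. absf (\<lambda>t. f t - g t) x \<le> ennreal e"
      using le(2) by (subst (asm) esssup_le_iff) auto
    then have "AE x in M. \<bar>f x - g x\<bar> \<le> e" by eventually_elim (use that in simp)
    then show ?thesis using gm fm le(1) by blast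
  qed
  from split[of 1] have [measurable]: "f \<in> borel_measurable M" by auto
  have null: "emeasure M {x \<in> space M. d < \<bar>f x\<bar>} = 0" if d: "d > 0" for d :: real
  proof -
    have "ennreal (d / 2) * emeasure M {x \<in> space M. d < \<bar>f x\<bar>} \<le> 0 + ennreal e" if e: "0 < e" "e \<le> d / 2" for e
    proof -
      obtain g where [measurable]: "g \<in> borel_measurable M"
        and g: "(\<integral>\<^sup>+ x. absf g x \<partial>M) \<le> ennreal e" "AE x in M. \<bar>f x - g x\<bar> \<le> e" using split[OF e(1)] by blast
      have "ennreal (d / 2) * emeasure M {x \<in> space M. d < \<bar>f x\<bar>}
        = (\<integral>\<^sup>+ x. ennreal (d / 2) * indicator {x \<in> space M. d < \<bar>f x\<bar>} x \<partial>M)"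
        by (simp add: nn_integral_cmult)
      also have "\<dots> \<le> (\<integral>\<^sup>+ x. absf g x \<partial>M)"
        using g(2) by (intro nn_integral_mono_AE, eventually_elim) (use e d in \<open>auto simp: indicator_def intro!: ennreal_leI\<close>)
      finally show ?thesis using g(1) by simp
    qed
    note small = this
    have "ennreal (d / 2) * emeasure M {x \<in> space M. d < \<bar>f x\<bar>} \<le> 0"
    proof (rule ennreal_le_epsilon)
      fix e :: real assume "0 < e"
      have "ennreal (d / 2) * emeasure M {x \<in> space M. d < \<bar>f x\<bar>} \<le> 0 + ennreal (min e (d / 2))"
        using \<open>0 < e\<close> d by (intro small) auto
      also have "\<dots> \<le> 0 + ennreal e" by (intro add_left_mono ennreal_leI) simp
      finally show "ennreal (d / 2) * emeasure M {x \<in> space M. d < \<bar>f x\<bar>} \<le> 0 + ennreal e" .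
    qed
    then show ?thesis using d by (simp add: ennreal_eq_0_iff)
  qed
  have "AE x in M. \<forall>i::nat. \<bar>f x\<bar> \<le> 1 / Suc i"
  proof (subst AE_all_countable, intro allI)
    fix i :: nat
    have "AE x in M. \<not> (1 / Suc i < \<bar>f x\<bar>)"
      using null[of "1 / Suc i"] by (intro AE_I[of _ _ "{x \<in> space M. 1 / Suc i < \<bar>f x\<bar>}"]) auto
    then show "AE x in M. \<bar>f x\<bar> \<le> 1 / Suc i" by (simp add: not_less)
  qed
  then have ae: "AE x in M. absf f x = 0"
  proof eventually_elim
    fix x assume *: "\<forall>i::nat. \<bar>f x\<bar> \<le> 1 / Suc i"
    have "\<bar>f x\<bar> \<le> 0"
    proof (rule ccontr)
      assume "\<not> \<bar>f x\<bar> \<le> 0"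
      then have "0 < \<bar>f x\<bar>" by simp
      then obtain i where "1 / real (Suc i) < \<bar>f x\<bar>" by (rule nat_approx_posE)
      then show False using * by (metis not_le)
    qed
    then show "absf f x = 0" by simp
  qed
  then show "L1n M f = 0" by (simp add: fnorm_of_def nn_integral_0_iff_AE)
  have "esssup M (absf f) \<le> 0" using ae by (subst esssup_le_iff) auto
  then show "Linfn M f = 0" by (simp add: fnorm_of_def)
qed

section \<open>Interpolation of weighted compositions\<close>

lemma linear_op_weighted_composition: "linear_op (\<lambda>f x. m x * f (P x))"
  by (simp add: linear_op_def fun_eq_iff algebra_simps)

text \<open>Interpolation is only applied to weighted compositions: they are linear on all real functions,
  whereas an integral operator would first have to be extended algebraically beyond the functions for
  which the integral exists.\<close>

lemma interpolation_weighted_composition: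
  assumes \<F>: "exact_interpolation_functor \<F>"
    and P [measurable]: "P \<in> measurable N M" and m [measurable]: "m \<in> borel_measurable N" "\<And>x. \<bar>m x\<bar> \<le> 1"
    and c: "1 \<le> c"
    and int: "\<And>g. g \<in> borel_measurable M \<Longrightarrow> (\<integral>\<^sup>+ x. ennreal \<bar>m x\<bar> * g (P x) \<partial>N) \<le> ennreal c * (\<integral>\<^sup>+ x. g x \<partial>M)"
  shows "\<F> (L1n N) (Linfn N) (\<lambda>x. m x * f (P x)) \<le> ennreal c * \<F> (L1n M) (Linfn M) f"
proof -
  have 1: "L1n N (\<lambda>x. m x * f (P x)) \<le> ennreal c * L1n M f" for f
  proof (cases "f \<in> borel_measurable M")
    case True
    then show ?thesis using int[of "absf f"]
      by (simp add: fnorm_of_def abs_mult ennreal_mult)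
  qed (use c in \<open>auto simp: fnorm_of_def ennreal_mult_top\<close>)
  have 2: "Linfn N (\<lambda>x. m x * f (P x)) \<le> ennreal c * Linfn M f" for f
  proof (cases "f \<in> borel_measurable M")
    case True
    then have [measurable]: "f \<in> borel_measurable M" .
    \<comment> \<open>The L1 bound already yields the sup bound: applied to the indicator of the
      null set where |f| exceeds its essential supremum, it shows that, up to a null set, P enters
      this set only where m = 0.\<close>
    define s where "s = esssup M (absf f)"
    have "AE x in M. absf f x \<le> s" unfolding s_def by (rule esssup_AE)
    then have "AE x in M. indicator {x. s < absf f x} x = (0 :: ennreal)"
      by eventually_elim (simp add: indicator_def not_less)
    then have "(\<integral>\<^sup>+ x. indicator {x \<in> space M. s < absf f x} x \<partial>M) = 0"
      by (subst nn_integral_0_iff_AE) (auto simp: indicator_def)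
    then have "(\<integral>\<^sup>+ x. ennreal \<bar>m x\<bar> * indicator {x \<in> space M. s < absf f x} (P x) \<partial>N) = 0"
      using int[of "indicator {x \<in> space M. s < absf f x}"] by simp
    then have "AE x in N. ennreal \<bar>m x\<bar> * indicator {x \<in> space M. s < absf f x} (P x) = 0"
      by (subst (asm) nn_integral_0_iff_AE) auto
    then have "AE x in N. ennreal \<bar>m x * f (P x)\<bar> \<le> s"
    proof (rule AE_mp, intro AE_I2 impI)
      fix x assume x: "x \<in> space N" and *: "ennreal \<bar>m x\<bar> * indicator {x \<in> space M. s < absf f x} (P x) = 0"
      have "P x \<in> space M" using x by (rule measurable_space[OF P])
      then have "m x = 0 \<or> absf f (P x) \<le> s" using * by (auto simp: indicator_def not_less split: if_splits)
      then show "ennreal \<bar>m x * f (P x)\<bar> \<le> s"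
      proof
        assume "absf f (P x) \<le> s"
        moreover have "\<bar>m x * f (P x)\<bar> \<le> \<bar>f (P x)\<bar>" using m(2)[of x] by (simp add: abs_mult mult_left_le_one_le)
        ultimately show ?thesis using ennreal_leI order_trans by blast
      qed simp
    qed
    then have "esssup N (absf (\<lambda>x. m x * f (P x))) \<le> s" by (intro esssup_I) auto
    also have "\<dots> \<le> ennreal c * s" using mult_right_mono[of 1 "ennreal c" s] c by simp
    finally show ?thesis by (simp add: fnorm_of_def s_def)
  qed (use c in \<open>auto simp: fnorm_of_def ennreal_mult_top\<close>)
  have "banach_couple (L1n M) (Linfn M) \<and> banach_couple (L1n N) (Linfn N) \<and>
      linear_op (\<lambda>f x. m x * f (P x)) \<and> 0 < c \<and>
      (\<forall>f. L1n N (\<lambda>x. m x * f (P x)) \<le> ennreal c * L1n M f) \<and>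
      (\<forall>f. Linfn N (\<lambda>x. m x * f (P x)) \<le> ennreal c * Linfn M f)"
    using 1 2 c by (auto intro: banach_couple_L1_Linf linear_op_weighted_composition)
  then show ?thesis
    using conjunct2[OF \<F>[unfolded exact_interpolation_functor_def],
      THEN spec, of "L1n M", THEN spec, of "Linfn M", THEN spec, of "L1n N", THEN spec, of "Linfn N",
      THEN spec, of "\<lambda>f x. m x * f (P x)", THEN spec, of c] by (rule mp[rotated, THEN spec])
qed

section \<open>Changes of variables on the half line\<close>

lemma space_half_line: "space half_line = {0<..}"
  by (simp add: space_restrict_space)

lemma sets_log_measure [simp, measurable_cong]: "sets log_measure = sets half_line"
  by (simp add: log_measure_def)

lemma space_log_measure: "space log_measure = {0<..}"
  by (simp add: log_measure_def space_half_line)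

lemma borel_measurable_half_line: "f \<in> borel_measurable borel \<Longrightarrow> f \<in> borel_measurable half_line"
  by (intro measurable_restrict_space1 measurable_completion) simp

lemma borel_measurable_log_measure: "f \<in> borel_measurable borel \<Longrightarrow> f \<in> borel_measurable log_measure"
  using borel_measurable_half_line measurable_cong_sets[OF sets_log_measure refl] by blast

lemma nn_integral_half_line:
  "nn_integral half_line g = (\<integral>\<^sup>+ t. g t * indicator {0<..} t \<partial>lborel)"
  by (subst nn_integral_restrict_space) (simp_all add: nn_integral_completion)

lemma AE_half_line_iff: "(AE t in half_line. Q t) \<longleftrightarrow> (AE t in lborel. 0 < t \<longrightarrow> Q t)"
  by (subst AE_restrict_space_iff) (simp_all add: AE_completion_iff)

lemma nn_integral_log_measure:
  assumes "g \<in> borel_measurable half_line"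
  shows "nn_integral log_measure g = nn_integral half_line (\<lambda>t. ennreal (1 / t) * g t)"
  unfolding log_measure_def
  by (rule nn_integral_density) (auto intro: borel_measurable_half_line assms)

lemma AE_log_measure_iff: "(AE t in log_measure. Q t) \<longleftrightarrow> (AE t in half_line. Q t)"
proof -
  have "(AE t in log_measure. Q t) \<longleftrightarrow> (AE t in half_line. 0 < ennreal (1 / t) \<longrightarrow> Q t)"
    unfolding log_measure_def by (rule AE_density) (rule borel_measurable_half_line, measurable)
  also have "\<dots> \<longleftrightarrow> (AE t in half_line. Q t)"
    unfolding AE_half_line_iff by (intro AE_cong) auto
  finally show ?thesis .
qed

text \<open>\<open>half_line\<close> carries the Lebesgue sets. The substitution rules below are
  proved for Borel functions and transferred through such a version, which requires that the map
  pulls null sets back to null sets.\<close>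

lemma half_line_borel_version:
  fixes g :: "real \<Rightarrow> ennreal"
  assumes "g \<in> borel_measurable half_line"
  obtains g' where "g' \<in> borel_measurable borel" "AE t in half_line. g t = g' t"
proof -
  have "(\<lambda>t. g t * indicator {0<..} t) \<in> borel_measurable lebesgue"
    using assms by (subst (asm) borel_measurable_restrict_space_iff_ennreal) auto
  then obtain g' where g': "g' \<in> borel_measurable lborel" "AE t in lborel. g t * indicator {0<..} t = g' t"
    using completion_ex_borel_measurable by blast
  have "AE t in half_line. g t = g' t"
    unfolding AE_half_line_iff using g'(2) by eventually_elim auto
  then show ?thesis using g' that by simp
qed

text \<open>The preimage of a Lebesgue set under a Borel map may fail to be measurable. If Borel
  null sets have null preimages, completeness of \<open>half_line\<close> repairs this, and almost
  everywhere statements can be composed with the map.\<close>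

lemma
  assumes P: "P \<in> borel_measurable borel" "\<And>t. 0 < t \<Longrightarrow> 0 < (P t :: real)"
    and null: "\<And>N. N \<in> null_sets lborel \<Longrightarrow> (\<integral>\<^sup>+ t. indicator N (P t) * indicator {0<..} t \<partial>lborel) = 0"
  shows measurable_half_line_map: "P \<in> measurable half_line half_line"
    and AE_half_line_map: "(AE t in half_line. Q t) \<Longrightarrow> AE t in half_line. Q (P t)"
proof -
  have Pm [measurable]: "P \<in> measurable half_line lborel" using P(1) by (simp add: borel_measurable_half_line)
  have null': "emeasure half_line (P -` N \<inter> {0<..}) = 0" if N: "N \<in> null_sets lborel" for N
  proof -
    have "P -` N \<inter> space half_line \<in> sets half_line" using N by (intro measurable_sets[OF Pm]) auto
    then have "emeasure half_line (P -` N \<inter> {0<..}) = (\<integral>\<^sup>+ t. indicator (P -` N \<inter> {0<..}) t \<partial>half_line)"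
      by (simp add: space_half_line)
    also have "\<dots> = (\<integral>\<^sup>+ t. indicator N (P t) * indicator {0<..} t \<partial>lborel)"
      unfolding nn_integral_half_line by (intro nn_integral_cong) (auto simp: indicator_def)
    finally show ?thesis using null[OF N] by simp
  qed
  have "complete_measure half_line"
  proof
    fix A B assume AB: "B \<subseteq> A" "A \<in> null_sets half_line"
    then have "A \<in> null_sets lebesgue" "A \<subseteq> {0<..}"
      by (auto simp: null_sets_restrict_space)
    then have "B \<in> sets lebesgue" using AB(1) completion.complete by blast
    then show "B \<in> sets half_line" using AB \<open>A \<subseteq> {0<..}\<close> by (subst sets_restrict_space_iff) auto
  qed
  then interpret complete_measure half_line .
  have "P \<in> measurable half_line lebesgue"
  proof (rule measurable_completion2[OF Pm], rule subsetI)
    fix N :: "real set" assume N: "N \<in> null_sets lborel"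
    then show "N \<in> null_sets (distr half_line lborel P)"
      using null'[OF N] null_setsD2[OF N]
      by (intro null_setsI) (simp_all add: emeasure_distr[OF Pm] space_half_line)
  qed
  then show "P \<in> measurable half_line half_line"
    using P(2) by (intro measurable_restrict_space2) (auto simp: space_half_line)
  assume "AE t in half_line. Q t"
  then have "AE t in lborel. 0 < t \<longrightarrow> Q t" by (simp only: AE_half_line_iff)
  then obtain N where N: "N \<in> null_sets lborel" "{t. \<not> (0 < t \<longrightarrow> Q t)} \<subseteq> N"
    by (auto elim!: AE_E simp: null_sets_def)
  show "AE t in half_line. Q (P t)"
  proof (rule AE_I')
    show "P -` N \<inter> {0<..} \<in> null_sets half_line"
      using null'[OF N(1)] measurable_sets[OF Pm, of N] N(1) by (intro null_setsI) (auto simp: space_half_line)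
    show "{t \<in> space half_line. \<not> Q (P t)} \<subseteq> P -` N \<inter> {0<..}"
      using N(2) P(2) by (auto simp: space_half_line)
  qed
qed

text \<open>The image of dt/t under the logarithm is Lebesgue measure on the line, since its mass on
  an interval (l, u) is ln (exp u) - ln (exp l).\<close>

lemma nn_integral_exp_substitution:
  assumes [measurable]: "g \<in> borel_measurable borel"
  shows "(\<integral>\<^sup>+ t. ennreal (1 / t) * g t * indicator {0<..} t \<partial>lborel) = (\<integral>\<^sup>+ u. g (exp u) \<partial>lborel)"
proof -
  define L where "L = density lborel (\<lambda>t::real. ennreal (1 / t) * indicator {0<..} t)"
  have sL [measurable_cong]: "sets L = sets borel" by (simp add: L_def)
  have "lborel = distr L borel ln"
  proof (rule lborel_eqI)
    fix l u :: real assume "\<And>b. b \<in> Basis \<Longrightarrow> l \<bullet> b \<le> u \<bullet> b"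
    then have lu: "l \<le> u" by simp
    have "emeasure (distr L borel ln) (box l u) = emeasure L (ln -` box l u)"
      by (subst emeasure_distr) (auto simp: L_def)
    also have "\<dots> = (\<integral>\<^sup>+ t. ennreal (1 / t) * indicator {0<..} t * indicator (ln -` box l u) t \<partial>lborel)"
      unfolding L_def
    proof (rule emeasure_density)
      have "ln -` box l u \<inter> space borel \<in> sets borel" by (rule measurable_sets[of ln borel borel]) auto
      then show "ln -` box l u \<in> sets lborel" by simp
    qed measurable
    also have "\<dots> = (\<integral>\<^sup>+ t. ennreal (1 / t * indicator {0<..} t) * indicator {exp l..exp u} t \<partial>lborel)"
    proof (rule nn_integral_cong_AE)
      have "AE t in lborel. t \<noteq> exp l" "AE t in lborel. t \<noteq> exp u" by (rule AE_lborel_singleton)+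
      then show "AE t in lborel. ennreal (1 / t) * indicator {0<..} t * indicator (ln -` box l u) t
        = ennreal (1 / t * indicator {0<..} t) * indicator {exp l..exp u} t"
      proof eventually_elim
        case (elim t)
        show ?case
        proof (cases "0 < t")
          case True
          then have "ln t \<in> box l u \<longleftrightarrow> t \<in> {exp l..exp u}"
          proof -
            have "l < ln t \<longleftrightarrow> exp l < t" "ln t < u \<longleftrightarrow> t < exp u"
              using True by (metis exp_less_cancel_iff exp_ln)+
            then show ?thesis using elim by (auto simp: box_real)
          qed
          then show ?thesis using True by (auto simp: indicator_def)
        next
          case False
          then show ?thesis using less_le_trans[OF exp_gt_zero, of l t] by (auto simp: indicator_def)
        qed
      qed
    qed
    also have "\<dots> = ln (exp u) - ln (exp l)"
    proof (rule nn_integral_FTC_Icc)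
      fix x assume "x \<in> {exp l..exp u}"
      then have x: "0 < x" using less_le_trans[OF exp_gt_zero, of l x] by simp
      then show "DERIV ln x :> 1 / x * indicator {0<..} x"
        by (auto intro!: derivative_eq_intros)
      show "0 \<le> 1 / x * indicator {0<..} x" using x by simp
    qed (use lu in auto)
    finally show "emeasure (distr L borel ln) (box l u) = (\<Prod>b\<in>Basis. (u - l) \<bullet> b)" by simp
  qed simp
  then have "(\<integral>\<^sup>+ u. g (exp u) \<partial>lborel) = (\<integral>\<^sup>+ u. g (exp u) \<partial>distr L borel ln)" by simp
  also have "\<dots> = (\<integral>\<^sup>+ t. g (exp (ln t)) \<partial>L)" by (intro nn_integral_distr) auto
  also have "\<dots> = (\<integral>\<^sup>+ t. ennreal (1 / t) * indicator {0<..} t * g (exp (ln t)) \<partial>lborel)"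
    unfolding L_def by (rule nn_integral_density) auto
  also have "\<dots> = (\<integral>\<^sup>+ t. ennreal (1 / t) * g t * indicator {0<..} t \<partial>lborel)"
    by (intro nn_integral_cong) (auto simp: indicator_def)
  finally show ?thesis by simp
qed

lemma nn_integral_log_measure_borel:
  assumes [measurable]: "g \<in> borel_measurable borel"
  shows "nn_integral log_measure g = (\<integral>\<^sup>+ u. g (exp u) \<partial>lborel)"
  using nn_integral_exp_substitution[OF assms]
  by (simp add: nn_integral_log_measure borel_measurable_half_line nn_integral_half_line)

text \<open>Affine in the variable ln t, so it changes dt/t only by the constant 1/|p|. It covers
  the passage from measures to radii (p = 1/d), dyadic dilations (p = 1) and inversion (p =
  -1).\<close>

definition power_map :: "real \<Rightarrow> real \<Rightarrow> real \<Rightarrow> real" where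
  "power_map A p t = A * t powr p"

lemma power_map_borel [measurable]: "power_map A p \<in> borel_measurable borel"
  unfolding power_map_def by measurable

lemma power_map_pos: "0 < A \<Longrightarrow> 0 < t \<Longrightarrow> 0 < power_map A p t"
  by (simp add: power_map_def)

lemma power_map_integral_borel:
  assumes A: "0 < A" and p: "p \<noteq> 0" and [measurable]: "g \<in> borel_measurable borel"
  shows "nn_integral log_measure (\<lambda>t. g (power_map A p t)) = ennreal (1 / \<bar>p\<bar>) * nn_integral log_measure g"
proof -
  have *: "power_map A p (exp u) = exp (ln A + p * u)" for u
    using A by (simp add: power_map_def powr_def exp_add)
  have "nn_integral log_measure g = ennreal \<bar>p\<bar> * (\<integral>\<^sup>+ u. g (exp (ln A + p * u)) \<partial>lborel)"
    unfolding nn_integral_log_measure_borel[OF assms(3)] using p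
    by (intro nn_integral_real_affine[where f = "\<lambda>u. g (exp u)"]) auto
  then show ?thesis using p
    by (simp add: nn_integral_log_measure_borel * mult.assoc[symmetric] ennreal_mult[symmetric])
qed

lemma null_borel_log_measure:
  assumes P [measurable]: "P \<in> borel_measurable borel" and N: "N \<in> sets borel"
    and 0: "nn_integral log_measure (\<lambda>t. indicator N (P t)) = 0"
  shows "(\<integral>\<^sup>+ t. indicator N (P t) * indicator {0<..} t \<partial>lborel) = 0"
proof -
  have [measurable]: "(\<lambda>t. indicator N (P t) :: ennreal) \<in> borel_measurable borel" using N by measurable
  then have "AE t in log_measure. indicator N (P t) = (0 :: ennreal)"
    using 0 by (subst nn_integral_0_iff_AE[symmetric]) (auto intro: borel_measurable_log_measure)
  then have "AE t in lborel. 0 < t \<longrightarrow> indicator N (P t) = (0 :: ennreal)"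
    by (simp only: AE_log_measure_iff AE_half_line_iff)
  then show ?thesis by (subst nn_integral_0_iff_AE) auto
qed

lemma log_measure_null:
  assumes "N \<in> null_sets lborel" shows "nn_integral log_measure (indicator N) = 0"
proof -
  have [measurable]: "N \<in> sets borel" using assms by auto
  have "AE t in lborel. t \<notin> N" using assms by (rule AE_not_in)
  then have "AE t in log_measure. indicator N t = (0 :: ennreal)"
    unfolding AE_log_measure_iff AE_half_line_iff by eventually_elim auto
  then show ?thesis by (subst nn_integral_0_iff_AE) (auto intro: borel_measurable_log_measure)
qed

lemma
  assumes A: "0 < A" and p: "p \<noteq> 0"
  shows power_map_measurable: "power_map A p \<in> measurable half_line half_line"
    and power_map_AE: "(AE t in half_line. Q t) \<Longrightarrow> AE t in half_line. Q (power_map A p t)"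
proof -
  have n: "(\<integral>\<^sup>+ t. indicator N (power_map A p t) * indicator {0<..} t \<partial>lborel) = 0"
    if N: "N \<in> null_sets lborel" for N
    using N power_map_integral_borel[OF A p, of "indicator N"] log_measure_null[OF N]
    by (intro null_borel_log_measure) auto
  show "power_map A p \<in> measurable half_line half_line"
    by (rule measurable_half_line_map[OF power_map_borel power_map_pos[OF A] n])
  show "(AE t in half_line. Q t) \<Longrightarrow> AE t in half_line. Q (power_map A p t)"
    by (rule AE_half_line_map[OF power_map_borel power_map_pos[OF A] n])
qed

lemma power_map_integral:
  assumes A: "0 < A" and p: "p \<noteq> 0" and g: "g \<in> borel_measurable half_line"
  shows "nn_integral log_measure (\<lambda>t. g (power_map A p t)) = ennreal (1 / \<bar>p\<bar>) * nn_integral log_measure g"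
proof -
  obtain g' where [measurable]: "g' \<in> borel_measurable borel" and ae: "AE t in half_line. g t = g' t"
    using g by (rule half_line_borel_version)
  have "nn_integral log_measure (\<lambda>t. g (power_map A p t)) = nn_integral log_measure (\<lambda>t. g' (power_map A p t))"
    using power_map_AE[OF A p ae] by (intro nn_integral_cong_AE) (simp add: AE_log_measure_iff)
  also have "\<dots> = ennreal (1 / \<bar>p\<bar>) * nn_integral log_measure g'" by (rule power_map_integral_borel[OF A p]) simp
  also have "nn_integral log_measure g' = nn_integral log_measure g"
    using ae by (intro nn_integral_cong_AE) (auto simp: AE_log_measure_iff)
  finally show ?thesis .
qed

section \<open>The substitution t = exp (-u) on the unit interval\<close>

lemma exp_map_integral_borel:
  assumes [measurable]: "g \<in> borel_measurable borel"
  shows "nn_integral half_line (\<lambda>u. g (exp (- u))) = nn_integral log_measure (\<lambda>t. g t * indicator {0<..<1} t)"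
proof -
  have "nn_integral log_measure (\<lambda>t. g t * indicator {0<..<1} t) = (\<integral>\<^sup>+ u. g (exp u) * indicator {0<..<1} (exp u) \<partial>lborel)"
    by (rule nn_integral_log_measure_borel) simp
  also have "\<dots> = ennreal \<bar>-1\<bar> * (\<integral>\<^sup>+ u. g (exp (0 + (-1) * u)) * indicator {0<..<1} (exp (0 + (-1) * u)) \<partial>lborel)"
    by (intro nn_integral_real_affine[where f = "\<lambda>u. g (exp u) * indicator {0<..<1} (exp u)"]) auto
  also have "\<dots> = (\<integral>\<^sup>+ u. g (exp (- u)) * indicator {0<..} u \<partial>lborel)"
    by (simp, intro nn_integral_cong) (auto simp: indicator_def)
  finally show ?thesis by (simp add: nn_integral_half_line)
qed

lemma exp_map_null:
  fixes N :: "real set"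
  assumes N: "N \<in> null_sets lborel"
  shows "(\<integral>\<^sup>+ u. indicator N (exp (- u)) * indicator {0<..} u \<partial>lborel) = 0"
proof -
  have [measurable]: "N \<in> sets borel" using N by auto
  have "nn_integral half_line (\<lambda>u. indicator N (exp (- u))) \<le> nn_integral log_measure (indicator N)"
    by (subst exp_map_integral_borel) (auto simp: indicator_def intro!: nn_integral_mono)
  then show ?thesis using log_measure_null[OF N] by (simp add: nn_integral_half_line)
qed

lemma
  shows exp_map_measurable: "(\<lambda>u. exp (- u)) \<in> measurable half_line half_line"
    and exp_map_AE: "(AE t in half_line. Q t) \<Longrightarrow> AE u in half_line. Q (exp (- u))"
  by (rule measurable_half_line_map[OF _ _ exp_map_null] AE_half_line_map[OF _ _ exp_map_null]; simp)+

lemma exp_map_integral: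
  assumes g: "g \<in> borel_measurable half_line"
  shows "nn_integral half_line (\<lambda>u. g (exp (- u))) = nn_integral log_measure (\<lambda>t. g t * indicator {0<..<1} t)"
proof -
  obtain g' where [measurable]: "g' \<in> borel_measurable borel" and ae: "AE t in half_line. g t = g' t"
    using g by (rule half_line_borel_version)
  have "nn_integral half_line (\<lambda>u. g (exp (- u))) = nn_integral half_line (\<lambda>u. g' (exp (- u)))"
    using exp_map_AE[OF ae] by (intro nn_integral_cong_AE)
  also have "\<dots> = nn_integral log_measure (\<lambda>t. g' t * indicator {0<..<1} t)" by (rule exp_map_integral_borel) simp
  also have "\<dots> = nn_integral log_measure (\<lambda>t. g t * indicator {0<..<1} t)"
    by (intro nn_integral_cong_AE, unfold AE_log_measure_iff, use ae in eventually_elim) simp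
  finally show ?thesis .
qed

text \<open>The value at 1 only serves to keep the map inside the half line.\<close>

definition ln_map :: "real \<Rightarrow> real" where
  "ln_map t = (if t = 1 then 1 else \<bar>ln t\<bar>)"

lemma ln_map_borel [measurable]: "ln_map \<in> borel_measurable borel"
  unfolding ln_map_def by measurable

lemma ln_map_integral_borel:
  assumes [measurable]: "g \<in> borel_measurable borel"
  shows "nn_integral log_measure (\<lambda>t. g (ln_map t) * indicator {0<..<1} t) = nn_integral half_line g"
proof -
  have "nn_integral log_measure (\<lambda>t. g (ln_map t) * indicator {0<..<1} t)
      = nn_integral half_line (\<lambda>u. g (ln_map (exp (- u))))"
    by (rule exp_map_integral_borel[symmetric]) simp
  also have "\<dots> = nn_integral half_line g"
    by (intro nn_integral_cong) (auto simp: ln_map_def space_half_line)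
  finally show ?thesis .
qed

text \<open>In the variable u = ln t the map is |u| away from u = 0, so points sent into N have u in
  N or -u in N.\<close>

lemma ln_map_null:
  assumes N: "N \<in> null_sets lborel"
  shows "(\<integral>\<^sup>+ t. indicator N (ln_map t) * indicator {0<..} t \<partial>lborel) = 0"
proof (rule null_borel_log_measure)
  show [measurable]: "N \<in> sets borel" using N by auto
  have ae: "AE u in lborel. u \<notin> N" using N by (rule AE_not_in)
  have "AE u in lborel. - u \<notin> N"
  proof -
    have "(\<integral>\<^sup>+ u. indicator N u \<partial>lborel) = ennreal \<bar>-1\<bar> * (\<integral>\<^sup>+ u. indicator N (0 + (-1) * u) \<partial>lborel)"
      by (intro nn_integral_real_affine) auto
    then have "(\<integral>\<^sup>+ u. indicator N (- u) \<partial>lborel) = 0" using N by (simp add: null_sets_def)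
    then have "AE u in lborel. indicator N (- u) = (0 :: ennreal)" by (subst (asm) nn_integral_0_iff_AE) auto
    then show ?thesis by eventually_elim (auto simp: indicator_def split: if_splits)
  qed
  then have "AE u in lborel. indicator N (ln_map (exp u)) = (0 :: ennreal)"
    using ae AE_lborel_singleton[of 0]
    by eventually_elim (auto simp: ln_map_def abs_if)
  then have "(\<integral>\<^sup>+ u. indicator N (ln_map (exp u)) \<partial>lborel) = (0 :: ennreal)"
    by (subst nn_integral_0_iff_AE) auto
  then show "nn_integral log_measure (\<lambda>t. indicator N (ln_map t)) = 0"
    by (subst nn_integral_log_measure_borel) auto
qed simp

lemma ln_map_pos: "0 < t \<Longrightarrow> 0 < ln_map t"
  by (simp add: ln_map_def)

lemma ln_map_measurable: "ln_map \<in> measurable half_line half_line"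
    and ln_map_AE: "(AE t in half_line. Q t) \<Longrightarrow> AE t in half_line. Q (ln_map t)"
  by (rule measurable_half_line_map[OF ln_map_borel ln_map_pos ln_map_null]
    AE_half_line_map[OF ln_map_borel ln_map_pos ln_map_null]; simp)+

lemma ln_map_integral:
  assumes g: "g \<in> borel_measurable half_line"
  shows "nn_integral log_measure (\<lambda>t. g (ln_map t) * indicator {0<..<1} t) = nn_integral half_line g"
proof -
  obtain g' where [measurable]: "g' \<in> borel_measurable borel" and ae: "AE t in half_line. g t = g' t"
    using g by (rule half_line_borel_version)
  have "nn_integral log_measure (\<lambda>t. g (ln_map t) * indicator {0<..<1} t)
      = nn_integral log_measure (\<lambda>t. g' (ln_map t) * indicator {0<..<1} t)"
    by (intro nn_integral_cong_AE, unfold AE_log_measure_iff, use ln_map_AE[OF ae] in eventually_elim) simp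
  also have "\<dots> = nn_integral half_line g'" by (rule ln_map_integral_borel) simp
  also have "\<dots> = nn_integral half_line g" using ae by (intro nn_integral_cong_AE) auto
  finally show ?thesis .
qed

section \<open>Dilations of the half line\<close>

lemma dil_map_integral_borel:
  assumes s: "0 < s" and [measurable]: "g \<in> borel_measurable borel"
  shows "nn_integral half_line (\<lambda>t. g (t / s)) = ennreal s * nn_integral half_line g"
proof -
  have "nn_integral half_line (\<lambda>t. g (t / s)) = (\<integral>\<^sup>+ t. g (t / s) * indicator {0<..} t \<partial>lborel)"
    by (rule nn_integral_half_line)
  also have "\<dots> = ennreal \<bar>s\<bar> * (\<integral>\<^sup>+ t. g ((0 + s * t) / s) * indicator {0<..} (0 + s * t) \<partial>lborel)"
    using s by (intro nn_integral_real_affine[where f = "\<lambda>t. g (t / s) * indicator {0<..} t"]) auto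
  also have "(\<integral>\<^sup>+ t. g ((0 + s * t) / s) * indicator {0<..} (0 + s * t) \<partial>lborel) = nn_integral half_line g"
    unfolding nn_integral_half_line using s by (intro nn_integral_cong) (auto simp: indicator_def zero_less_mult_iff)
  finally show ?thesis using s by simp
qed

lemma dil_map_null:
  fixes N :: "real set"
  assumes s: "0 < s" and N: "N \<in> null_sets lborel"
  shows "(\<integral>\<^sup>+ t. indicator N (t / s) * indicator {0<..} t \<partial>lborel) = 0"
proof -
  have [measurable]: "N \<in> sets borel" using N by auto
  have "nn_integral half_line (indicator N) \<le> (\<integral>\<^sup>+ t. indicator N t \<partial>lborel)"
    unfolding nn_integral_half_line by (intro nn_integral_mono) (auto simp: indicator_def)
  also have "\<dots> = 0" using N by auto
  finally show ?thesis using dil_map_integral_borel[OF s, of "indicator N"] by (simp add: nn_integral_half_line)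
qed

lemma
  assumes s: "0 < (s::real)"
  shows dil_map_measurable: "(\<lambda>t. t / s) \<in> measurable half_line half_line"
    and dil_map_AE: "(AE t in half_line. Q t) \<Longrightarrow> AE t in half_line. Q (t / s)"
  by (rule measurable_half_line_map[OF _ _ dil_map_null[OF s]]
    AE_half_line_map[OF _ _ dil_map_null[OF s]]; use s in simp)+

lemma dil_map_integral:
  assumes s: "0 < s" and g: "g \<in> borel_measurable half_line"
  shows "nn_integral half_line (\<lambda>t. g (t / s)) = ennreal s * nn_integral half_line g"
proof -
  obtain g' where [measurable]: "g' \<in> borel_measurable borel" and ae: "AE t in half_line. g t = g' t"
    using g by (rule half_line_borel_version)
  have "nn_integral half_line (\<lambda>t. g (t / s)) = nn_integral half_line (\<lambda>t. g' (t / s))"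
    using dil_map_AE[OF s ae] by (intro nn_integral_cong_AE)
  also have "\<dots> = ennreal s * nn_integral half_line g'" by (rule dil_map_integral_borel[OF s]) simp
  also have "nn_integral half_line g' = nn_integral half_line g" using ae by (intro nn_integral_cong_AE) auto
  finally show ?thesis .
qed

section \<open>The parameter space and its logarithmic companion\<close>

lemma rearr_int_measurable:
  assumes [measurable]: "f \<in> borel_measurable M"
  shows "rearr_int M f \<in> borel_measurable borel"
proof -
  have "(\<lambda>p :: real \<times> real. indicator {0<..<fst p} (snd p) :: ennreal) = (\<lambda>p. if 0 < snd p \<and> snd p < fst p then 1 else 0)"
    by (auto simp: fun_eq_iff)
  then have [measurable]: "(\<lambda>p :: real \<times> real. indicator {0<..<fst p} (snd p) :: ennreal) \<in> borel_measurable (borel \<Otimes>\<^sub>M lborel)"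
    by (simp only:) measurable
  have "(\<lambda>t. \<integral>\<^sup>+ s. rearr M f s * indicator {0<..<t} s \<partial>lborel) \<in> borel_measurable borel"
    by (intro lborel.borel_measurable_nn_integral) (simp add: case_prod_beta')
  then show ?thesis by (simp add: rearr_int_def[abs_def])
qed

lemma
  assumes [measurable]: "f \<in> borel_measurable M"
  shows max_rearr_measurable: "max_rearr M f \<in> borel_measurable borel"
    and osc_measurable: "osc M f \<in> borel_measurable borel"
proof -
  have [measurable]: "rearr_int M f \<in> borel_measurable borel" by (rule rearr_int_measurable) fact
  have eq: "max_rearr M f = (\<lambda>t. rearr_int M f t / ennreal t)" by (simp add: max_rearr_eq fun_eq_iff)
  show m [measurable]: "max_rearr M f \<in> borel_measurable borel" unfolding eq by measurable
  show "osc M f \<in> borel_measurable borel" unfolding osc_def[abs_def] by measurable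
qed

lemma ennreal_le_suminf: "f i \<le> (\<Sum>i. f i :: ennreal)"
  using sum_le_suminf[OF summableI, of "{i}" f] by simp

text \<open>On the shell [u/a^(j+1), u/a^j) the rearrangement is at most its value at the left end,
  and the shell has length at most u/a^j. Unlike the integral, the resulting series can be estimated
  term by term with dilation norms.\<close>

lemma max_rearr_le_geometric:
  assumes f [measurable]: "f \<in> borel_measurable M" and a: "1 < a" and u: "0 < u"
  shows "max_rearr M f u \<le> (\<Sum>j. ennreal ((1 / a) ^ j) * rearr M f (u / a ^ Suc j))"
proof -
  define J where "J j = {u / a ^ Suc j..<u / a ^ j}" for j
  have "rearr_int M f u \<le> (\<integral>\<^sup>+ s. (\<Sum>j. rearr M f (u / a ^ Suc j) * indicator (J j) s) \<partial>lborel)"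
    unfolding rearr_int_def
  proof (intro nn_integral_mono)
    fix s
    show "rearr M f s * indicator {0<..<u} s \<le> (\<Sum>j. rearr M f (u / a ^ Suc j) * indicator (J j) s)"
    proof (cases "s \<in> {0<..<u}")
      case True
      obtain n where "u / s < a ^ n" using real_arch_pow[OF a] by blast
      also have "\<dots> \<le> a ^ Suc n" using a by (simp add: mult_le_cancel_right1)
      finally have "u \<le> s * a ^ Suc n" using True by (simp add: field_simps)
      then have ex: "\<exists>n. u \<le> s * a ^ Suc n" by blast
      define i where "i = (LEAST n. u \<le> s * a ^ Suc n)"
      have i: "u \<le> s * a ^ Suc i" unfolding i_def using ex by (rule LeastI_ex)
      have "s * a ^ i < u"
      proof (cases i)
        case (Suc m)
        then show ?thesis using not_less_Least[of m "\<lambda>n. u \<le> s * a ^ Suc n"] by (simp add: i_def)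
      qed (use True in simp)
      moreover have "0 < a ^ i" "0 < a ^ Suc i" using a by simp_all
      ultimately have "s \<in> J i"
        unfolding J_def atLeastLessThan_iff using i by (metis pos_divide_le_eq pos_less_divide_eq)
      then have "rearr M f s * indicator {0<..<u} s \<le> rearr M f (u / a ^ Suc i) * indicator (J i) s"
        using True by (simp add: J_def rearr_antimono)
      also have "\<dots> \<le> (\<Sum>j. rearr M f (u / a ^ Suc j) * indicator (J j) s)"
        by (rule ennreal_le_suminf[of "\<lambda>j. rearr M f (u / a ^ Suc j) * indicator (J j) s"])
      finally show ?thesis .
    qed simp
  qed
  also have "\<dots> = (\<Sum>j. rearr M f (u / a ^ Suc j) * emeasure lborel (J j))"
    by (subst nn_integral_suminf) (simp_all add: J_def nn_integral_cmult_indicator)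
  also have "\<dots> \<le> (\<Sum>j. ennreal u * (ennreal ((1 / a) ^ j) * rearr M f (u / a ^ Suc j)))"
  proof (intro suminf_le)
    fix j
    have "u / a ^ Suc j \<le> u / a ^ j" using a u by (intro divide_left_mono) auto
    then have "emeasure lborel (J j) = ennreal (u / a ^ j - u / a ^ Suc j)" by (simp add: J_def)
    also have "\<dots> \<le> ennreal (u * (1 / a) ^ j)" using a u by (intro ennreal_leI) (simp add: power_divide)
    also have "\<dots> = ennreal u * ennreal ((1 / a) ^ j)" using u a by (intro ennreal_mult) auto
    finally have "emeasure lborel (J j) * rearr M f (u / a ^ Suc j)
        \<le> ennreal u * ennreal ((1 / a) ^ j) * rearr M f (u / a ^ Suc j)"
      by (rule mult_right_mono) simp
    then show "rearr M f (u / a ^ Suc j) * emeasure lborel (J j)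
        \<le> ennreal u * (ennreal ((1 / a) ^ j) * rearr M f (u / a ^ Suc j))"
      by (simp add: ac_simps)
  qed auto
  also have "\<dots> = (\<Sum>j. ennreal ((1 / a) ^ j) * rearr M f (u / a ^ Suc j)) * ennreal u"
    by (simp add: ennreal_suminf_cmult mult.commute)
  finally have "max_rearr M f u \<le> (\<Sum>j. ennreal ((1 / a) ^ j) * rearr M f (u / a ^ Suc j)) * ennreal u / ennreal u"
    unfolding max_rearr_eq by (rule divide_right_mono_ennreal)
  then show ?thesis using u by (simp add: ennreal_mult_divide_eq)
qed

locale interpolation_parameter =
  fixes E :: "(real \<Rightarrow> ennreal) \<Rightarrow> ennreal" and \<F> :: "fnorm \<Rightarrow> fnorm \<Rightarrow> fnorm"
  assumes par: "parameter E \<F>"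
begin

abbreviation "N \<equiv> tilde_norm \<F>"
abbreviation "T \<equiv> \<F> (L1n log_measure) (Linfn log_measure)"

lemma exact_F: "exact_interpolation_functor \<F>"
  using par by (simp add: parameter_def)

lemma F_half_line: "\<F> (L1n half_line) (Linfn half_line) = fnorm_of half_line E"
  using par by (simp add: parameter_def)

section \<open>The companion norm over dt/t as a lattice norm\<close>

lemma banach_T: "banach_norm T"
  using exact_F banach_couple_L1_Linf[of log_measure] unfolding exact_interpolation_functor_def by blast

lemma T_cmult: "T (\<lambda>t. c * f t) = ennreal \<bar>c\<bar> * T f"
  and T_add: "T (\<lambda>t. f t + g t) \<le> T f + T g"
  using banach_T unfolding banach_norm_def by blast+

lemma T_upper: obtains C :: real where "C > 0" "\<And>f. T f \<le> ennreal C * max (L1n log_measure f) (Linfn log_measure f)"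
  using exact_F banach_couple_L1_Linf[of log_measure] unfolding exact_interpolation_functor_def by blast

lemma T_lower: obtains C :: real where "C > 0" "\<And>f. sum_norm (L1n log_measure) (Linfn log_measure) f \<le> ennreal C * T f"
  using exact_F banach_couple_L1_Linf[of log_measure] unfolding exact_interpolation_functor_def by blast

lemma log_half_measurable [simp]: "f \<in> borel_measurable log_measure \<longleftrightarrow> f \<in> borel_measurable half_line"
  by (simp cong: measurable_cong_sets)

text \<open>The norm of the functor dominates a multiple of the sum norm, and a decomposition of
  finite norm consists of measurable functions.\<close>

lemma T_finite_measurable:
  assumes "T f < \<infinity>" shows "f \<in> borel_measurable half_line"
proof -
  obtain C where C: "C > 0" "\<And>f. sum_norm (L1n log_measure) (Linfn log_measure) f \<le> ennreal C * T f"
    by (rule T_lower) blast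
  have "sum_norm (L1n log_measure) (Linfn log_measure) f < \<infinity>"
    by (rule le_less_trans[OF C(2)]) (use assms in \<open>simp add: ennreal_mult_less_top\<close>)
  then obtain g where g: "L1n log_measure g + Linfn log_measure (\<lambda>t. f t - g t) < \<infinity>"
    by (auto simp: sum_norm_def INF_less_iff)
  then have [measurable]: "g \<in> borel_measurable half_line" "(\<lambda>t. f t - g t) \<in> borel_measurable half_line"
    by (auto simp: fnorm_of_def split: if_splits)
  have "(\<lambda>t. (f t - g t) + g t) \<in> borel_measurable half_line" by measurable
  then show ?thesis by simp
qed

text \<open>The norm of the functor is at most a multiple of the intersection norm, which is 0 for a
  null function.\<close>

lemma T_null:
  assumes [measurable]: "f \<in> borel_measurable half_line" and ae: "AE t in half_line. f t = 0"
  shows "T f = 0"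
proof -
  obtain C where C: "C > 0" "\<And>f. T f \<le> ennreal C * max (L1n log_measure f) (Linfn log_measure f)"
    by (rule T_upper) blast
  have ae': "AE t in log_measure. absf f t = 0"
    unfolding AE_log_measure_iff using ae by eventually_elim simp
  have fm: "absf f \<in> borel_measurable log_measure" by simp
  have "L1n log_measure f = 0"
    using nn_integral_0_iff_AE[OF fm] ae' by (simp add: fnorm_of_def)
  moreover have "esssup log_measure (absf f) \<le> 0"
    using esssup_le_iff[OF fm, of 0] ae' by simp
  then have "Linfn log_measure f = 0" by (simp add: fnorm_of_def)
  ultimately show ?thesis using C(2)[of f] by simp
qed

text \<open>An interpolation space carries no order by definition. Here |f| <= |g| almost everywhere
  means f = m g almost everywhere with |m| <= 1; multiplication by m has norm at most 1 on both end
  points, and the difference f - m g is null.\<close>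

lemma T_mono:
  assumes [measurable]: "f \<in> borel_measurable half_line" and ae: "AE t in half_line. \<bar>f t\<bar> \<le> \<bar>g t\<bar>"
  shows "T f \<le> T g"
proof (cases "T g < \<infinity>")
  case True
  then have [measurable]: "g \<in> borel_measurable half_line" by (rule T_finite_measurable)
  define m where "m t = (if \<bar>f t\<bar> \<le> \<bar>g t\<bar> then f t / g t else 0)" for t
  have [measurable]: "m \<in> borel_measurable half_line" unfolding m_def by measurable
  have m1: "\<bar>m t\<bar> \<le> 1" for t by (auto simp: m_def divide_le_eq_1 abs_divide)
  have "T (\<lambda>t. m t * g (id t)) \<le> ennreal 1 * T g"
  proof (rule interpolation_weighted_composition[OF exact_F])
    fix h :: "real \<Rightarrow> ennreal" assume "h \<in> borel_measurable log_measure"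
    show "(\<integral>\<^sup>+ x. ennreal \<bar>m x\<bar> * h (id x) \<partial>log_measure) \<le> ennreal 1 * integral\<^sup>N log_measure h"
      using mult_right_mono[OF ennreal_leI[OF m1], of "h _"] by (auto intro!: nn_integral_mono simp: mult.commute)
  qed (auto simp: m1)
  moreover have "T f \<le> T (\<lambda>t. m t * g t) + T (\<lambda>t. f t - m t * g t)"
    using T_add[of "\<lambda>t. m t * g t" "\<lambda>t. f t - m t * g t"] by simp
  moreover have "T (\<lambda>t. f t - m t * g t) = 0"
    by (rule T_null, measurable, use ae in eventually_elim) (auto simp: m_def)
  ultimately show ?thesis by simp
qed (simp add: not_less top_unique)

lemma N_eq: "N g = (if AE t in half_line. g t < \<infinity> then T (\<lambda>t. enn2real (g t)) else \<infinity>)"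
  by (simp add: tilde_norm_def AE_log_measure_iff)

text \<open>Only the smaller function is assumed measurable, because the larger one will be the
  modulus as a function of the radius. If its norm is infinite the bound is trivial, and if it is
  finite \<open>T_finite_measurable\<close> supplies the measurability.\<close>

lemma N_mono:
  assumes [measurable]: "g \<in> borel_measurable half_line" and ae: "AE t in half_line. g t \<le> h t"
  shows "N g \<le> N h"
proof (cases "AE t in half_line. h t < \<infinity>")
  case True
  then have "AE t in half_line. g t < \<infinity>" using ae by eventually_elim (rule le_less_trans)
  moreover have "T (\<lambda>t. enn2real (g t)) \<le> T (\<lambda>t. enn2real (h t))"
    by (rule T_mono, measurable, use ae True in eventually_elim) (auto intro: enn2real_mono)
  ultimately show ?thesis using True by (simp add: N_eq)
qed (simp add: N_eq)

lemma N_cmult: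
  assumes "0 \<le> c" shows "N (\<lambda>t. ennreal c * g t) \<le> ennreal c * N g"
proof (cases "c = 0")
  case True
  have "T (\<lambda>t. 0) = 0" by (rule T_null) auto
  then show ?thesis using True by (simp add: N_eq)
next
  case False
  show ?thesis
  proof (cases "AE t in half_line. g t < \<infinity>")
    case True
    then have "AE t in half_line. ennreal c * g t < \<infinity>" by eventually_elim (simp add: ennreal_mult_less_top)
    then show ?thesis using True T_cmult[of c "\<lambda>t. enn2real (g t)"] assms
      by (simp add: N_eq enn2real_mult)
  qed (use False assms in \<open>simp add: N_eq ennreal_mult_top\<close>)
qed

lemma N_add:
  assumes [measurable]: "g \<in> borel_measurable half_line" "h \<in> borel_measurable half_line"
  shows "N (\<lambda>t. g t + h t) \<le> N g + N h"
proof (cases "(AE t in half_line. g t < \<infinity>) \<and> (AE t in half_line. h t < \<infinity>)")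
  case True
  then have g: "AE t in half_line. g t < \<infinity>" and h: "AE t in half_line. h t < \<infinity>" by auto
  from g h have s: "AE t in half_line. g t + h t < \<infinity>" by eventually_elim simp
  have "T (\<lambda>t. enn2real (g t + h t)) \<le> T (\<lambda>t. enn2real (g t) + enn2real (h t))"
    by (rule T_mono, measurable, use g h in eventually_elim) (simp add: enn2real_plus)
  also have "\<dots> \<le> T (\<lambda>t. enn2real (g t)) + T (\<lambda>t. enn2real (h t))" by (rule T_add)
  finally show ?thesis using g h s by (simp add: N_eq)
qed (auto simp: N_eq)

text \<open>The constant dominates the norms of the substitution on Linf and on L1 for dt/t, which
  are 1 and 1/|p|. In particular dilations (p = 1) and inversion (p = -1) have norm at most
  1.\<close>

lemma N_power_map:
  assumes A: "0 < A" and p: "p \<noteq> 0"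
  shows "N (\<lambda>t. g (power_map A p t)) \<le> ennreal (max 1 (1 / \<bar>p\<bar>)) * N g"
proof (cases "AE t in half_line. g t < \<infinity>")
  case True
  have "T (\<lambda>t. 1 * enn2real (g (power_map A p t))) \<le> ennreal (max 1 (1 / \<bar>p\<bar>)) * T (\<lambda>t. enn2real (g t))"
  proof (rule interpolation_weighted_composition[OF exact_F])
    show "power_map A p \<in> measurable log_measure log_measure"
      using power_map_measurable[OF A p] by (simp cong: measurable_cong_sets)
    fix h :: "real \<Rightarrow> ennreal" assume "h \<in> borel_measurable log_measure"
    then show "(\<integral>\<^sup>+ x. ennreal \<bar>1\<bar> * h (power_map A p x) \<partial>log_measure) \<le> ennreal (max 1 (1 / \<bar>p\<bar>)) * integral\<^sup>N log_measure h"
      by (simp add: power_map_integral[OF A p] mult_right_mono ennreal_leI)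
  qed auto
  moreover have "AE t in half_line. g (power_map A p t) < \<infinity>" using power_map_AE[OF A p True] .
  ultimately show ?thesis using True by (simp add: N_eq)
next
  case False
  have "max 1 (1 / \<bar>p\<bar>) \<noteq> 0" by linarith
  then show ?thesis using False by (simp add: N_eq ennreal_mult_top)
qed

section \<open>The function norm of the parameter space\<close>

lemma ri_E: "ri_norm half_line E"
  using par by (simp add: parameter_def)

lemma E_mono:
  assumes "f \<in> borel_measurable half_line" "g \<in> borel_measurable half_line" "AE t in half_line. f t \<le> g t"
  shows "E f \<le> E g"
  using ri_E assms unfolding ri_norm_def banach_function_norm_def by blast

lemma E_cmult: "f \<in> borel_measurable half_line \<Longrightarrow> 0 \<le> a \<Longrightarrow> E (\<lambda>x. ennreal a * f x) = ennreal a * E f"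
  using ri_E unfolding ri_norm_def banach_function_norm_def by blast

lemma E_add: "f \<in> borel_measurable half_line \<Longrightarrow> g \<in> borel_measurable half_line \<Longrightarrow> E (\<lambda>x. f x + g x) \<le> E f + E g"
  using ri_E unfolding ri_norm_def banach_function_norm_def by blast

lemma E_zero_iff: "f \<in> borel_measurable half_line \<Longrightarrow> E f = 0 \<longleftrightarrow> (AE x in half_line. f x = 0)"
  using ri_E unfolding ri_norm_def banach_function_norm_def by blast

lemma E_indicator: "A \<in> sets half_line \<Longrightarrow> emeasure half_line A < \<infinity> \<Longrightarrow> E (indicator A) < \<infinity>"
  using ri_E unfolding ri_norm_def banach_function_norm_def by blast

lemma E_fatou:
  assumes "\<And>i::nat. F i \<in> borel_measurable half_line" "f \<in> borel_measurable half_line"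
    "AE x in half_line. incseq (\<lambda>i. F i x) \<and> (\<lambda>i. F i x) \<longlonglongrightarrow> f x"
  shows "(\<lambda>i. E (F i)) \<longlonglongrightarrow> E f"
  using ri_E assms unfolding ri_norm_def banach_function_norm_def by blast

lemma E_finite_AE:
  assumes f [measurable]: "f \<in> borel_measurable half_line" and fin: "E f < \<infinity>"
  shows "AE t in half_line. f t < \<infinity>"
proof -
  have "AE t in half_line. t \<in> {0<..<real n} \<longrightarrow> f t < \<infinity>" for n :: nat
  proof -
    have A [measurable]: "{0<..<real n} \<in> sets half_line" by (auto simp: sets_restrict_space_iff)
    have "emeasure half_line {0<..<real n} < \<infinity>"
      by (subst emeasure_restrict_space) (auto simp: emeasure_completion)
    then obtain C :: real where "(\<integral>\<^sup>+ x\<in>{0<..<real n}. f x \<partial>half_line) \<le> ennreal C * E f"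
      using ri_E A f fin unfolding ri_norm_def banach_function_norm_def by blast
    also have "\<dots> < \<infinity>" using fin by (simp add: ennreal_mult_less_top)
    finally have "AE t in half_line. f t * indicator {0<..<real n} t \<noteq> \<infinity>"
      by (intro nn_integral_PInf_AE) (auto simp: less_top)
    then show ?thesis by eventually_elim (auto simp: less_top)
  qed
  then have "AE t in half_line. \<forall>n::nat. t \<in> {0<..<real n} \<longrightarrow> f t < \<infinity>" unfolding AE_all_countable by blast
  then have "AE t in lborel. 0 < t \<longrightarrow> (\<forall>n::nat. t \<in> {0<..<real n} \<longrightarrow> f t < \<infinity>)"
    by (simp only: AE_half_line_iff)
  then show ?thesis unfolding AE_half_line_iff
  proof eventually_elim
    case (elim t)
    obtain n :: nat where "t < real n" using reals_Archimedean2 by blast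
    then show ?case using elim by auto
  qed
qed

text \<open>The Fatou property along partial sums. It belongs to E and not a priori to the companion
  norm, so infinite sums there are transferred to E.\<close>

lemma E_suminf:
  assumes [measurable]: "\<And>j::nat. g j \<in> borel_measurable half_line"
  shows "E (\<lambda>t. \<Sum>j. g j t) \<le> (\<Sum>j. E (g j))"
proof -
  define S where "S n t = (\<Sum>j<n. g j t)" for n t
  have [measurable]: "S n \<in> borel_measurable half_line" for n unfolding S_def by measurable
  have "AE t in half_line. incseq (\<lambda>n. S n t) \<and> (\<lambda>n. S n t) \<longlonglongrightarrow> (\<Sum>j. g j t)"
    by (intro AE_I2 conjI incseq_SucI) (auto simp: S_def intro!: summable_LIMSEQ)
  then have "(\<lambda>n. E (S n)) \<longlonglongrightarrow> E (\<lambda>t. \<Sum>j. g j t)"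
    by (intro E_fatou) auto
  moreover have "E (S n) \<le> (\<Sum>j. E (g j))" for n
  proof -
    have "E (S n) \<le> (\<Sum>j<n. E (g j))"
    proof (induction n)
      case 0
      have "E (\<lambda>t. 0) = 0" by (subst E_zero_iff) auto
      then show ?case by (simp add: S_def[abs_def])
    next
      case (Suc n)
      have "E (\<lambda>t. S n t + g n t) \<le> E (S n) + E (g n)" by (intro E_add) auto
      also have "\<dots> \<le> (\<Sum>j<n. E (g j)) + E (g n)" by (intro add_right_mono Suc)
      finally show ?case by (simp add: S_def[abs_def])
    qed
    also have "\<dots> \<le> (\<Sum>j. E (g j))" by (intro sum_le_suminf) auto
    finally show ?thesis .
  qed
  ultimately show ?thesis by (blast intro: LIMSEQ_le_const2)
qed

text \<open>Both inequalities interpolate contractions: composition with exp (-u), from dt/t to du,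
  and in the other direction composition with \<open>ln_map\<close> followed by the cut to the unit
  interval. This makes the abstract value of the functor concrete.\<close>

lemma N_unit_interval:
  assumes [measurable]: "g \<in> borel_measurable half_line"
  shows "N (\<lambda>t. g t * indicator {0<..<1} t) = E (\<lambda>u. g (exp (- u)))"
proof (rule antisym)
  have [measurable]: "(\<lambda>u. g (exp (- u))) \<in> borel_measurable half_line"
    using measurable_comp[OF exp_map_measurable assms] by (simp add: comp_def)
  have I [measurable]: "indicator {0<..<1} \<in> borel_measurable half_line" for I
    by (rule borel_measurable_half_line) simp
  have I' [measurable]: "indicator {0<..<1} \<in> (half_line \<rightarrow>\<^sub>M (borel :: ennreal measure))"
    by (rule borel_measurable_half_line) simp
  show "E (\<lambda>u. g (exp (- u))) \<le> N (\<lambda>t. g t * indicator {0<..<1} t)"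
  proof (cases "AE t in half_line. g t * indicator {0<..<1} t < \<infinity>")
    case True
    have "\<F> (L1n half_line) (Linfn half_line) (\<lambda>u. 1 * (\<lambda>t. enn2real (g t * indicator {0<..<1} t)) (exp (- u)))
        \<le> ennreal 1 * T (\<lambda>t. enn2real (g t * indicator {0<..<1} t))"
    proof (rule interpolation_weighted_composition[OF exact_F])
      show "(\<lambda>u. exp (- u)) \<in> measurable half_line log_measure"
        using exp_map_measurable by (simp cong: measurable_cong_sets)
      fix h :: "real \<Rightarrow> ennreal" assume "h \<in> borel_measurable log_measure"
      then have "(\<integral>\<^sup>+ x. h (exp (- x)) \<partial>half_line) = (\<integral>\<^sup>+ t. h t * indicator {0<..<1} t \<partial>log_measure)"
        by (intro exp_map_integral) simp
      also have "\<dots> \<le> integral\<^sup>N log_measure h" by (intro nn_integral_mono) (auto simp: indicator_def)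
      finally show "(\<integral>\<^sup>+ x. ennreal \<bar>1\<bar> * h (exp (- x)) \<partial>half_line) \<le> ennreal 1 * integral\<^sup>N log_measure h" by simp
    qed auto
    moreover have gm: "(\<lambda>u. enn2real (g (exp (- u)) * indicator {0<..<1} (exp (- u)))) \<in> borel_measurable half_line"
    proof -
      have "(\<lambda>t. enn2real (g t * indicator {0<..<1} t)) \<in> borel_measurable half_line" by measurable
      from measurable_comp[OF exp_map_measurable this] show ?thesis by (simp add: comp_def)
    qed
    ultimately have le: "E (\<lambda>u. ennreal (enn2real (g (exp (- u)) * indicator {0<..<1} (exp (- u))))) \<le> N (\<lambda>t. g t * indicator {0<..<1} t)"
      using True by (simp add: F_half_line fnorm_of_def N_eq)
    have "E (\<lambda>u. g (exp (- u))) \<le> E (\<lambda>u. ennreal (enn2real (g (exp (- u)) * indicator {0<..<1} (exp (- u)))))"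
    proof (rule E_mono)
      have "AE u in half_line. g (exp (- u)) * indicator {0<..<1} (exp (- u)) < \<infinity>"
        by (rule exp_map_AE[OF True])
      then have "AE u in lborel. 0 < u \<longrightarrow> g (exp (- u)) * indicator {0<..<1} (exp (- u)) < \<infinity>"
        by (simp only: AE_half_line_iff)
      then show "AE u in half_line. g (exp (- u)) \<le> ennreal (enn2real (g (exp (- u)) * indicator {0<..<1} (exp (- u))))"
        unfolding AE_half_line_iff by eventually_elim auto
      show "(\<lambda>u. ennreal (enn2real (g (exp (- u)) * indicator {0<..<1} (exp (- u))))) \<in> borel_measurable half_line"
        using gm by measurable
    qed simp
    then show ?thesis using le by simp
  qed (simp add: N_eq)
  show "N (\<lambda>t. g t * indicator {0<..<1} t) \<le> E (\<lambda>u. g (exp (- u)))"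
  proof (cases "E (\<lambda>u. g (exp (- u))) < \<infinity>")
    case True
    \<comment> \<open>The functor acts on real functions. A finite norm in E excludes infinite
      values almost everywhere, so the passage to \<open>enn2real\<close> loses nothing.\<close>
    then have ae: "AE u in half_line. g (exp (- u)) < \<infinity>" by (intro E_finite_AE) auto
    have ae': "AE t in half_line. g t * indicator {0<..<1} t < \<infinity>"
    proof -
      have "AE t in lborel. 0 < t \<longrightarrow> g (exp (- ln_map t)) < \<infinity>"
        using ln_map_AE[OF ae] by (simp only: AE_half_line_iff)
      then show ?thesis unfolding AE_half_line_iff
        by eventually_elim (auto simp: indicator_def ln_map_def abs_if)
    qed
    define f where "f u = enn2real (g (exp (- u)))" for u
    have [measurable]: "f \<in> borel_measurable half_line" unfolding f_def by measurable
    have "T (\<lambda>t. indicator {0<..<1} t * f (ln_map t)) \<le> ennreal 1 * \<F> (L1n half_line) (Linfn half_line) f"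
    proof (rule interpolation_weighted_composition[OF exact_F])
      show "ln_map \<in> measurable log_measure half_line"
        using ln_map_measurable by (simp cong: measurable_cong_sets)
      fix h :: "real \<Rightarrow> ennreal" assume h: "h \<in> borel_measurable half_line"
      have "(\<integral>\<^sup>+ x. ennreal \<bar>indicator {0<..<1} x\<bar> * h (ln_map x) \<partial>log_measure)
          = (\<integral>\<^sup>+ x. h (ln_map x) * indicator {0<..<1} x \<partial>log_measure)"
        by (intro nn_integral_cong) (auto simp: indicator_def)
      then show "(\<integral>\<^sup>+ x. ennreal \<bar>indicator {0<..<1} x\<bar> * h (ln_map x) \<partial>log_measure) \<le> ennreal 1 * integral\<^sup>N half_line h"
        using ln_map_integral[OF h] by simp
    qed (auto simp: indicator_def intro: borel_measurable_half_line)
    also have "\<dots> \<le> E (\<lambda>u. g (exp (- u)))"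
    proof -
      have gE [measurable]: "(\<lambda>u. g (exp (- u))) \<in> borel_measurable half_line" by fact
      have "AE u in half_line. absf f u \<le> g (exp (- u))" using ae by eventually_elim (simp add: f_def)
      then have "E (absf f) \<le> E (\<lambda>u. g (exp (- u)))" by (intro E_mono) auto
      then show ?thesis by (simp add: F_half_line fnorm_of_def)
    qed
    finally have le: "T (\<lambda>t. indicator {0<..<1} t * f (ln_map t)) \<le> E (\<lambda>u. g (exp (- u)))" .
    have "T (\<lambda>t. enn2real (g t * indicator {0<..<1} t)) \<le> T (\<lambda>t. indicator {0<..<1} t * f (ln_map t))"
    proof (rule T_mono)
      show "(\<lambda>t. enn2real (g t * indicator {0<..<1} t)) \<in> borel_measurable half_line" by measurable
    qed (auto simp: f_def indicator_def ln_map_def abs_if intro!: AE_I2)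
    then show ?thesis using le ae' by (simp add: N_eq)
  qed (simp add: not_less top_unique)
qed

lemma N_suminf_unit_interval:
  assumes [measurable]: "\<And>j::nat. g j \<in> borel_measurable half_line"
  shows "N (\<lambda>t. (\<Sum>j. g j t) * indicator {0<..<1} t) \<le> (\<Sum>j. N (\<lambda>t. g j t * indicator {0<..<1} t))"
proof -
  have "(\<lambda>u. g j (exp (- u))) \<in> borel_measurable half_line" for j
    using measurable_comp[OF exp_map_measurable assms] by (simp add: comp_def)
  then have "E (\<lambda>u. \<Sum>j. g j (exp (- u))) \<le> (\<Sum>j. E (\<lambda>u. g j (exp (- u))))" by (rule E_suminf)
  then show ?thesis by (simp add: N_unit_interval)
qed

text \<open>t -> 1/t is an involution of norm at most 1 that exchanges the two intervals, so facts
  transferred from E to (0, 1) reach (1, \<infinity>) as well.\<close>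

lemma N_invert:
  assumes [measurable]: "g \<in> borel_measurable half_line"
  shows "N (\<lambda>t. g t * indicator {1<..} t) = N (\<lambda>t. g (power_map 1 (-1) t) * indicator {0<..<1} t)"
proof (rule antisym)
  let ?P = "power_map 1 (-1)"
  have P: "?P t = 1 / t" if "0 < t" for t using that by (simp add: power_map_def powr_minus field_simps)
  have [measurable]: "?P \<in> measurable half_line half_line" by (rule power_map_measurable) auto
  have [measurable]: "(\<lambda>t. g (?P t)) \<in> borel_measurable half_line" by measurable
  have [measurable]: "indicator {1<..} \<in> (half_line \<rightarrow>\<^sub>M (borel :: ennreal measure))"
     "indicator {0<..<1} \<in> (half_line \<rightarrow>\<^sub>M (borel :: ennreal measure))"
    by (rule borel_measurable_half_line; simp)+
  have "N (\<lambda>t. g t * indicator {1<..} t) \<le> N (\<lambda>t. (\<lambda>s. g (?P s) * indicator {0<..<1} s) (?P t))"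
  proof (rule N_mono)
    show "AE t in half_line. g t * indicator {1<..} t \<le> g (?P (?P t)) * indicator {0<..<1} (?P t)"
      by (intro AE_I2) (auto simp: space_half_line P indicator_def)
  qed measurable
  also have "\<dots> \<le> ennreal (max 1 (1 / \<bar>-1\<bar>)) * N (\<lambda>t. g (?P t) * indicator {0<..<1} t)"
    by (rule N_power_map) auto
  finally show "N (\<lambda>t. g t * indicator {1<..} t) \<le> N (\<lambda>t. g (?P t) * indicator {0<..<1} t)" by simp
  have "N (\<lambda>t. g (?P t) * indicator {0<..<1} t) \<le> N (\<lambda>t. (\<lambda>s. g s * indicator {1<..} s) (?P t))"
  proof (rule N_mono)
    show "AE t in half_line. g (?P t) * indicator {0<..<1} t \<le> g (?P t) * indicator {1<..} (?P t)"
      by (intro AE_I2) (auto simp: space_half_line P indicator_def)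
  qed measurable
  also have "\<dots> \<le> ennreal (max 1 (1 / \<bar>-1\<bar>)) * N (\<lambda>t. g t * indicator {1<..} t)"
    by (rule N_power_map) auto
  finally show "N (\<lambda>t. g (?P t) * indicator {0<..<1} t) \<le> N (\<lambda>t. g t * indicator {1<..} t)" by simp
qed

lemma N_suminf_outer:
  assumes [measurable]: "\<And>j::nat. g j \<in> borel_measurable half_line"
  shows "N (\<lambda>t. (\<Sum>j. g j t) * indicator {1<..} t) \<le> (\<Sum>j. N (\<lambda>t. g j t * indicator {1<..} t))"
proof -
  have [measurable]: "power_map 1 (-1) \<in> measurable half_line half_line" by (rule power_map_measurable) auto
  have "N (\<lambda>t. (\<Sum>j. g j (power_map 1 (-1) t)) * indicator {0<..<1} t)
      \<le> (\<Sum>j. N (\<lambda>t. g j (power_map 1 (-1) t) * indicator {0<..<1} t))"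
    by (rule N_suminf_unit_interval) measurable
  then show ?thesis by (simp add: N_invert)
qed

lemma powr_unit_integral:
  assumes e: "0 < e"
  shows "nn_integral log_measure (\<lambda>t. ennreal (t powr e) * indicator {0<..<1} t) = ennreal (1 / e)"
proof -
  have "nn_integral log_measure (\<lambda>t. ennreal (t powr e) * indicator {0<..<1} t)
      = nn_integral half_line (\<lambda>u. ennreal (exp (- u) powr e))"
    by (rule exp_map_integral[symmetric]) (rule borel_measurable_half_line, measurable)
  also have "\<dots> = (\<integral>\<^sup>+ u. ennreal (exp (- e * u)) * indicator {0<..} u \<partial>lborel)"
    unfolding nn_integral_half_line by (simp add: powr_def)
  also have "\<dots> = (\<integral>\<^sup>+ u. ennreal (exp (- e * u)) * indicator {0..} u \<partial>lborel)"
    by (intro nn_integral_cong_AE, use AE_lborel_singleton[of 0] in eventually_elim) (auto simp: indicator_def)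
  also have "\<dots> = 0 - (- exp (- e * 0) / e)"
  proof (rule nn_integral_FTC_atLeast)
    show "DERIV (\<lambda>u. - exp (- e * u) / e) x :> exp (- e * x)" for x
      using e by (auto intro!: derivative_eq_intros)
    have "((\<lambda>u. - exp (- (e * u)) / e) \<longlongrightarrow> - 0 / e) at_top"
      by (intro tendsto_intros filterlim_compose[OF exp_at_bot] filterlim_compose[OF filterlim_uminus_at_bot_at_top] filterlim_tendsto_pos_mult_at_top[OF tendsto_const e] filterlim_ident) (use e in auto)
    then show "((\<lambda>u. - exp (- e * u) / e) \<longlongrightarrow> 0) at_top" by simp
  qed auto
  finally show ?thesis by simp
qed

text \<open>The power cut to the unit interval is integrable for dt/t and bounded, so it lies in the
  intersection of the couple. It will carry the term with the norm of f in L1 + Linf.\<close>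

lemma N_powr_unit_finite:
  assumes e: "0 < e"
  shows "N (\<lambda>t. ennreal (t powr e) * indicator {0<..<1} t) < \<infinity>"
proof -
  let ?g = "\<lambda>t::real. t powr e * indicator {0<..<1} t"
  obtain C where C: "C > 0" "\<And>f. T f \<le> ennreal C * max (L1n log_measure f) (Linfn log_measure f)"
    by (rule T_upper) blast
  have [measurable]: "?g \<in> borel_measurable half_line" by (rule borel_measurable_half_line) measurable
  have abs: "absf ?g = (\<lambda>t. ennreal (t powr e) * indicator {0<..<1} t)"
    by (auto simp: fun_eq_iff indicator_def)
  have "L1n log_measure ?g = nn_integral log_measure (absf ?g)" by (simp add: fnorm_of_def)
  also have "\<dots> = ennreal (1 / e)" unfolding abs by (rule powr_unit_integral[OF e])
  finally have "L1n log_measure ?g = ennreal (1 / e)" .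
  moreover have "esssup log_measure (absf ?g) \<le> 1"
  proof (rule esssup_I)
    have "absf ?g \<in> borel_measurable half_line" by measurable
    then show "absf ?g \<in> borel_measurable log_measure" by (simp only: log_half_measurable)
    show "AE x in log_measure. absf ?g x \<le> 1"
      using e by (intro AE_I2) (auto simp: indicator_def powr_le1)
  qed
  then have "Linfn log_measure ?g \<le> 1" by (simp add: fnorm_of_def)
  ultimately have "max (L1n log_measure ?g) (Linfn log_measure ?g) < \<infinity>"
    by (auto simp: max_def intro: le_less_trans)
  then have "T ?g < \<infinity>" by (intro le_less_trans[OF C(2)]) (auto simp: ennreal_mult_less_top)
  moreover have "(\<lambda>t. enn2real (ennreal (t powr e) * indicator {0<..<1} t)) = ?g"
    by (auto simp: fun_eq_iff indicator_def)
  moreover have "AE t in half_line. ennreal (t powr e) * indicator {0<..<1} t < \<infinity>"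
    by (intro AE_I2) (auto simp: indicator_def)
  ultimately show ?thesis by (simp add: N_eq)
qed

text \<open>The cut power lies in the intersection of the couple, so it pairs with the sum space,
  into which the space of the functor embeds. This gives a duality bound for power weights without
  computing an associate norm.\<close>

lemma powr_unit_duality:
  assumes e: "0 < e"
  obtains K :: real where "0 < K" "\<And>h. h \<in> borel_measurable half_line \<Longrightarrow>
    (\<integral>\<^sup>+ t. (ennreal (t powr e) * indicator {0<..<1} t) * h t \<partial>log_measure) \<le> ennreal K * N h"
proof -
  obtain C where C: "C > 0" "\<And>f. sum_norm (L1n log_measure) (Linfn log_measure) f \<le> ennreal C * T f"
    by (rule T_lower) blast
  let ?w = "\<lambda>t. ennreal (t powr e) * indicator {0<..<1} t"
  \<comment> \<open>The larger of the sup bound 1 and the L1 norm 1/e of the cut power.\<close>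
  define D where "D = max 1 (1 / e)"
  have D: "1 \<le> D" by (simp add: D_def)
  have w1: "?w t \<le> 1" for t using e by (auto simp: indicator_def powr_le1)
  have [measurable]: "?w \<in> borel_measurable half_line" by (rule borel_measurable_half_line) measurable
  show ?thesis
  proof (rule that)
    show "0 < D * C" using D C by simp
    fix h :: "real \<Rightarrow> ennreal" assume [measurable]: "h \<in> borel_measurable half_line"
    show "(\<integral>\<^sup>+ t. ?w t * h t \<partial>log_measure) \<le> ennreal (D * C) * N h"
    proof (cases "AE t in half_line. h t < \<infinity>")
      case True
      define f where "f t = enn2real (h t)" for t
      have [measurable]: "f \<in> borel_measurable half_line" unfolding f_def by measurable
      have "(\<integral>\<^sup>+ t. ?w t * h t \<partial>log_measure) = (\<integral>\<^sup>+ t. ?w t * ennreal (f t) \<partial>log_measure)"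
        by (intro nn_integral_cong_AE, unfold AE_log_measure_iff, use True in eventually_elim) (simp add: f_def)
      also have "\<dots> \<le> ennreal D * sum_norm (L1n log_measure) (Linfn log_measure) f"
      proof -
        have "(\<integral>\<^sup>+ t. ?w t * ennreal (f t) \<partial>log_measure) \<le> ennreal D * (L1n log_measure g + Linfn log_measure (\<lambda>t. f t - g t))" for g
        proof (cases "g \<in> borel_measurable half_line")
          case True
          then have [measurable]: "g \<in> borel_measurable half_line" .
          let ?s = "esssup log_measure (absf (\<lambda>t. f t - g t))"
          have "(\<integral>\<^sup>+ t. ?w t * ennreal (f t) \<partial>log_measure) \<le> (\<integral>\<^sup>+ t. absf g t + ?s * ?w t \<partial>log_measure)"
          proof (rule nn_integral_mono_AE)
            show "AE t in log_measure. ?w t * ennreal (f t) \<le> absf g t + ?s * ?w t"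
              using esssup_AE[of "absf (\<lambda>t. f t - g t)" log_measure]
            proof eventually_elim
              case (elim t)
              have "ennreal (f t) \<le> absf g t + ennreal \<bar>f t - g t\<bar>"
                by (simp flip: ennreal_plus)
              then have "?w t * ennreal (f t) \<le> ?w t * (absf g t + ennreal \<bar>f t - g t\<bar>)" by (rule mult_left_mono) simp
              also have "\<dots> = ?w t * absf g t + ?w t * ennreal \<bar>f t - g t\<bar>" by (rule distrib_left)
              also have "\<dots> \<le> 1 * absf g t + ?w t * ?s"
                using w1[of t] elim by (intro add_mono mult_mono) auto
              finally show ?case by (simp add: mult.commute)
            qed
          qed
          also have "\<dots> = (\<integral>\<^sup>+ t. absf g t \<partial>log_measure) + ?s * ennreal (1 / e)"
            by (simp add: nn_integral_add nn_integral_cmult powr_unit_integral[OF e])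
          also have "\<dots> \<le> ennreal D * (\<integral>\<^sup>+ t. absf g t \<partial>log_measure) + ennreal D * ?s"
          proof (rule add_mono)
            show "(\<integral>\<^sup>+ t. absf g t \<partial>log_measure) \<le> ennreal D * (\<integral>\<^sup>+ t. absf g t \<partial>log_measure)"
              using mult_right_mono[of 1 "ennreal D" "(\<integral>\<^sup>+ t. absf g t \<partial>log_measure)"] D by simp
            show "?s * ennreal (1 / e) \<le> ennreal D * ?s"
              by (subst mult.commute) (auto intro!: mult_right_mono ennreal_leI simp: D_def)
          qed
          finally show ?thesis by (simp add: fnorm_of_def distrib_left)
        qed (use D in \<open>simp add: fnorm_of_def ennreal_mult_top\<close>)
        note le = this
        let ?y = "\<integral>\<^sup>+ t. ?w t * ennreal (f t) \<partial>log_measure"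
        have inv: "ennreal (1 / D) * (ennreal D * z) = z" "ennreal D * (ennreal (1 / D) * z) = z" for z
          using D by (simp_all add: mult.assoc[symmetric] ennreal_mult[symmetric])
        have "ennreal (1 / D) * ?y \<le> sum_norm (L1n log_measure) (Linfn log_measure) f"
          unfolding sum_norm_def
        proof (rule INF_greatest)
          fix g
          have "ennreal (1 / D) * ?y \<le> ennreal (1 / D) * (ennreal D * (L1n log_measure g + Linfn log_measure (\<lambda>t. f t - g t)))"
            by (intro mult_left_mono le) simp
          then show "ennreal (1 / D) * ?y \<le> L1n log_measure g + Linfn log_measure (\<lambda>t. f t - g t)"
            by (simp only: inv)
        qed
        then have "ennreal D * (ennreal (1 / D) * ?y) \<le> ennreal D * sum_norm (L1n log_measure) (Linfn log_measure) f"
          by (rule mult_left_mono) simp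
        then show ?thesis by (simp only: inv)
      qed
      also have "\<dots> \<le> ennreal D * (ennreal C * T f)" by (intro mult_left_mono C) auto
      also have "\<dots> = ennreal (D * C) * N h"
        using True D C by (simp add: N_eq f_def[abs_def] ennreal_mult mult.assoc)
      finally show ?thesis .
    qed (use D C in \<open>simp add: N_eq ennreal_mult_top\<close>)
  qed
qed

section \<open>Dilation norms and Hardy averages\<close>

lemma E_rearr:
  assumes [measurable]: "g \<in> borel_measurable half_line"
  shows "E (rearr half_line g) \<le> E g"
proof (cases "E g < \<infinity>")
  case True
  have [measurable]: "rearr half_line g \<in> borel_measurable half_line"
    by (rule borel_measurable_half_line, rule borel_measurable_rearr) fact
  have "rearr half_line (rearr half_line g) s \<le> rearr half_line g s" for s
  proof (rule rearr_le_rearrI)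
    fix l
    let ?d = "emeasure half_line {x \<in> space half_line. l < g x}"
    have S: "{x \<in> space half_line. l < rearr half_line g x} \<subseteq> {x. 0 < x \<and> ennreal x < ?d}"
      by (auto simp: space_half_line less_rearr_iff)
    show "emeasure half_line {x \<in> space half_line. l < rearr half_line g x} \<le> ?d"
    proof (cases "?d = top")
      case False
      then obtain d where d: "?d = ennreal d" "0 \<le> d" by (cases ?d) auto
      have "emeasure half_line {x \<in> space half_line. l < rearr half_line g x} \<le> emeasure half_line {0<..<d}"
        using S d by (intro emeasure_mono) (auto simp: ennreal_less_iff sets_restrict_space_iff)
      also have "\<dots> = ennreal d" using d
        by (subst emeasure_restrict_space) (auto simp: emeasure_completion)
      finally show ?thesis using d by simp
    qed simp
  qed
  then have "AE s in half_line. rearr half_line (rearr half_line g) s \<le> rearr half_line g s" by simp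
  then show ?thesis using ri_E True assms \<open>rearr half_line g \<in> borel_measurable half_line\<close>
    unfolding ri_norm_def by blast
qed (simp add: not_less top_unique)

text \<open>E is the value of the functor on the couple for dt, so the dilation is interpolated
  between L1, where its norm is s, and Linf, where it is 1.\<close>

lemma E_dilation:
  assumes s: "0 < s" and [measurable]: "f \<in> borel_measurable half_line"
  shows "E (\<lambda>t. f (t / s)) \<le> ennreal (max 1 s) * E f"
proof (cases "E f < \<infinity>")
  case True
  then have ae: "AE t in half_line. f t < \<infinity>" by (intro E_finite_AE) auto
  have m [measurable]: "(\<lambda>t. t / s) \<in> measurable half_line half_line" by (rule dil_map_measurable[OF s])
  have [measurable]: "(\<lambda>t. f (t / s)) \<in> borel_measurable half_line" by measurable
  have "\<F> (L1n half_line) (Linfn half_line) (\<lambda>t. 1 * (\<lambda>t. enn2real (f t)) (t / s))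
      \<le> ennreal (max 1 s) * \<F> (L1n half_line) (Linfn half_line) (\<lambda>t. enn2real (f t))"
    by (rule interpolation_weighted_composition[OF exact_F m])
      (auto simp: dil_map_integral[OF s] intro!: mult_right_mono ennreal_leI)
  then have "E (\<lambda>t. ennreal (enn2real (f (t / s)))) \<le> ennreal (max 1 s) * E (\<lambda>t. ennreal (enn2real (f t)))"
    by (simp add: F_half_line fnorm_of_def)
  moreover have "E (\<lambda>t. ennreal (enn2real (f t))) \<le> E f"
    by (rule E_mono, measurable, use ae in eventually_elim) auto
  then have "ennreal (max 1 s) * E (\<lambda>t. ennreal (enn2real (f t))) \<le> ennreal (max 1 s) * E f" by (rule mult_left_mono) simp
  moreover have "E (\<lambda>t. f (t / s)) \<le> E (\<lambda>t. ennreal (enn2real (f (t / s))))"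
    by (rule E_mono, measurable, use dil_map_AE[OF s ae] in eventually_elim) auto
  ultimately show ?thesis by order
next
  case False
  have "max 1 s \<noteq> 0" using s by linarith
  then show ?thesis using False by (simp add: not_less top_unique ennreal_mult_top)
qed

text \<open>The Boyd indices are computed from \<open>enn2real (dil_norm E s)\<close>, where an
  infinite norm would silently become 0.\<close>

lemma dil_norm_finite: "0 < s \<Longrightarrow> dil_norm E s \<le> ennreal (max 1 s)"
  unfolding dil_norm_def
proof (rule SUP_least)
  fix f assume s: "0 < s" and f: "f \<in> {f \<in> borel_measurable half_line. E f \<le> 1}"
  then have "E (\<lambda>t. f (t / s)) \<le> ennreal (max 1 s) * E f" by (intro E_dilation) auto
  also have "\<dots> \<le> ennreal (max 1 s) * 1" using f by (intro mult_left_mono) auto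
  finally show "E (\<lambda>t. f (t / s)) \<le> ennreal (max 1 s)" by simp
qed

lemma E_dilation_le_dil_norm:
  assumes s: "0 < s" and f [measurable]: "f \<in> borel_measurable half_line" and fin: "E f < \<infinity>"
  shows "E (\<lambda>t. f (t / s)) \<le> dil_norm E s * E f"
proof (cases "E f = 0")
  case True
  then have "AE t in half_line. f t = 0" by (simp add: E_zero_iff)
  then have "AE t in half_line. f (t / s) = 0" by (rule dil_map_AE[OF s])
  moreover have "(\<lambda>t. f (t / s)) \<in> borel_measurable half_line"
    using measurable_comp[OF dil_map_measurable[OF s] f] by (simp add: comp_def)
  ultimately have "E (\<lambda>t. f (t / s)) = 0" by (simp add: E_zero_iff)
  then show ?thesis by simp
next
  case False
  then obtain c where c: "E f = ennreal c" "0 < c" using fin by (cases "E f") (auto simp: less_le)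
  have "E (\<lambda>t. ennreal (1 / c) * f t) = 1" using c by (simp add: E_cmult ennreal_mult[symmetric])
  then have "E (\<lambda>t. ennreal (1 / c) * f (t / s)) \<le> dil_norm E s"
    unfolding dil_norm_def by (intro SUP_upper2[of "\<lambda>t. ennreal (1 / c) * f t"]) auto
  moreover have "(\<lambda>t. f (t / s)) \<in> borel_measurable half_line"
    using measurable_comp[OF dil_map_measurable[OF s] f] by (simp add: comp_def)
  ultimately have "ennreal (1 / c) * E (\<lambda>t. f (t / s)) \<le> dil_norm E s" using c by (simp add: E_cmult)
  then have "ennreal c * (ennreal (1 / c) * E (\<lambda>t. f (t / s))) \<le> ennreal c * dil_norm E s" by (rule mult_left_mono) simp
  then show ?thesis using c by (simp add: mult.assoc[symmetric] ennreal_mult[symmetric] mult.commute)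
qed

text \<open>Since \<open>E g\<^sup>* \<le> E g\<close>, the Hardy average is replaced by that of the decreasing function \<open>g\<^sup>*\<close>, which
  is a geometric sum of dilates; this avoids a Minkowski inequality for integrals.\<close>

theorem E_hardy:
  assumes "upper_boyd_index E < 1"
  obtains K :: real where "0 < K"
    "\<And>g. g \<in> borel_measurable half_line \<Longrightarrow> E (max_rearr half_line g) \<le> ennreal K * E g"
proof -
  let ?f = "\<lambda>s. ln (enn2real (dil_norm E s)) / ln s"
  \<comment> \<open>The index is an infimum of ln h(s) / ln s, so an index below 1 provides a single
    a > 1 with dilation norm d < a. The powers of this a suffice, as d^j bounds the norm of the
    dilation by a^j.\<close>
  have "Inf (?f ` {1<..}) < 1" using assms by (simp add: upper_boyd_index_def)
  moreover have "?f ` {1<..} \<noteq> {}" by (simp add: greaterThan_non_empty)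
  ultimately have "\<exists>y\<in>?f ` {1<..}. y < 1" by (rule cInf_lessD[rotated])
  then obtain a where a: "1 < a" "ln (enn2real (dil_norm E a)) / ln a < 1" by auto
  define d where "d = enn2real (dil_norm E a)"
  have "dil_norm E a < \<infinity>" using dil_norm_finite[of a] a le_less_trans by fastforce
  then have d: "dil_norm E a = ennreal d" "0 \<le> d" by (auto simp: d_def)
  have da: "d < a"
  proof (cases "d = 0")
    case False
    have "ln d < ln a" using a by (simp add: d_def[symmetric] field_simps)
    then show ?thesis using False d a by (simp add: ln_less_cancel_iff)
  qed (use a in simp)
  define q where "q = d / a"
  have q: "0 \<le> q" "q < 1" using d da a by (auto simp: q_def)
  show ?thesis
  proof (rule that)
    \<comment> \<open>The geometric ratio q = d / a comes from the weight a^-j against the dilation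
      norm d^(j+1); the added 1 keeps the constant positive even for d = 0.\<close>
    show K: "0 < d * (\<Sum>j. q ^ j) + 1"
      using d q by (intro add_nonneg_pos mult_nonneg_nonneg suminf_nonneg) auto
    fix g :: "real \<Rightarrow> ennreal" assume g [measurable]: "g \<in> borel_measurable half_line"
    show "E (max_rearr half_line g) \<le> ennreal (d * (\<Sum>j. q ^ j) + 1) * E g"
    proof (cases "E g < \<infinity>")
      case True
      define r where "r j t = rearr half_line g (t / a ^ j)" for j t
      have rm [measurable]: "r j \<in> borel_measurable half_line" for j
        unfolding r_def by (intro borel_measurable_half_line) measurable
      have rE: "E (r j) \<le> ennreal (d ^ j) * E g" for j
      proof (induction j)
        case 0
        then show ?case using E_rearr[OF g] by (simp add: r_def[abs_def])
      next
        case (Suc j)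
        have fin: "E (r j) < \<infinity>" using True by (intro le_less_trans[OF Suc]) (simp add: ennreal_mult_less_top)
        have "r (Suc j) = (\<lambda>t. r j (t / a))" by (simp add: r_def fun_eq_iff)
        then have "E (r (Suc j)) \<le> ennreal d * E (r j)"
          using E_dilation_le_dil_norm[OF _ rm fin, of a] a d by simp
        also have "\<dots> \<le> ennreal d * (ennreal (d ^ j) * E g)" by (intro mult_left_mono Suc) simp
        also have "\<dots> = ennreal (d ^ Suc j) * E g" using d by (simp add: ennreal_mult mult.assoc)
        finally show ?case .
      qed
      have "E (max_rearr half_line g) \<le> E (\<lambda>u. \<Sum>j. ennreal ((1 / a) ^ j) * r (Suc j) u)"
      proof (rule E_mono)
        show "max_rearr half_line g \<in> borel_measurable half_line"
          by (rule borel_measurable_half_line, rule max_rearr_measurable) fact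
        show "AE t in half_line. max_rearr half_line g t \<le> (\<Sum>j. ennreal ((1 / a) ^ j) * r (Suc j) t)"
          using max_rearr_le_geometric[OF g a(1)] by (intro AE_I2) (simp add: space_half_line r_def)
      qed measurable
      also have "\<dots> \<le> (\<Sum>j. E (\<lambda>u. ennreal ((1 / a) ^ j) * r (Suc j) u))" by (rule E_suminf) measurable
      also have "\<dots> = (\<Sum>j. ennreal ((1 / a) ^ j) * E (r (Suc j)))" using a by (simp add: E_cmult)
      also have "\<dots> \<le> (\<Sum>j. ennreal d * E g * ennreal (q ^ j))"
      proof (intro suminf_le)
        fix j
        have "ennreal ((1 / a) ^ j) * E (r (Suc j)) \<le> ennreal ((1 / a) ^ j) * (ennreal (d ^ Suc j) * E g)"
          by (intro mult_left_mono rE) simp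
        also have "\<dots> = ennreal ((1 / a) ^ j * d ^ Suc j) * E g" using a d by (simp add: ennreal_mult mult.assoc)
        also have "(1 / a) ^ j * d ^ Suc j = d * q ^ j" by (simp add: q_def power_divide)
        also have "ennreal (d * q ^ j) * E g = ennreal d * E g * ennreal (q ^ j)"
          using d q by (simp add: ennreal_mult ac_simps)
        finally show "ennreal ((1 / a) ^ j) * E (r (Suc j)) \<le> ennreal d * E g * ennreal (q ^ j)" .
      qed auto
      also have "\<dots> = ennreal d * E g * ennreal (\<Sum>j. q ^ j)"
        using q by (simp add: ennreal_suminf_cmult suminf_ennreal2 summable_geometric)
      also have "\<dots> = ennreal (d * (\<Sum>j. q ^ j)) * E g"
        using d q by (simp add: ennreal_mult suminf_nonneg summable_geometric ac_simps)
      also have "\<dots> \<le> ennreal (d * (\<Sum>j. q ^ j) + 1) * E g"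
        by (intro mult_right_mono ennreal_leI) auto
      finally show ?thesis .
    next
      case False
      then show ?thesis using K by (simp add: not_less top_unique ennreal_mult_top)
    qed
  qed
qed

end

section \<open>Fundamental indices and weights\<close>

text \<open>Fekete's lemma over the reals: the limit is the infimum of h u / u. Writing u = q a + r,
  subadditivity handles q a and the linear bound handles the remainder r, whatever the regularity of
  h.\<close>

lemma fekete_quotient_convergent:
  fixes h :: "real \<Rightarrow> real"
  assumes sub: "\<And>x y. 0 \<le> x \<Longrightarrow> 0 \<le> y \<Longrightarrow> h (x + y) \<le> h x + h y"
    and bnd: "\<And>x. 0 \<le> x \<Longrightarrow> \<bar>h x\<bar> \<le> x"
  shows "\<exists>L. ((\<lambda>u. h u / u) \<longlongrightarrow> L) at_top"
proof
  define L where "L = (INF u\<in>{0<..}. h u / u)"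
  have q1: "\<bar>h u / u\<bar> \<le> 1" if "0 < u" for u using bnd[of u] that by (simp add: abs_divide)
  have bdd: "bdd_below ((\<lambda>u. h u / u) ` {0<..})"
  proof (rule bdd_belowI2[of _ "-1"])
    fix u :: real assume "u \<in> {0<..}"
    then have "\<bar>h u / u\<bar> \<le> 1" by (intro q1) simp
    then show "- 1 \<le> h u / u" by linarith
  qed
  have mult: "h (real q * a) \<le> real q * h a" if "0 \<le> a" for q a
  proof (induction q)
    case (Suc q)
    have "h (real q * a + a) \<le> h (real q * a) + h a" using that by (intro sub) auto
    then show ?case using Suc by (simp add: algebra_simps)
  qed (use bnd[of 0] in simp)
  have upper: "h u / u \<le> h a / a + 2 * a / u" if a: "0 < a" and u: "0 < u" for a u
  proof -
    define q where "q = nat \<lfloor>u / a\<rfloor>"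
    define r where "r = u - real q * a"
    have "real q \<le> u / a" "u / a < real q + 1" using a u by (simp_all add: q_def)
    then have r: "0 \<le> r" "r \<le> a" using a by (auto simp: r_def field_simps)
    have "h u = h (real q * a + r)" by (simp add: r_def)
    also have "\<dots> \<le> real q * h a + r" using sub[of "real q * a" r] mult[of a q] bnd[of r] a r by auto
    finally have "h u / u \<le> (real q * h a + r) / u" using u by (intro divide_right_mono) auto
    also have "\<dots> = (u - r) / u * (h a / a) + r / u" using a u by (simp add: r_def field_simps)
    also have "(u - r) / u = 1 - r / u" using u by (simp add: diff_divide_distrib)
    also have "(1 - r / u) * (h a / a) + r / u = h a / a - r / u * (h a / a) + r / u"
      by (simp only: left_diff_distrib mult_1_left)
    also have "\<dots> \<le> h a / a + r / u + r / u"
    proof -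
      have "\<bar>r / u * (h a / a)\<bar> \<le> r / u * 1"
        unfolding abs_mult using q1[OF a] r u by (intro mult_mono) auto
      then show ?thesis by linarith
    qed
    also have "\<dots> \<le> h a / a + a / u + a / u" using r u by (intro add_mono divide_right_mono) auto
    finally show ?thesis by simp
  qed
  show "((\<lambda>u. h u / u) \<longlongrightarrow> L) at_top"
  proof (rule order_tendstoI)
    fix l assume "l < L"
    moreover have "L \<le> h u / u" if "0 < u" for u unfolding L_def using bdd that by (intro cINF_lower) auto
    ultimately show "\<forall>\<^sub>F u in at_top. l < h u / u"
      by (intro eventually_mono[OF eventually_gt_at_top[of 0]]) (auto intro: less_le_trans)
  next
    fix v assume "L < v"
    then obtain a where a: "0 < a" "h a / a < v"
      unfolding L_def using cINF_less_iff[OF _ bdd, of v] by (auto simp: greaterThan_non_empty)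
    have "((\<lambda>u. h a / a + 2 * a / u) \<longlongrightarrow> h a / a + 0) at_top"
      by (intro tendsto_intros tendsto_divide_0[OF tendsto_const] filterlim_at_top_imp_at_infinity filterlim_ident)
    then have "\<forall>\<^sub>F u in at_top. h a / a + 2 * a / u < v" using a by (auto dest: order_tendstoD(2))
    then show "\<forall>\<^sub>F u in at_top. h u / u < v"
      using eventually_gt_at_top[of 0] by eventually_elim (use upper[OF a(1)] in \<open>auto intro: le_less_trans\<close>)
  qed
qed

section \<open>Indices of a quasi-concave function\<close>

locale quasi_concave =
  fixes \<phi> :: "real \<Rightarrow> real"
  assumes pos: "\<And>t. 0 < t \<Longrightarrow> 0 < \<phi> t"
    and mono: "\<And>s t. 0 < s \<Longrightarrow> s \<le> t \<Longrightarrow> \<phi> s \<le> \<phi> t"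
    and qc: "\<And>s t. 0 < s \<Longrightarrow> s \<le> t \<Longrightarrow> s * \<phi> t \<le> t * \<phi> s"
begin

abbreviation "D \<equiv> fund_dil \<phi>"

lemma ratio_bounds:
  assumes s: "0 < s" and t: "0 < t"
  shows "\<phi> (s * t) / \<phi> s \<le> max 1 t" "min 1 t \<le> \<phi> (s * t) / \<phi> s"
proof -
  have "\<phi> (s * t) / \<phi> s \<le> max 1 t \<and> min 1 t \<le> \<phi> (s * t) / \<phi> s"
  proof (cases "t \<le> 1")
    case True
    then have "s * t \<le> s" using s by simp
    then have "\<phi> (s * t) \<le> \<phi> s" "s * (t * \<phi> s) \<le> s * \<phi> (s * t)"
      using mono[of "s * t" s] qc[of "s * t" s] s t by (auto simp: mult.assoc)
    then show ?thesis using True s t pos[OF s] by (simp add: field_simps)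
  next
    case False
    then have "s \<le> s * t" using s by simp
    then have "\<phi> s \<le> \<phi> (s * t)" "s * \<phi> (s * t) \<le> s * (t * \<phi> s)"
      using mono[of s "s * t"] qc[of s "s * t"] s t by (auto simp: mult.assoc)
    then show ?thesis using False s t pos[OF s] by (simp add: field_simps)
  qed
  then show "\<phi> (s * t) / \<phi> s \<le> max 1 t" "min 1 t \<le> \<phi> (s * t) / \<phi> s" by auto
qed

lemma ratio_bdd: "0 < t \<Longrightarrow> bdd_above ((\<lambda>s. \<phi> (s * t) / \<phi> s) ` {0<..})"
  using ratio_bounds(1) by (intro bdd_aboveI2[of _ _ "max 1 t"]) auto

lemma ratio_le_D: "0 < s \<Longrightarrow> 0 < t \<Longrightarrow> \<phi> (s * t) / \<phi> s \<le> D t"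
  unfolding fund_dil_def by (intro cSUP_upper ratio_bdd) auto

lemma le_D_mult: "0 < s \<Longrightarrow> 0 < t \<Longrightarrow> \<phi> (s * t) \<le> D t * \<phi> s"
  using ratio_le_D[of s t] pos[of s] by (simp add: field_simps)

lemma D_le: "0 < t \<Longrightarrow> D t \<le> max 1 t"
  unfolding fund_dil_def using ratio_bounds(1) by (intro cSUP_least) (auto simp: greaterThan_non_empty)

lemma D_ge: "0 < t \<Longrightarrow> min 1 t \<le> D t"
  using ratio_bounds(2)[of 1 t] ratio_le_D[of 1 t] by simp

lemma D_pos: "0 < t \<Longrightarrow> 0 < D t"
  using D_ge[of t] by linarith

lemma D_mult: assumes "0 < s" "0 < t" shows "D (s * t) \<le> D s * D t"
proof -
  have "\<phi> (r * (s * t)) / \<phi> r \<le> D s * D t" if r: "0 < r" for r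
  proof -
    have "\<phi> (r * s * t) \<le> D t * \<phi> (r * s)" using assms r by (intro le_D_mult) auto
    also have "\<dots> \<le> D t * (D s * \<phi> r)" using assms r D_pos[of t] by (intro mult_left_mono le_D_mult) auto
    finally show ?thesis using pos[OF r] by (simp add: field_simps)
  qed
  then show ?thesis unfolding fund_dil_def[of _ "s * t"]
    by (intro cSUP_least) (auto simp: greaterThan_non_empty)
qed

text \<open>\<open>lower_fund_index\<close> is a \<open>Lim\<close>, meaningful only once
  convergence is known. In the variable u = -ln t the function ln (D t) is subadditive because D is
  submultiplicative, and at most u in modulus because min 1 t <= D t <= max 1 t.\<close>

lemma lower_index_tendsto:
  "((\<lambda>t. ln (D t) / ln t) \<longlongrightarrow> lower_fund_index \<phi>) (at_right 0)"
proof -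
  define h where "h u = ln (D (exp (- u)))" for u
  have "\<exists>L. ((\<lambda>u. h u / u) \<longlongrightarrow> L) at_top"
  proof (rule fekete_quotient_convergent)
    show "h (x + y) \<le> h x + h y" for x y
    proof -
      have "exp (- (x + y)) = exp (- x) * exp (- y)" by (simp add: exp_add[symmetric])
      then have "D (exp (- (x + y))) \<le> D (exp (- x)) * D (exp (- y))" using D_mult[of "exp (-x)" "exp (-y)"] by simp
      then have "h (x + y) \<le> ln (D (exp (- x)) * D (exp (- y)))" unfolding h_def
        by (subst ln_le_cancel_iff) (simp_all add: D_pos)
      then show ?thesis using D_pos[of "exp (- x)"] D_pos[of "exp (- y)"] by (simp add: h_def ln_mult)
    qed
    show "\<bar>h x\<bar> \<le> x" if x: "0 \<le> x" for x
    proof -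
      have "D (exp (- x)) \<le> 1" "exp (- x) \<le> D (exp (- x))"
        using D_le[of "exp (- x)"] D_ge[of "exp (- x)"] x by auto
      moreover have "- x \<le> h x" unfolding h_def using \<open>exp (- x) \<le> _\<close> D_pos[of "exp (- x)"]
        by (simp add: ln_ge_iff)
      ultimately show ?thesis using D_pos[of "exp (- x)"] x by (simp add: h_def)
    qed
  qed
  then obtain L where L: "((\<lambda>u. h u / u) \<longlongrightarrow> L) at_top" by blast
  have "filterlim (\<lambda>t::real. - ln t) at_top (at_right 0)"
    using ln_at_0 by (simp add: filterlim_uminus_at_top)
  from filterlim_compose[OF L this] have "((\<lambda>t. - (h (- ln t) / (- ln t))) \<longlongrightarrow> - L) (at_right 0)"
    by (intro tendsto_minus)
  moreover have "\<forall>\<^sub>F t in at_right 0. - (h (- ln t) / (- ln t)) = ln (D t) / ln t"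
    using eventually_at_right_less[of 0] by eventually_elim (simp add: h_def)
  ultimately have "((\<lambda>t. ln (D t) / ln t) \<longlongrightarrow> - L) (at_right 0)" by (rule Lim_transform_eventually)
  moreover from this have "lower_fund_index \<phi> = - L"
    unfolding lower_fund_index_def by (intro tendsto_Lim) simp_all
  ultimately show ?thesis by simp
qed

lemma upper_index_tendsto:
  "((\<lambda>t. ln (D t) / ln t) \<longlongrightarrow> upper_fund_index \<phi>) at_top"
proof -
  define h where "h u = ln (D (exp u))" for u
  have "\<exists>L. ((\<lambda>u. h u / u) \<longlongrightarrow> L) at_top"
  proof (rule fekete_quotient_convergent)
    show "h (x + y) \<le> h x + h y" for x y
    proof -
      have "D (exp (x + y)) \<le> D (exp x) * D (exp y)" using D_mult[of "exp x" "exp y"] by (simp add: exp_add)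
      then have "h (x + y) \<le> ln (D (exp x) * D (exp y))" unfolding h_def
        by (subst ln_le_cancel_iff) (simp_all add: D_pos)
      then show ?thesis using D_pos[of "exp x"] D_pos[of "exp y"] by (simp add: h_def ln_mult)
    qed
    show "\<bar>h x\<bar> \<le> x" if x: "0 \<le> x" for x
    proof -
      have "D (exp x) \<le> exp x" "1 \<le> D (exp x)"
        using D_le[of "exp x"] D_ge[of "exp x"] x by auto
      moreover have "h x \<le> ln (exp x)" unfolding h_def using \<open>_ \<le> exp x\<close> D_pos[of "exp x"]
        by (subst ln_le_cancel_iff) auto
      ultimately show ?thesis using x by (simp add: h_def)
    qed
  qed
  then obtain L where L: "((\<lambda>u. h u / u) \<longlongrightarrow> L) at_top" by blast
  from filterlim_compose[OF L ln_at_top] have "((\<lambda>t. h (ln t) / ln t) \<longlongrightarrow> L) at_top" .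
  moreover have "\<forall>\<^sub>F t in at_top. h (ln t) / ln t = ln (D t) / ln t"
    using eventually_gt_at_top[of 0] by eventually_elim (simp add: h_def)
  ultimately have "((\<lambda>t. ln (D t) / ln t) \<longlongrightarrow> L) at_top" by (rule Lim_transform_eventually)
  moreover from this have "upper_fund_index \<phi> = L"
    unfolding upper_fund_index_def by (intro tendsto_Lim) simp_all
  ultimately show ?thesis by simp
qed

text \<open>Near 0 the limit gives D \<tau> <= \<tau>^(g+e); on [a, 1] the constant C = a^-(g+e)
  compensates, as D \<tau> <= 1 there. The surplus e beyond g will absorb the slowly varying factor
  of the weights.\<close>

lemma lower_index_decay:
  assumes g: "0 < g" "g < lower_fund_index \<phi>"
  obtains C e where "0 < C" "0 < e" "\<And>s t. 0 < s \<Longrightarrow> s \<le> t \<Longrightarrow> \<phi> s \<le> C * (s / t) powr (g + e) * \<phi> t"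
proof -
  define e where "e = (lower_fund_index \<phi> - g) / 2"
  have e: "0 < e" "g + e < lower_fund_index \<phi>" using g by (auto simp: e_def field_simps)
  have "\<forall>\<^sub>F t in at_right 0. g + e < ln (D t) / ln t"
    using lower_index_tendsto e(2) by (rule order_tendstoD(1))
  then obtain b where b: "0 < b" "\<And>t. 0 < t \<Longrightarrow> t < b \<Longrightarrow> g + e < ln (D t) / ln t"
    by (auto simp: eventually_at_right_field)
  define a where "a = min b 1"
  have a: "0 < a" "a \<le> 1" "a \<le> b" using b by (auto simp: a_def)
  define C where "C = a powr (- (g + e))"
  have "C = 1 / a powr (g + e)" unfolding C_def by (rule powr_minus_divide)
  moreover have "a powr (g + e) \<le> 1" using a g e by (intro powr_le1) auto
  then have "1 \<le> 1 / a powr (g + e)" using a by (subst le_divide_eq_1_pos) auto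
  ultimately have C: "1 \<le> C" by simp
  have D: "D \<tau> \<le> C * \<tau> powr (g + e)" if t: "0 < \<tau>" "\<tau> \<le> 1" for \<tau>
  proof (cases "\<tau> < a")
    case True
    then have "ln \<tau> < 0" using t a by (intro ln_less_zero) auto
    then have "ln (D \<tau>) < (g + e) * ln \<tau>" using b(2)[of \<tau>] t a True by (simp add: neg_less_divide_eq)
    also have "\<dots> = ln (\<tau> powr (g + e))" using t by (simp add: ln_powr)
    finally have "D \<tau> < \<tau> powr (g + e)"
      using D_pos[of \<tau>] t by (subst (asm) ln_less_cancel_iff) auto
    then have "D \<tau> \<le> 1 * \<tau> powr (g + e)" by simp
    also have "\<dots> \<le> C * \<tau> powr (g + e)" using C by (intro mult_right_mono) auto
    finally show ?thesis .
  next
    case False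
    have "D \<tau> \<le> 1" using D_le[of \<tau>] t by simp
    also have "1 = a powr (- (g + e)) * a powr (g + e)" using a by (simp add: powr_add[symmetric])
    also have "\<dots> \<le> C * \<tau> powr (g + e)" unfolding C_def
      using False a g e by (intro mult_left_mono powr_mono2) auto
    finally show ?thesis .
  qed
  show ?thesis
  proof (rule that)
    show "0 < C" "0 < e" using C e by auto
    fix s t :: real assume st: "0 < s" "s \<le> t"
    have "\<phi> s = \<phi> (t * (s / t))" using st by simp
    also have "\<dots> \<le> D (s / t) * \<phi> t" using st by (intro le_D_mult) auto
    also have "\<dots> \<le> C * (s / t) powr (g + e) * \<phi> t" using st pos[of t] by (intro mult_right_mono D) auto
    finally show "\<phi> s \<le> C * (s / t) powr (g + e) * \<phi> t" .
  qed
qed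

lemma upper_index_growth:
  assumes g: "0 < g" "upper_fund_index \<phi> < g"
  obtains C e where "0 < C" "0 < e" "\<And>s t. 0 < s \<Longrightarrow> s \<le> t \<Longrightarrow> \<phi> t \<le> C * (t / s) powr (g - e) * \<phi> s"
proof -
  \<comment> \<open>The bound g/2 keeps the exponent g - e positive, so that \<tau>^(g-e) >= 1 on
    [1, C), where only D \<tau> <= \<tau> is available.\<close>
  define e where "e = min (g / 2) ((g - upper_fund_index \<phi>) / 2)"
  have e: "0 < e" "upper_fund_index \<phi> < g - e" "e < g" using g by (auto simp: e_def min_def field_simps)
  have "\<forall>\<^sub>F t in at_top. ln (D t) / ln t < g - e"
    using upper_index_tendsto e(2) by (rule order_tendstoD(2))
  then obtain b where b: "\<And>t. b \<le> t \<Longrightarrow> ln (D t) / ln t < g - e"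
    by (auto simp: eventually_at_top_linorder)
  define C where "C = max b 2"
  have C: "1 < C" "b \<le> C" by (auto simp: C_def)
  have D: "D \<tau> \<le> C * \<tau> powr (g - e)" if t: "1 \<le> \<tau>" for \<tau>
  proof (cases "C \<le> \<tau>")
    case True
    then have "0 < ln \<tau>" using C by (intro ln_gt_zero) auto
    then have "ln (D \<tau>) < (g - e) * ln \<tau>" using b[of \<tau>] C True by (simp add: divide_less_eq)
    also have "\<dots> = ln (\<tau> powr (g - e))" using t by (simp add: ln_powr)
    finally have "D \<tau> < \<tau> powr (g - e)"
      using D_pos[of \<tau>] t by (subst (asm) ln_less_cancel_iff) auto
    then have "D \<tau> \<le> 1 * \<tau> powr (g - e)" by simp
    also have "\<dots> \<le> C * \<tau> powr (g - e)" using C by (intro mult_right_mono) auto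
    finally show ?thesis .
  next
    case False
    have "D \<tau> \<le> C * 1" using D_le[of \<tau>] t False by simp
    also have "\<dots> \<le> C * \<tau> powr (g - e)" using C t e by (intro mult_left_mono ge_one_powr_ge_zero) auto
    finally show ?thesis .
  qed
  show ?thesis
  proof (rule that)
    show "0 < C" "0 < e" using C e by auto
    fix s t :: real assume st: "0 < s" "s \<le> t"
    have "\<phi> t = \<phi> (s * (t / s))" using st by simp
    also have "\<dots> \<le> D (t / s) * \<phi> s" using st by (intro le_D_mult) auto
    also have "\<dots> \<le> C * (t / s) powr (g - e) * \<phi> s" using st pos[of s] by (intro mult_right_mono D) auto
    finally show "\<phi> t \<le> C * (t / s) powr (g - e) * \<phi> s" .
  qed
qed

end

section \<open>Slowly varying functions and weights\<close>

lemma quasi_increasing_onD: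
  assumes "quasi_increasing_on S f"
  obtains C where "0 < C" "\<And>s t. s \<in> S \<Longrightarrow> t \<in> S \<Longrightarrow> s \<le> t \<Longrightarrow> f s \<le> C * f t"
proof -
  obtain g c C where g: "mono_on S g" "0 < c" "0 < C" "\<And>t. t \<in> S \<Longrightarrow> c * g t \<le> f t \<and> f t \<le> C * g t"
    using assms unfolding quasi_increasing_on_def equivalent_on_def by blast
  show ?thesis
  proof (rule that[of "C / c"])
    fix s t assume st: "s \<in> S" "t \<in> S" "s \<le> t"
    have "f s \<le> C * g s" using g(4) st by blast
    also have "\<dots> \<le> C * g t" using g st by (intro mult_left_mono) (auto dest: mono_onD)
    also have "\<dots> \<le> C / c * f t" using g(2,3) g(4)[OF st(2)] by (simp add: field_simps)
    finally show "f s \<le> C / c * f t" .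
  qed (use g in simp)
qed

lemma quasi_decreasing_onD:
  assumes "quasi_decreasing_on S f"
  obtains C where "0 < C" "\<And>s t. s \<in> S \<Longrightarrow> t \<in> S \<Longrightarrow> s \<le> t \<Longrightarrow> f t \<le> C * f s"
proof -
  obtain g c C where g: "antimono_on S g" "0 < c" "0 < C" "\<And>t. t \<in> S \<Longrightarrow> c * g t \<le> f t \<and> f t \<le> C * g t"
    using assms unfolding quasi_decreasing_on_def equivalent_on_def by blast
  show ?thesis
  proof (rule that[of "C / c"])
    fix s t assume st: "s \<in> S" "t \<in> S" "s \<le> t"
    have "f t \<le> C * g t" using g(4) st by blast
    also have "\<dots> \<le> C * g s" using g st by (intro mult_left_mono) (auto dest: monotone_onD)
    also have "\<dots> \<le> C / c * f s" using g(2,3) g(4)[OF st(1)] by (simp add: field_simps)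
    finally show "f t \<le> C / c * f s" .
  qed (use g in simp)
qed

lemma SV_pos: "b \<in> SV \<Longrightarrow> 0 < t \<Longrightarrow> 0 < b t"
  by (simp add: SV_def)

lemma SV_increasing:
  assumes "b \<in> SV" "0 < e"
  obtains C where "0 < C" "\<And>s t. 0 < s \<Longrightarrow> s \<le> t \<Longrightarrow> s powr e * b s \<le> C * (t powr e * b t)"
proof -
  have "quasi_increasing_on {0<..} (\<lambda>t. t powr e * b t)" using assms by (simp add: SV_def)
  then obtain C where "0 < C" "\<And>s t. s \<in> {0<..} \<Longrightarrow> t \<in> {0<..} \<Longrightarrow> s \<le> t \<Longrightarrow> s powr e * b s \<le> C * (t powr e * b t)"
    by (rule quasi_increasing_onD) blast
  then show ?thesis by (intro that[of C]) auto
qed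

lemma SV_decreasing:
  assumes "b \<in> SV" "0 < e"
  obtains C where "0 < C" "\<And>s t. 0 < s \<Longrightarrow> s \<le> t \<Longrightarrow> t powr (-e) * b t \<le> C * (s powr (-e) * b s)"
proof -
  have "quasi_decreasing_on {0<..} (\<lambda>t. t powr (-e) * b t)" using assms by (simp add: SV_def)
  then obtain C where "0 < C" "\<And>s t. s \<in> {0<..} \<Longrightarrow> t \<in> {0<..} \<Longrightarrow> s \<le> t \<Longrightarrow> t powr (-e) * b t \<le> C * (s powr (-e) * b s)"
    by (rule quasi_decreasing_onD) blast
  then show ?thesis by (intro that[of C]) auto
qed

locale weighted = quasi_concave \<phi> for \<phi> :: "real \<Rightarrow> real" +
  fixes b :: "real \<Rightarrow> real" and \<theta> :: real
  assumes b: "b \<in> SV" and \<theta>: "0 < \<theta>" 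
begin

abbreviation "w \<equiv> weight b \<phi> \<theta>"

lemma w_pos: "0 < t \<Longrightarrow> 0 < w d t"
  using SV_pos[OF b] pos by (simp add: weight_def)

lemma w_measurable:
  assumes d: "0 < d" shows "w d \<in> borel_measurable half_line"
proof -
  \<comment> \<open>b is only Lebesgue measurable, so its composition with t^(1/d) relies on the
    power map being measurable between Lebesgue sets.\<close>
  have "(\<lambda>t. b (power_map 1 (1 / d) t)) \<in> borel_measurable half_line"
    using measurable_comp[OF power_map_measurable[of 1 "1 / d"]] b d by (auto simp: SV_def comp_def)
  then have 1 [measurable]: "(\<lambda>t. b (t powr (1 / d))) \<in> borel_measurable half_line" by (simp add: power_map_def)
  \<comment> \<open>\<phi> is known to be monotone on the positive axis only; the cut-off makes it
    monotone on the whole line, hence Borel.\<close>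
  have "mono (\<lambda>t. if 0 < t then \<phi> t else 0)"
    by (intro monoI) (auto intro: mono less_imp_le pos)
  then have [measurable]: "(\<lambda>t. if 0 < t then \<phi> t else 0) \<in> borel_measurable half_line"
    by (intro borel_measurable_half_line borel_measurable_mono)
  have [measurable]: "(\<lambda>t. t powr (\<theta> / d)) \<in> borel_measurable half_line"
    by (rule borel_measurable_half_line) measurable
  have "(\<lambda>t. b (t powr (1 / d)) * (if 0 < t then \<phi> t else 0) / t powr (\<theta> / d)) \<in> borel_measurable half_line"
    by measurable
  then show ?thesis
    by (rule measurable_cong[THEN iffD1, rotated]) (simp add: weight_def space_half_line)
qed

text \<open>The surplus e from \<open>lower_index_decay\<close> is split: the slowly varying factor
  costs a power e/2, which is d e/2 in the variable t^(1/d), and e/2 remains as decay. Since g >=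
  \<theta>/d, the power of t in the weight does not consume any of it.\<close>

lemma w_decay:
  assumes d: "0 < d" and g: "\<theta> / d \<le> g" "g < lower_fund_index \<phi>"
  obtains K e where "0 < K" "0 < e" "\<And>s t. 0 < s \<Longrightarrow> s \<le> t \<Longrightarrow> w d s \<le> K * (s / t) powr e * w d t"
proof -
  have g0: "0 < g" using g d \<theta> by (meson divide_pos_pos less_le_trans)
  obtain C e where C: "0 < C" "0 < e" and ph: "\<And>s t. 0 < s \<Longrightarrow> s \<le> t \<Longrightarrow> \<phi> s \<le> C * (s / t) powr (g + e) * \<phi> t"
    using lower_index_decay[OF g0 g(2)] by blast
  obtain B where B: "0 < B" and bb: "\<And>s t. 0 < s \<Longrightarrow> s \<le> t \<Longrightarrow> s powr (d * e / 2) * b s \<le> B * (t powr (d * e / 2) * b t)"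
    using SV_increasing[OF b, of "d * e / 2"] d C by (metis divide_pos_pos mult_pos_pos zero_less_numeral)
  show ?thesis
  proof (rule that)
    show "0 < B * C" "0 < e / 2" using B C by auto
    fix s t :: real assume st: "0 < s" "s \<le> t"
    have t: "0 < t" using st by simp
    have "s powr (1 / d) \<le> t powr (1 / d)" using st d by (intro powr_mono2) auto
    then have "(s powr (1 / d)) powr (d * e / 2) * b (s powr (1 / d)) \<le> B * ((t powr (1 / d)) powr (d * e / 2) * b (t powr (1 / d)))"
      using st by (intro bb) auto
    then have "s powr (e / 2) * b (s powr (1 / d)) \<le> B * (t powr (e / 2) * b (t powr (1 / d)))"
      using d by (simp add: powr_powr)
    then have b1: "b (s powr (1 / d)) \<le> B * (s / t) powr (- (e / 2)) * b (t powr (1 / d))"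
      using st t by (simp add: powr_divide powr_minus field_simps)
    have "w d s = b (s powr (1 / d)) * \<phi> s * s powr (- (\<theta> / d))"
      by (simp add: weight_def powr_minus field_simps)
    also have "\<dots> \<le> (B * (s / t) powr (- (e / 2)) * b (t powr (1 / d))) * (C * (s / t) powr (g + e) * \<phi> t) * s powr (- (\<theta> / d))"
    proof (intro mult_right_mono mult_mono b1 ph st)
      have "0 < b (t powr (1 / d))" using t by (intro SV_pos[OF b]) simp
      then show "0 \<le> B * (s / t) powr (- (e / 2)) * b (t powr (1 / d))" using B by simp
      show "0 \<le> \<phi> s" using pos[of s] st by simp
    qed simp
    also have "s powr (- (\<theta> / d)) = (s / t) powr (- (\<theta> / d)) * t powr (- (\<theta> / d))"
      using st t by (simp add: powr_mult[symmetric])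
    also have "(B * (s / t) powr (- (e / 2)) * b (t powr (1 / d))) * (C * (s / t) powr (g + e) * \<phi> t) * ((s / t) powr (- (\<theta> / d)) * t powr (- (\<theta> / d)))
        = B * C * ((s / t) powr (- (e / 2)) * (s / t) powr (g + e) * (s / t) powr (- (\<theta> / d))) * w d t"
      by (simp add: weight_def powr_minus field_simps)
    also have "(s / t) powr (- (e / 2)) * (s / t) powr (g + e) * (s / t) powr (- (\<theta> / d)) = (s / t) powr (e / 2 + (g - \<theta> / d))"
      by (simp add: powr_add[symmetric] algebra_simps)
    also have "B * C * (s / t) powr (e / 2 + (g - \<theta> / d)) * w d t \<le> B * C * (s / t) powr (e / 2) * w d t"
      using st t B C g w_pos[OF t] by (intro mult_right_mono mult_left_mono powr_mono') (auto simp: less_imp_le)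
    finally show "w d s \<le> B * C * (s / t) powr (e / 2) * w d t" .
  qed
qed

text \<open>The same splitting with the upper index and the quasi-decreasing function t^-\<epsilon>
  b(t), comparing t with 1; the reciprocal weight then vanishes at 0 at least like a power.\<close>

lemma inverse_w_decay:
  assumes d: "0 < d" and g: "upper_fund_index \<phi> < \<theta> / d"
  obtains K e where "0 < K" "0 < e" "\<And>t. 0 < t \<Longrightarrow> t \<le> 1 \<Longrightarrow> 1 / w d t \<le> K * t powr e"
proof -
  have g0: "0 < \<theta> / d" using d \<theta> by simp
  obtain C e where C: "0 < C" "0 < e" and ph: "\<And>s t. 0 < s \<Longrightarrow> s \<le> t \<Longrightarrow> \<phi> t \<le> C * (t / s) powr (\<theta> / d - e) * \<phi> s"
    using upper_index_growth[OF g0 g] by blast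
  obtain B where B: "0 < B" and bb: "\<And>s t. 0 < s \<Longrightarrow> s \<le> t \<Longrightarrow> t powr (- (d * e / 2)) * b t \<le> B * (s powr (- (d * e / 2)) * b s)"
    using SV_decreasing[OF b, of "d * e / 2"] d C by (metis divide_pos_pos mult_pos_pos zero_less_numeral)
  define K where "K = B * C / (b 1 * \<phi> 1)"
  have b1: "0 < b 1" "0 < \<phi> 1" using SV_pos[OF b] pos by auto
  show ?thesis
  proof (rule that)
    show "0 < K" "0 < e / 2" using B C b1 by (auto simp: K_def)
    fix t :: real assume t: "0 < t" "t \<le> 1"
    have "1 powr (- (d * e / 2)) * b 1 \<le> B * ((t powr (1 / d)) powr (- (d * e / 2)) * b (t powr (1 / d)))"
      using t d by (intro bb) (auto simp: powr_le1)
    then have 1: "b 1 \<le> B * (t powr (- (e / 2)) * b (t powr (1 / d)))" using d by (simp add: powr_powr)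
    have "\<phi> 1 \<le> C * (1 / t) powr (\<theta> / d - e) * \<phi> t" using t by (intro ph) auto
    also have "(1 / t) powr (\<theta> / d - e) = t powr (e - \<theta> / d)"
      using t by (simp add: powr_divide powr_minus_divide[symmetric])
    finally have 2: "\<phi> 1 \<le> C * t powr (e - \<theta> / d) * \<phi> t" .
    have "b 1 * \<phi> 1 \<le> (B * (t powr (- (e / 2)) * b (t powr (1 / d)))) * (C * t powr (e - \<theta> / d) * \<phi> t)"
      using 1 2 b1 by (intro mult_mono) auto
    also have "\<dots> = B * C * (t powr (- (e / 2)) * t powr e * t powr (- (\<theta> / d))) * (b (t powr (1 / d)) * \<phi> t)"
      by (simp add: powr_add powr_diff powr_minus field_simps)
    also have "t powr (- (e / 2)) * t powr e * t powr (- (\<theta> / d)) = t powr (e / 2) * t powr (- (\<theta> / d))"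
      by (simp add: powr_add[symmetric])
    also have "B * C * (t powr (e / 2) * t powr (- (\<theta> / d))) * (b (t powr (1 / d)) * \<phi> t) = B * C * t powr (e / 2) * w d t"
      by (simp add: weight_def powr_minus field_simps)
    finally show "1 / w d t \<le> K * t powr (e / 2)"
      using b1 w_pos[of t d] t by (simp add: K_def field_simps)
  qed
qed

lemma b_dilate:
  assumes A: "1 \<le> A"
  obtains B where "0 < B" "\<And>t. 0 < t \<Longrightarrow> b t \<le> B * b (A * t)"
proof -
  obtain C where C: "0 < C" "\<And>s t. 0 < s \<Longrightarrow> s \<le> t \<Longrightarrow> s powr 1 * b s \<le> C * (t powr 1 * b t)"
    using SV_increasing[OF b, of 1] by auto
  show ?thesis
  proof (rule that)
    show "0 < C * A" using C A by simp
    fix t :: real assume t: "0 < t"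
    have "t powr 1 * b t \<le> C * ((A * t) powr 1 * b (A * t))" using t A by (intro C) auto
    then show "b t \<le> C * A * b (A * t)" using t A by (simp add: field_simps)
  qed
qed

end

section \<open>Embeddings of Besov spaces\<close>

lemma dyadic_scale:
  fixes t :: real assumes "0 < t" "t < 1"
  obtains J where "1 / 2 \<le> 2 ^ J * t" "2 ^ J * t < 1"
proof -
  obtain n where "1 / (2 * t) < 2 ^ n" using real_arch_pow[of 2 "1 / (2 * t)"] by auto
  then have ex: "\<exists>n. 1 / 2 \<le> 2 ^ n * t" using assms by (intro exI[of _ n]) (simp add: field_simps)
  define J where "J = (LEAST n. 1 / 2 \<le> 2 ^ n * t)"
  have J: "1 / 2 \<le> 2 ^ J * t" unfolding J_def using ex by (rule LeastI_ex)
  have "2 ^ J * t < 1"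
  proof (cases J)
    case (Suc i)
    then have "\<not> 1 / 2 \<le> 2 ^ i * t" using not_less_Least[of i "\<lambda>n. 1 / 2 \<le> 2 ^ n * t"] by (simp add: J_def)
    then show ?thesis using Suc by simp
  qed (use assms in simp)
  with J show ?thesis by (rule that)
qed

text \<open>The exact value is ln 2; bounding 1/t below by 1/(2a) gives a constant that is good
  enough.\<close>

lemma emeasure_log_dyadic_ge:
  assumes a: "0 < a"
  shows "ennreal (1 / 2) \<le> nn_integral log_measure (indicator {a..<2 * a})"
proof -
  have "ennreal (1 / 2) = ennreal (1 / (2 * a) * (2 * a - a))" using a by simp
  also have "\<dots> = ennreal (1 / (2 * a)) * ennreal (2 * a - a)" using a by (intro ennreal_mult) auto
  also have "\<dots> = (\<integral>\<^sup>+ t. ennreal (1 / (2 * a)) * indicator {a..<2 * a} t \<partial>lborel)"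
    using a by (subst nn_integral_cmult_indicator) auto
  also have "\<dots> \<le> (\<integral>\<^sup>+ t. ennreal (1 / t) * indicator {a..<2 * a} t * indicator {0<..} t \<partial>lborel)"
    using a by (intro nn_integral_mono) (auto simp: indicator_def intro!: ennreal_leI divide_left_mono)
  also have "\<dots> = nn_integral log_measure (indicator {a..<2 * a})"
    by (subst nn_integral_log_measure) (auto simp: nn_integral_half_line intro: borel_measurable_half_line)
  finally show ?thesis .
qed

text \<open>Each value g(2^j t) is at most c times g on the dyadic interval that starts there, whose
  measure for dt/t is at least 1/2, whence the factor 2 c. The intervals are disjoint.\<close>

lemma dyadic_sum_le_integral:
  fixes g :: "real \<Rightarrow> ennreal" and c :: real
  assumes g [measurable]: "g \<in> borel_measurable half_line" and t: "0 < t" and c: "0 \<le> c"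
    and le: "\<And>a s. 0 < a \<Longrightarrow> a \<le> s \<Longrightarrow> s \<le> 2 * a \<Longrightarrow> g a \<le> ennreal c * g s"
  shows "(\<Sum>j=1..J. g (2 ^ j * t)) \<le> ennreal (2 * c) * (\<integral>\<^sup>+ s. g s * indicator {2 * t..<2 ^ Suc J * t} s \<partial>log_measure)"
proof (induction J)
  case (Suc J)
  define a where "a = 2 ^ Suc J * t"
  have a: "0 < a" using t by (simp add: a_def)
  have [measurable]: "g \<in> borel_measurable log_measure" using g by (simp cong: measurable_cong_sets)
  have I [measurable]: "indicator {x..<y} \<in> (log_measure \<rightarrow>\<^sub>M (borel :: ennreal measure))" for x y
    by (rule borel_measurable_log_measure) simp
  have "2 * t \<le> a" using t by (simp add: a_def)
  have "g a * ennreal (1 / 2) \<le> g a * nn_integral log_measure (indicator {a..<2 * a})"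
    by (intro mult_left_mono emeasure_log_dyadic_ge a) simp
  also have "\<dots> = (\<integral>\<^sup>+ s. g a * indicator {a..<2 * a} s \<partial>log_measure)" by (simp add: nn_integral_cmult)
  also have "\<dots> \<le> (\<integral>\<^sup>+ s. ennreal c * (g s * indicator {a..<2 * a} s) \<partial>log_measure)"
    using le[OF a] by (intro nn_integral_mono) (auto simp: indicator_def)
  also have "\<dots> = ennreal c * (\<integral>\<^sup>+ s. g s * indicator {a..<2 * a} s \<partial>log_measure)" by (simp add: nn_integral_cmult)
  finally have "2 * (g a * ennreal (1 / 2)) \<le> 2 * (ennreal c * (\<integral>\<^sup>+ s. g s * indicator {a..<2 * a} s \<partial>log_measure))"
    by (rule mult_left_mono) simp
  moreover have "2 * (g a * ennreal (1 / 2)) = g a"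
  proof -
    have "2 * ennreal (1 / 2) = ennreal (2 * (1 / 2))" by (subst ennreal_mult) auto
    then show ?thesis by (subst mult.left_commute) simp
  qed
  ultimately have 1: "g a \<le> ennreal (2 * c) * (\<integral>\<^sup>+ s. g s * indicator {a..<2 * a} s \<partial>log_measure)"
    using c by (simp add: ennreal_mult mult.assoc)
  have "(\<Sum>j=1..Suc J. g (2 ^ j * t)) = (\<Sum>j=1..J. g (2 ^ j * t)) + g a" by (simp add: a_def)
  also have "\<dots> \<le> ennreal (2 * c) * (\<integral>\<^sup>+ s. g s * indicator {2 * t..<a} s \<partial>log_measure)
      + ennreal (2 * c) * (\<integral>\<^sup>+ s. g s * indicator {a..<2 * a} s \<partial>log_measure)"
    using Suc 1 unfolding a_def[symmetric] by (rule add_mono)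
  also have "\<dots> = ennreal (2 * c) * (\<integral>\<^sup>+ s. g s * indicator {2 * t..<a} s + g s * indicator {a..<2 * a} s \<partial>log_measure)"
    by (simp add: nn_integral_add distrib_left)
  also have "\<dots> = ennreal (2 * c) * (\<integral>\<^sup>+ s. g s * indicator {2 * t..<2 * a} s \<partial>log_measure)"
    using \<open>2 * t \<le> a\<close> a by (intro arg_cong2[of _ _ _ _ "(*)"] refl nn_integral_cong) (auto simp: indicator_def)
  finally show ?case by (simp add: a_def mult.assoc)
qed simp

text \<open>Past a point s with f*(s) <= e/2 the average f**(t) is at most F/t + e/2, where F = s
  f**(s).\<close>

lemma max_rearr_vanishes:
  assumes f: "f \<in> borel_measurable M" and fin: "L1_plus_Linf_norm M f < \<infinity>"
    and van: "vanishes_at_infinity M f" and e: "0 < e"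
  obtains T where "\<And>t. T \<le> t \<Longrightarrow> max_rearr M f t \<le> ennreal e"
proof -
  have "\<forall>\<^sub>F t in at_top. rearr M f t < ennreal (e / 2)"
    using van e unfolding vanishes_at_infinity_def by (intro order_tendstoD(2)) auto
  then obtain T0 where "\<And>t. T0 \<le> t \<Longrightarrow> rearr M f t < ennreal (e / 2)" by (auto simp: eventually_at_top_linorder)
  then have T1: "rearr M f (max 1 T0) \<le> ennreal (e / 2)" by (intro less_imp_le) auto
  define s where "s = max 1 T0"
  have s: "0 < s" "rearr M f s \<le> ennreal (e / 2)" using T1 by (auto simp: s_def)
  obtain F where F: "rearr_int M f s = ennreal F" "0 \<le> F"
    using rearr_int_finite[OF f fin s(1)] by (cases "rearr_int M f s") auto
  show ?thesis
  proof (rule that)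
    fix t assume t: "max s (2 * F / e) \<le> t"
    then have t': "s \<le> t" "2 * F / e \<le> t" "0 < t" using s by auto
    have "rearr_int M f t \<le> ennreal F + ennreal (t - s) * rearr M f s"
      using rearr_int_le[OF f s(1) t'(1)] F by simp
    also have "\<dots> \<le> ennreal F + ennreal (t - s) * ennreal (e / 2)" by (intro add_left_mono mult_left_mono s) simp
    also have "\<dots> = ennreal F + ennreal ((t - s) * (e / 2))" using t' e by (subst ennreal_mult) auto
    also have "\<dots> = ennreal (F + (t - s) * (e / 2))" using F t' e by (subst ennreal_plus) auto
    also have "\<dots> \<le> ennreal (e * t)"
    proof (rule ennreal_leI)
      have "2 * F \<le> e * t" using t' e by (simp add: field_simps)
      moreover have "0 \<le> s * e" using s e by simp
      moreover have "F + (t - s) * (e / 2) = F + e * t / 2 - s * e / 2" by (simp add: field_simps)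
      ultimately show "F + (t - s) * (e / 2) \<le> e * t" by linarith
    qed
    finally have "max_rearr M f t \<le> ennreal (e * t) / ennreal t"
      unfolding max_rearr_eq by (rule divide_right_mono_ennreal)
    then show "max_rearr M f t \<le> ennreal e" using t' e by (simp add: divide_ennreal)
  qed
qed

text \<open>The remainder f**(2^J t) of the finite sum tends to 0; this is where f*(\<infinity>) = 0
  enters.\<close>

lemma max_rearr_le_suminf_osc:
  assumes f: "f \<in> borel_measurable M" and fin: "L1_plus_Linf_norm M f < \<infinity>"
    and van: "vanishes_at_infinity M f" and t: "0 < t"
  shows "max_rearr M f t \<le> (\<Sum>j. osc M f (2 ^ Suc j * t))"
proof (rule ennreal_le_epsilon)
  fix e :: real assume "0 < e"
  then obtain T where T: "\<And>t. T \<le> t \<Longrightarrow> max_rearr M f t \<le> ennreal e"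
    using max_rearr_vanishes[OF f fin van] by blast
  obtain J where "T / t < 2 ^ J" using real_arch_pow[of 2 "T / t"] by auto
  then have J: "T \<le> 2 ^ J * t" using t by (simp add: field_simps)
  have "max_rearr M f t \<le> max_rearr M f (2 ^ J * t) + (\<Sum>j=1..J. osc M f (2 ^ j * t))"
    by (rule max_rearr_le_sum_osc[OF f fin t])
  also have "(\<Sum>j=1..J. osc M f (2 ^ j * t)) = (\<Sum>j<J. osc M f (2 ^ Suc j * t))"
    using sum.atLeast1_atMost_eq[of "\<lambda>j. osc M f (2 ^ j * t)" J] by simp
  also have "\<dots> \<le> (\<Sum>j. osc M f (2 ^ Suc j * t))" by (intro sum_le_suminf) auto
  finally show "max_rearr M f t \<le> (\<Sum>j. osc M f (2 ^ Suc j * t)) + ennreal e"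
    using T[OF J] by (subst add.commute) (meson add_mono order_refl order_trans)
qed

text \<open>The finite sum is stopped at the dyadic multiple of t in [1/2, 1), where f** is at most
  2 f**(1), twice the norm in L1 + Linf.\<close>

lemma max_rearr_le_unit_scale:
  assumes f: "f \<in> borel_measurable M" and fin: "L1_plus_Linf_norm M f < \<infinity>" and t: "0 < t" "t < 1"
  obtains J where "2 ^ J * t < 1" "1 / 2 \<le> 2 ^ J * t"
    "max_rearr M f (2 ^ J * t) \<le> 2 * L1_plus_Linf_norm M f"
    "max_rearr M f t \<le> 2 * L1_plus_Linf_norm M f + (\<Sum>j=1..J. osc M f (2 ^ j * t))"
proof -
  obtain J where J: "1 / 2 \<le> 2 ^ J * t" "2 ^ J * t < 1" using t by (rule dyadic_scale)
  have "max_rearr M f (2 ^ J * t) \<le> 2 * L1_plus_Linf_norm M f"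
    unfolding L1_plus_Linf_norm_eq(2) using J t by (intro max_rearr_le_two[OF f fin]) auto
  moreover from this have "max_rearr M f t \<le> 2 * L1_plus_Linf_norm M f + (\<Sum>j=1..J. osc M f (2 ^ j * t))"
    using max_rearr_le_sum_osc[OF f fin t(1), of J] add_right_mono order_trans by blast
  ultimately show ?thesis using J that by blast
qed

lemma ennreal_double: "0 \<le> c \<Longrightarrow> ennreal c * x + ennreal c * x = ennreal (2 * c) * x"
proof -
  assume "0 \<le> c"
  then have "ennreal (2 * c) = ennreal c + ennreal c" by (subst ennreal_plus[symmetric]) auto
  then show ?thesis by (simp only: distrib_right)
qed

lemma osc_le_max_rearr: "osc M f t \<le> max_rearr M f t"
  unfolding osc_def by (rule diff_le_self_ennreal)

section \<open>Estimates in the companion norm\<close>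

locale besov_setting = ri_on_rd M k n X + interpolation_parameter E \<F>
  for M :: "'a::metric_space measure" and k n :: real and X :: "('a \<Rightarrow> ennreal) \<Rightarrow> ennreal"
    and E :: "(real \<Rightarrow> ennreal) \<Rightarrow> ennreal" and \<F> :: "fnorm \<Rightarrow> fnorm \<Rightarrow> fnorm" +
  fixes b :: "real \<Rightarrow> real" and \<theta> :: real
  assumes b_SV: "b \<in> SV" and \<theta>_pos: "0 < \<theta>"
begin

sublocale weighted "fund_fun M X" b \<theta>
proof
  show "\<And>t. 0 < t \<Longrightarrow> 0 < fund_fun M X t" by (rule fund_fun_pos)
  show "\<And>s t. 0 < s \<Longrightarrow> s \<le> t \<Longrightarrow> fund_fun M X s \<le> fund_fun M X t" by (rule fund_fun_mono) auto
  show "\<And>s t. 0 < s \<Longrightarrow> s \<le> t \<Longrightarrow> s * fund_fun M X t \<le> t * fund_fun M X s" by (rule fund_fun_quasi_concave)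
qed (rule b_SV \<theta>_pos)+

abbreviation "Bs \<equiv> besov_norm M X N \<theta> b"
abbreviation "Os f \<equiv> osc M (absf f)"
abbreviation "Ms f \<equiv> max_rearr M (absf f)"
abbreviation "nrm f \<equiv> L1_plus_Linf_norm M (absf f)"

definition Phi :: "('a \<Rightarrow> real) \<Rightarrow> real \<Rightarrow> ennreal" where
  "Phi f r = ennreal (r powr (- \<theta>) * b r) * modulus M X f r"

lemma besov_norm_eq: "besov_norm M X G \<theta> b f = G (Phi f)"
  by (simp add: besov_norm_def Phi_def[abs_def])

lemma L1_LinfD:
  assumes "f \<in> L1_plus_Linf M"
  shows "f \<in> borel_measurable M" "absf f \<in> borel_measurable M" "nrm f < \<infinity>"
  using assms by (auto simp: L1_plus_Linf_def)

lemma Os_measurable: "f \<in> L1_plus_Linf M \<Longrightarrow> Os f \<in> borel_measurable half_line"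
  by (intro borel_measurable_half_line osc_measurable L1_LinfD)

lemma Ms_measurable: "f \<in> L1_plus_Linf M \<Longrightarrow> Ms f \<in> borel_measurable half_line"
  by (rule borel_measurable_half_line, rule max_rearr_measurable) (rule L1_LinfD)

lemma w_measurable' [measurable]:
  "0 < d \<Longrightarrow> (\<lambda>t. ennreal (w d t)) \<in> borel_measurable half_line"
  using w_measurable[of d] by measurable

lemma indicator_measurable_half_line [measurable]:
  "A \<in> sets borel \<Longrightarrow> indicator A \<in> (half_line \<rightarrow>\<^sub>M (borel :: ennreal measure))"
  by (rule borel_measurable_half_line) simp

lemma weighted_osc_pointwise:
  obtains A Q where "1 \<le> A" "0 < Q"
    "\<And>f t. f \<in> L1_plus_Linf M \<Longrightarrow> 0 < t \<Longrightarrow> t \<le> 1 \<Longrightarrow>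
       ennreal (w n t) * Os f t \<le> ennreal Q * Phi f (power_map A (1 / n) t)"
    "\<And>f t. f \<in> L1_plus_Linf M \<Longrightarrow> 1 \<le> t \<Longrightarrow>
       ennreal (w k t) * Os f t \<le> ennreal Q * Phi f (power_map A (1 / k) t)"
proof -
  obtain A where A: "1 \<le> A"
    and An: "\<And>x t. 0 < t \<Longrightarrow> t \<le> 1 \<Longrightarrow> 2 * t \<le> measure M (ball x (A * t powr (1 / n)))"
    and Ak: "\<And>x t. 1 \<le> t \<Longrightarrow> 2 * t \<le> measure M (ball x (A * t powr (1 / k)))"
    using ball_measure_lower by blast
  obtain B where B: "0 < B" "\<And>t. 0 < t \<Longrightarrow> b t \<le> B * b (A * t)" using b_dilate[OF A] by blast
  \<comment> \<open>With r = A t^(1/d): the factor A^\<theta> converts t^(-\<theta>/d) into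
    r^(-\<theta>), B converts b(t^(1/d)) into b(r), and 2 is the loss in
    \<open>osc_le_modulus\<close>.\<close>
  define Q where "Q = 2 * (B * A powr \<theta>)"
  have main: "ennreal (w d t) * Os f t \<le> ennreal Q * Phi f (power_map A (1 / d) t)"
    if f: "f \<in> L1_plus_Linf M" and t: "0 < t" and d: "0 < d"
      and m: "\<And>x. 2 * t \<le> measure M (ball x (A * t powr (1 / d)))" for f t d
  proof -
    define r where "r = A * t powr (1 / d)"
    have r: "0 < r" using A t by (simp add: r_def)
    have osc: "ennreal (\<phi> t) * Os f t \<le> 2 * modulus M X f r"
      unfolding r_def by (rule osc_le_modulus[OF L1_LinfD(1,3)[OF f] t m])
    have "r powr (- \<theta>) = A powr (- \<theta>) * t powr (- (\<theta> / d))"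
      using A t by (simp add: r_def powr_mult powr_powr)
    then have e: "t powr (- (\<theta> / d)) = A powr \<theta> * r powr (- \<theta>)" using A by (simp add: powr_minus field_simps)
    have "w d t = b (t powr (1 / d)) * t powr (- (\<theta> / d)) * \<phi> t"
      by (simp add: weight_def powr_minus field_simps)
    also have "\<dots> \<le> (B * b r) * t powr (- (\<theta> / d)) * \<phi> t"
      unfolding r_def using t pos[of t] by (intro mult_right_mono B) auto
    also have "\<dots> = (B * A powr \<theta>) * (r powr (- \<theta>) * b r) * \<phi> t" by (simp add: e)
    finally have "ennreal (w d t) \<le> ennreal ((B * A powr \<theta>) * (r powr (- \<theta>) * b r)) * ennreal (\<phi> t)"
      using B SV_pos[OF b_SV r] pos[OF t] by (subst ennreal_mult[symmetric]) (auto intro: ennreal_leI)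
    then have "ennreal (w d t) * Os f t \<le> ennreal ((B * A powr \<theta>) * (r powr (- \<theta>) * b r)) * ennreal (\<phi> t) * Os f t"
      by (rule mult_right_mono) simp
    also have "\<dots> \<le> ennreal ((B * A powr \<theta>) * (r powr (- \<theta>) * b r)) * (2 * modulus M X f r)"
      unfolding mult.assoc by (intro mult_left_mono) (use osc in auto)
    also have "\<dots> = ennreal Q * Phi f r"
      using B SV_pos[OF b_SV r] by (simp add: Q_def Phi_def ennreal_mult ac_simps)
    finally show ?thesis by (simp add: r_def power_map_def)
  qed
  show ?thesis
  proof (rule that[OF A])
    show "0 < Q" using A B by (simp add: Q_def)
  qed (use main An Ak n_pos k_pos in auto)
qed

theorem weighted_osc_bound:
  obtains C where "0 < C"
    "\<And>f. f \<in> L1_plus_Linf M \<Longrightarrow> N (\<lambda>t. ennreal (w n t) * Os f t * indicator {0<..<1} t) \<le> ennreal C * Bs f"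
    "\<And>f. f \<in> L1_plus_Linf M \<Longrightarrow> N (\<lambda>t. ennreal (w k t) * Os f t * indicator {1<..} t) \<le> ennreal C * Bs f"
proof -
  obtain A Q where AQ: "1 \<le> A" "0 < Q"
    "\<And>f t. f \<in> L1_plus_Linf M \<Longrightarrow> 0 < t \<Longrightarrow> t \<le> 1 \<Longrightarrow>
       ennreal (w n t) * Os f t \<le> ennreal Q * Phi f (power_map A (1 / n) t)"
    "\<And>f t. f \<in> L1_plus_Linf M \<Longrightarrow> 1 \<le> t \<Longrightarrow>
       ennreal (w k t) * Os f t \<le> ennreal Q * Phi f (power_map A (1 / k) t)"
    by (rule weighted_osc_pointwise) blast
  \<comment> \<open>The substitution t -> A t^(1/d) has norm at most max 1 d, and d is n or
    k.\<close>
  define C where "C = Q * max (max 1 n) k"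
  have main: "N (\<lambda>t. ennreal (w d t) * Os f t * indicator I t) \<le> ennreal C * Bs f"
    if f: "f \<in> L1_plus_Linf M" and d: "0 < d" "d \<le> max (max 1 n) k" and [measurable]: "I \<in> sets borel"
      and le: "\<And>t. 0 < t \<Longrightarrow> t \<in> I \<Longrightarrow> ennreal (w d t) * Os f t \<le> ennreal Q * Phi f (power_map A (1 / d) t)" for f d I
  proof -
    note Os_measurable[OF f, measurable]
    have "N (\<lambda>t. ennreal (w d t) * Os f t * indicator I t) \<le> N (\<lambda>t. ennreal Q * Phi f (power_map A (1 / d) t))"
    proof (rule N_mono)
      show "(\<lambda>t. ennreal (w d t) * Os f t * indicator I t) \<in> borel_measurable half_line"
        using d by measurable
      show "AE t in half_line. ennreal (w d t) * Os f t * indicator I t \<le> ennreal Q * Phi f (power_map A (1 / d) t)"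
        using le by (intro AE_I2) (auto simp: space_half_line indicator_def)
    qed
    also have "\<dots> \<le> ennreal Q * N (\<lambda>t. Phi f (power_map A (1 / d) t))" using AQ by (intro N_cmult) auto
    also have "\<dots> \<le> ennreal Q * (ennreal (max 1 (1 / \<bar>1 / d\<bar>)) * N (Phi f))"
      using AQ d by (intro mult_left_mono N_power_map) auto
    also have "\<dots> = ennreal (Q * max 1 d) * N (Phi f)" using AQ d by (simp add: ennreal_mult mult.assoc)
    also have "\<dots> \<le> ennreal C * N (Phi f)"
      unfolding C_def using AQ d by (intro mult_right_mono ennreal_leI mult_left_mono) auto
    finally show ?thesis by (simp add: besov_norm_eq)
  qed
  show ?thesis
  proof (rule that)
    show "0 < C" using AQ by (auto simp: C_def less_max_iff_disj)
    fix f assume f: "f \<in> L1_plus_Linf M"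
    show "N (\<lambda>t. ennreal (w n t) * Os f t * indicator {0<..<1} t) \<le> ennreal C * Bs f"
      using AQ(3)[OF f] by (intro main f n_pos) auto
    show "N (\<lambda>t. ennreal (w k t) * Os f t * indicator {1<..} t) \<le> ennreal C * Bs f"
      using AQ(4)[OF f] by (intro main f k_pos) auto
  qed
qed

text \<open>The decay moves the weight from t to 2^j t at the cost K 2^(-e j), dilations have norm
  at most 1 for dt/t, and the powers of q = 2^-e are summable. The right-hand side carries no
  cut-off, since dilation moves points of (0, 1) out of it.\<close>

lemma geometric_dilation_sum:
  assumes W: "\<And>t. 0 < t \<Longrightarrow> 0 \<le> W t" and Wm [measurable]: "W \<in> borel_measurable half_line"
    and decay: "0 < K" "0 < e" "\<And>s t. 0 < s \<Longrightarrow> s \<le> t \<Longrightarrow> W s \<le> K * (s / t) powr e * W t"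
  obtains C where "0 < C"
    "\<And>h I. h \<in> borel_measurable half_line \<Longrightarrow> I = {0<..<1} \<or> I = {1<..} \<Longrightarrow>
      N (\<lambda>t. ennreal (W t) * (\<Sum>j. h (2 ^ Suc j * t)) * indicator I t) \<le> ennreal C * N (\<lambda>t. ennreal (W t) * h t)"
proof -
  define q where "q = (2::real) powr (- e)"
  have q: "0 < q" "q < 1" using decay(2) by (auto simp: q_def powr_less_one)
  define C where "C = K * (\<Sum>j. q ^ Suc j)"
  have sq: "summable (\<lambda>j. q ^ Suc j)" using q by (simp add: summable_geometric summable_Suc_iff del: power_Suc)
  have spos: "0 < (\<Sum>j. q ^ Suc j)" using q by (intro suminf_pos sq) auto
  show ?thesis
  proof (rule that)
    show "0 < C" using decay spos by (simp add: C_def)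
    fix h :: "real \<Rightarrow> ennreal" and I :: "real set"
    assume hm [measurable]: "h \<in> borel_measurable half_line" and I: "I = {0<..<1} \<or> I = {1<..}"
    define a where "a j = (2::real) ^ Suc j" for j
    have a0: "0 < a j" for j by (simp add: a_def)
    have P [measurable]: "(\<lambda>t. a j * t) \<in> measurable half_line half_line" for j
      using power_map_measurable[OF a0[of j], of 1] 
      by (rule measurable_cong[THEN iffD1, rotated]) (auto simp: power_map_def space_half_line)
    have gm [measurable]: "(\<lambda>t. ennreal (W t) * h (a j * t)) \<in> borel_measurable half_line" for j by measurable
    have Im [measurable]: "indicator I \<in> (half_line \<rightarrow>\<^sub>M (borel :: ennreal measure))" using I by auto
    have aq: "(1 / a j) powr e = q ^ Suc j" for j
    proof -
      have "(1 / a j) powr e = ((1 / 2) powr real (Suc j)) powr e"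
        by (simp add: a_def powr_realpow power_one_over del: power_Suc of_nat_Suc)
      also have "\<dots> = ((1 / 2) powr e) powr real (Suc j)" by (simp add: powr_powr mult.commute del: of_nat_Suc)
      also have "(1 / 2) powr e = q" by (simp add: q_def powr_divide powr_minus_divide)
      also have "q powr real (Suc j) = q ^ Suc j" using q by (simp add: powr_realpow del: of_nat_Suc power_Suc)
      finally show ?thesis .
    qed
    have summand: "N (\<lambda>t. ennreal (W t) * h (a j * t) * indicator I t) \<le> ennreal (K * q ^ Suc j) * N (\<lambda>t. ennreal (W t) * h t)" for j
    proof -
      let ?g = "\<lambda>t. ennreal (W t) * h t"
      have "N (\<lambda>t. ennreal (W t) * h (a j * t) * indicator I t) \<le> N (\<lambda>t. ennreal (K * q ^ Suc j) * ?g (power_map (a j) 1 t))"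
      proof (rule N_mono)
        show "AE t in half_line. ennreal (W t) * h (a j * t) * indicator I t \<le> ennreal (K * q ^ Suc j) * ?g (power_map (a j) 1 t)"
        proof (rule AE_I2)
          fix t assume "t \<in> space half_line"
          then have t: "0 < t" by (simp add: space_half_line)
          have "1 \<le> a j" by (simp add: a_def del: power_Suc)
          then have "W t \<le> K * (t / (a j * t)) powr e * W (a j * t)" using t by (intro decay(3)) auto
          also have "(t / (a j * t)) powr e = q ^ Suc j" using aq[of j] t by simp
          finally have "ennreal (W t) \<le> ennreal (K * q ^ Suc j) * ennreal (W (a j * t))"
            using decay(1) q W[of "a j * t"] t a0[of j] by (subst ennreal_mult[symmetric]) (auto intro: ennreal_leI)
          then have "ennreal (W t) * h (a j * t) \<le> ennreal (K * q ^ Suc j) * ennreal (W (a j * t)) * h (a j * t)"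
            by (rule mult_right_mono) simp
          then show "ennreal (W t) * h (a j * t) * indicator I t \<le> ennreal (K * q ^ Suc j) * ?g (power_map (a j) 1 t)"
            using t by (auto simp: indicator_def power_map_def mult.assoc)
        qed
      qed measurable
      also have "\<dots> \<le> ennreal (K * q ^ Suc j) * N (\<lambda>t. ?g (power_map (a j) 1 t))"
        using decay(1) q by (intro N_cmult) auto
      also have "\<dots> \<le> ennreal (K * q ^ Suc j) * (ennreal (max 1 (1 / \<bar>1\<bar>)) * N ?g)"
        by (intro mult_left_mono N_power_map a0) auto
      finally show ?thesis by simp
    qed
    have "N (\<lambda>t. ennreal (W t) * (\<Sum>j. h (2 ^ Suc j * t)) * indicator I t)
        = N (\<lambda>t. (\<Sum>j. ennreal (W t) * h (a j * t)) * indicator I t)"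
      by (simp add: a_def)
    also have "\<dots> \<le> (\<Sum>j. N (\<lambda>t. ennreal (W t) * h (a j * t) * indicator I t))"
      using I N_suminf_unit_interval[OF gm] N_suminf_outer[OF gm] by auto
    also have "\<dots> \<le> (\<Sum>j. ennreal (K * q ^ Suc j) * N (\<lambda>t. ennreal (W t) * h t))" by (intro suminf_le summand) auto
    also have "\<dots> = (\<Sum>j. ennreal (K * q ^ Suc j)) * N (\<lambda>t. ennreal (W t) * h t)" by simp
    also have "(\<Sum>j. ennreal (K * q ^ Suc j)) = ennreal C"
      unfolding C_def using decay(1) q sq
      by (subst suminf_ennreal2) (auto simp: suminf_mult summable_mult simp del: power_Suc)
    finally show "N (\<lambda>t. ennreal (W t) * (\<Sum>j. h (2 ^ Suc j * t)) * indicator I t) \<le> ennreal C * N (\<lambda>t. ennreal (W t) * h t)" .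
  qed
qed

theorem max_rearr_bound_large_index:
  assumes idx: "\<theta> / k < lower_fund_index \<phi>"
  obtains C where "0 < C"
    "\<And>f. f \<in> L1_plus_Linf M \<Longrightarrow> vanishes_at_infinity M (absf f) \<Longrightarrow>
      N (\<lambda>t. ennreal (w n t) * Ms f t * indicator {0<..<1} t) + N (\<lambda>t. ennreal (w k t) * Ms f t * indicator {1<..} t)
      \<le> ennreal C * Bs f"
proof -
  have nk: "\<theta> / n \<le> \<theta> / k" using k_pos k_le_n \<theta>_pos by (intro divide_left_mono) auto
  obtain K1 e1 where 1: "0 < K1" "0 < e1" "\<And>s t. 0 < s \<Longrightarrow> s \<le> t \<Longrightarrow> w n s \<le> K1 * (s / t) powr e1 * w n t"
    using w_decay[OF n_pos nk idx] by blast
  obtain K2 e2 where 2: "0 < K2" "0 < e2" "\<And>s t. 0 < s \<Longrightarrow> s \<le> t \<Longrightarrow> w k s \<le> K2 * (s / t) powr e2 * w k t"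
    using w_decay[OF k_pos order_refl idx] by blast
  \<comment> \<open>A dyadic sum started at t < 1 crosses 1, where the two weights agree, so a
    single glued weight is used. Its decay across 1 is the product of the decay from s to 1 and that
    from 1 to t; hence a constant K that dominates K1, K2 and their product.\<close>
  define W where "W t = (if t \<le> 1 then w n t else w k t)" for t
  define K where "K = (K1 + 1) * (K2 + 1)"
  define e where "e = min e1 e2"
  have e: "0 < e" "e \<le> e1" "e \<le> e2" using 1 2 by (auto simp: e_def)
  have "0 < K1 * K2" "K = K1 * K2 + K1 + K2 + 1" using 1 2 by (auto simp: K_def algebra_simps)
  then have K: "0 < K" "K1 \<le> K" "K2 \<le> K" "K1 * K2 \<le> K" using 1(1) 2(1) by linarith+
  have W1: "w n 1 = w k 1" by (simp add: weight_def)
  have W0: "0 \<le> W t" if "0 < t" for t using w_pos[OF that] by (auto simp: W_def less_imp_le)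
  note wm [measurable] = w_measurable[OF n_pos] w_measurable[OF k_pos]
  have [measurable]: "(\<lambda>t. t) \<in> borel_measurable half_line" by (rule borel_measurable_half_line) simp
  have Wm [measurable]: "W \<in> borel_measurable half_line" unfolding W_def by measurable
  have step: "L * (s / t) powr e' * y \<le> K * (s / t) powr e * y"
    if "0 < s" "s \<le> t" "0 \<le> L" "L \<le> K" "e \<le> e'" "0 \<le> y" for L s t e' y
    using that K by (intro mult_right_mono mult_mono powr_mono') auto
  have decay: "W s \<le> K * (s / t) powr e * W t" if st: "0 < s" "s \<le> t" for s t
  proof -
    consider "t \<le> 1" | "1 < s" | "s \<le> 1" "1 < t" by linarith
    then show ?thesis
    proof cases
      case 1
      then have "W s \<le> K1 * (s / t) powr e1 * w n t" using \<open>0 < s\<close> \<open>s \<le> t\<close> by (simp add: W_def \<open>\<And>s t. 0 < s \<Longrightarrow> s \<le> t \<Longrightarrow> w n s \<le> K1 * (s / t) powr e1 * w n t\<close>)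
      also have "\<dots> \<le> K * (s / t) powr e * w n t"
        using st K e \<open>0 < K1\<close> w_pos[of t n] by (intro step) auto
      finally show ?thesis using 1 by (simp add: W_def)
    next
      case 2
      then have "W s \<le> K2 * (s / t) powr e2 * w k t" using st by (simp add: W_def \<open>\<And>s t. 0 < s \<Longrightarrow> s \<le> t \<Longrightarrow> w k s \<le> K2 * (s / t) powr e2 * w k t\<close>)
      also have "\<dots> \<le> K * (s / t) powr e * w k t"
        using st K e \<open>0 < K2\<close> w_pos[of t k] by (intro step) auto
      finally show ?thesis using 2 st by (simp add: W_def)
    next
      case 3
      have "w n s \<le> K1 * (s / 1) powr e1 * w n 1" using st 3 by (intro 1) auto
      also have "\<dots> \<le> K1 * s powr e * w n 1"
        using st 3 e \<open>0 < K1\<close> w_pos[of 1 n] by (intro mult_right_mono mult_left_mono) (auto intro: powr_mono')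
      also have "\<dots> \<le> K1 * s powr e * (K2 * (1 / t) powr e2 * w k t)"
        unfolding W1 using st 3 \<open>0 < K1\<close> by (intro mult_left_mono 2) auto
      also have "\<dots> \<le> K1 * s powr e * (K2 * (1 / t) powr e * w k t)"
        using st 3 e \<open>0 < K1\<close> \<open>0 < K2\<close> w_pos[of t k] by (intro mult_right_mono mult_left_mono powr_mono') auto
      also have "\<dots> = K1 * K2 * (s / t) powr e * w k t"
        using st 3 by (simp add: powr_divide)
      also have "\<dots> \<le> K * (s / t) powr e * w k t"
        using st 3 K e \<open>0 < K1\<close> \<open>0 < K2\<close> w_pos[of t k] by (intro step) auto
      finally show ?thesis using 3 by (simp add: W_def)
    qed
  qed
  obtain C where C: "0 < C" "\<And>h I. h \<in> borel_measurable half_line \<Longrightarrow> I = {0<..<1} \<or> I = {1<..} \<Longrightarrow>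
      N (\<lambda>t. ennreal (W t) * (\<Sum>j. h (2 ^ Suc j * t)) * indicator I t) \<le> ennreal C * N (\<lambda>t. ennreal (W t) * h t)"
    using geometric_dilation_sum[OF W0 Wm K(1) e(1) decay] by blast
  obtain C' where C': "0 < C'"
    "\<And>f. f \<in> L1_plus_Linf M \<Longrightarrow> N (\<lambda>t. ennreal (w n t) * Os f t * indicator {0<..<1} t) \<le> ennreal C' * Bs f"
    "\<And>f. f \<in> L1_plus_Linf M \<Longrightarrow> N (\<lambda>t. ennreal (w k t) * Os f t * indicator {1<..} t) \<le> ennreal C' * Bs f"
    by (rule weighted_osc_bound) blast
  show ?thesis
  proof (rule that)
    show "0 < 2 * (C * (2 * C'))" using C C' by simp
    fix f assume f: "f \<in> L1_plus_Linf M" and van: "vanishes_at_infinity M (absf f)"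
    note [measurable] = Os_measurable[OF f] Ms_measurable[OF f]
    have piece: "N (\<lambda>t. ennreal (v t) * Ms f t * indicator I t) \<le> ennreal C * N (\<lambda>t. ennreal (W t) * Os f t)"
      if I: "I = {0<..<1} \<or> I = {1<..}" and v: "\<And>t. t \<in> I \<Longrightarrow> v t = W t"
        and vm [measurable]: "v \<in> borel_measurable half_line" for v I
    proof -
      have [measurable]: "indicator I \<in> (half_line \<rightarrow>\<^sub>M (borel :: ennreal measure))" using I by auto
      have "N (\<lambda>t. ennreal (v t) * Ms f t * indicator I t) \<le> N (\<lambda>t. ennreal (W t) * (\<Sum>j. Os f (2 ^ Suc j * t)) * indicator I t)"
      proof (rule N_mono)
        show "AE t in half_line. ennreal (v t) * Ms f t * indicator I t \<le> ennreal (W t) * (\<Sum>j. Os f (2 ^ Suc j * t)) * indicator I t"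
          using v by (intro AE_I2) (auto simp: space_half_line indicator_def
            intro!: mult_left_mono max_rearr_le_suminf_osc[OF L1_LinfD(2,3)[OF f] van] simp del: power_Suc)
      qed measurable
      also have "\<dots> \<le> ennreal C * N (\<lambda>t. ennreal (W t) * Os f t)" using I by (intro C) auto
      finally show ?thesis .
    qed
    have "N (\<lambda>t. ennreal (W t) * Os f t)
        \<le> N (\<lambda>t. ennreal (w n t) * Os f t * indicator {0<..<1} t + ennreal (w k t) * Os f t * indicator {1<..} t)"
    proof (rule N_mono)
      have "AE t in lborel. t \<noteq> (1::real)" by (rule AE_lborel_singleton)
      then show "AE t in half_line. ennreal (W t) * Os f t
          \<le> ennreal (w n t) * Os f t * indicator {0<..<1} t + ennreal (w k t) * Os f t * indicator {1<..} t"
        unfolding AE_half_line_iff by eventually_elim (auto simp: W_def indicator_def)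
    qed measurable
    also have "\<dots> \<le> N (\<lambda>t. ennreal (w n t) * Os f t * indicator {0<..<1} t) + N (\<lambda>t. ennreal (w k t) * Os f t * indicator {1<..} t)"
      by (rule N_add) measurable
    also have "\<dots> \<le> ennreal C' * Bs f + ennreal C' * Bs f" by (intro add_mono C' f)
    also have "\<dots> = ennreal (2 * C') * Bs f" using C' by (intro ennreal_double) simp
    finally have "ennreal C * N (\<lambda>t. ennreal (W t) * Os f t) \<le> ennreal C * (ennreal (2 * C') * Bs f)"
      by (rule mult_left_mono) simp
    also have "\<dots> = ennreal (C * (2 * C')) * Bs f" using C C' by (simp add: ennreal_mult mult.assoc)
    finally have le: "ennreal C * N (\<lambda>t. ennreal (W t) * Os f t) \<le> ennreal (C * (2 * C')) * Bs f" .
    have "N (\<lambda>t. ennreal (w n t) * Ms f t * indicator {0<..<1} t) \<le> ennreal (C * (2 * C')) * Bs f"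
      by (rule order_trans[OF piece[OF _ _ wm(1)] le]) (simp_all add: W_def)
    moreover have "N (\<lambda>t. ennreal (w k t) * Ms f t * indicator {1<..} t) \<le> ennreal (C * (2 * C')) * Bs f"
      by (rule order_trans[OF piece[OF _ _ wm(2)] le]) (simp_all add: W_def)
    ultimately have "N (\<lambda>t. ennreal (w n t) * Ms f t * indicator {0<..<1} t) + N (\<lambda>t. ennreal (w k t) * Ms f t * indicator {1<..} t)
      \<le> ennreal (C * (2 * C')) * Bs f + ennreal (C * (2 * C')) * Bs f"
      by (rule add_mono)
    also have "\<dots> = ennreal (2 * (C * (2 * C'))) * Bs f" using C C' by (intro ennreal_double) simp
    finally show "N (\<lambda>t. ennreal (w n t) * Ms f t * indicator {0<..<1} t) + N (\<lambda>t. ennreal (w k t) * Ms f t * indicator {1<..} t)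
      \<le> ennreal (2 * (C * (2 * C'))) * Bs f" .
  qed
qed

text \<open>The hypothesis gives decay for the weight with n only, so the dyadic sum stays inside
  the unit interval and the oscillation is cut off there. The leftover, w(t) times twice the norm in
  L1 + Linf, has finite norm because w(t) <= K t^e w(1).\<close>

theorem max_rearr_bound_middle_index:
  assumes idx: "\<theta> / n < lower_fund_index \<phi>"
  obtains C where "0 < C"
    "\<And>f. f \<in> L1_plus_Linf M \<Longrightarrow>
      N (\<lambda>t. ennreal (w n t) * Ms f t * indicator {0<..<1} t) \<le> ennreal C * (Bs f + nrm f)"
proof -
  obtain K e where K: "0 < K" "0 < e" and decay: "\<And>s t. 0 < s \<Longrightarrow> s \<le> t \<Longrightarrow> w n s \<le> K * (s / t) powr e * w n t"
    using w_decay[OF n_pos order_refl idx] by blast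
  have W0: "0 \<le> w n t" if "0 < t" for t using w_pos[OF that] by (auto simp: less_imp_le)
  have Wm [measurable]: "w n \<in> borel_measurable half_line" by (rule w_measurable[OF n_pos])
  obtain C where C: "0 < C" "\<And>h I. h \<in> borel_measurable half_line \<Longrightarrow> I = {0<..<1} \<or> I = {1<..} \<Longrightarrow>
      N (\<lambda>t. ennreal (w n t) * (\<Sum>j. h (2 ^ Suc j * t)) * indicator I t) \<le> ennreal C * N (\<lambda>t. ennreal (w n t) * h t)"
    using geometric_dilation_sum[OF W0 Wm K decay] by blast
  obtain C' where C': "0 < C'"
    "\<And>f. f \<in> L1_plus_Linf M \<Longrightarrow> N (\<lambda>t. ennreal (w n t) * Os f t * indicator {0<..<1} t) \<le> ennreal C' * Bs f"
    by (rule weighted_osc_bound) blast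
  obtain P where P: "N (\<lambda>t. ennreal (t powr e) * indicator {0<..<1} t) = ennreal P" "0 \<le> P"
    using N_powr_unit_finite[OF K(2)] by (cases "N (\<lambda>t. ennreal (t powr e) * indicator {0<..<1} t)") auto
  define c where "c = 2 * (K * w n 1 * P)"
  have c0: "0 \<le> c" using K P W0[of 1] by (simp add: c_def)
  show ?thesis
  proof (rule that)
    show "0 < C * C' + c" using C C' c0 by (simp add: add_pos_nonneg)
    fix f assume f: "f \<in> L1_plus_Linf M"
    note [measurable] = Os_measurable[OF f] Ms_measurable[OF f]
    obtain z where z: "nrm f = ennreal z" "0 \<le> z" using L1_LinfD(3)[OF f] by (cases "nrm f") auto
    define h where "h t = Os f t * indicator {0<..<1} t" for t
    have hm [measurable]: "h \<in> borel_measurable half_line" unfolding h_def by measurable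
    have pt: "Ms f t \<le> 2 * nrm f + (\<Sum>j. h (2 ^ Suc j * t))" if t: "0 < t" "t < 1" for t
    proof -
      obtain J where J: "2 ^ J * t < 1" "Ms f t \<le> 2 * nrm f + (\<Sum>j=1..J. Os f (2 ^ j * t))"
        using max_rearr_le_unit_scale[OF L1_LinfD(2,3)[OF f] t] by blast
      have "(\<Sum>j=1..J. Os f (2 ^ j * t)) = (\<Sum>j=1..J. h (2 ^ j * t))"
      proof (intro sum.cong refl)
        fix j assume "j \<in> {1..J}"
        then have "(2::real) ^ j * t \<le> 2 ^ J * t" using t by (intro mult_right_mono power_increasing) auto
        then have "2 ^ j * t < 1" using J(1) by (rule le_less_trans)
        moreover have "0 < 2 ^ j * t" using t by simp
        ultimately show "Os f (2 ^ j * t) = h (2 ^ j * t)" by (simp add: h_def)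
      qed
      also have "\<dots> = (\<Sum>j<J. h (2 ^ Suc j * t))"
        using sum.atLeast1_atMost_eq[of "\<lambda>j. h (2 ^ j * t)" J] by simp
      also have "\<dots> \<le> (\<Sum>j. h (2 ^ Suc j * t))" by (intro sum_le_suminf) auto
      finally show ?thesis using J(2) add_left_mono order_trans by blast
    qed
    have [measurable]: "(\<lambda>t. h (2 ^ Suc j * t)) \<in> borel_measurable half_line" for j
    proof -
      have "power_map (2 ^ Suc j) 1 \<in> measurable half_line half_line" by (rule power_map_measurable) auto
      then have "(\<lambda>t. (2::real) ^ Suc j * t) \<in> measurable half_line half_line"
        by (rule measurable_cong[THEN iffD1, rotated]) (auto simp: power_map_def space_half_line)
      then show ?thesis by measurable
    qed
    have [measurable]: "(\<lambda>t. ennreal (t powr e)) \<in> borel_measurable half_line"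
      by (rule borel_measurable_half_line) measurable
    let ?a = "\<lambda>t. ennreal (2 * z * (K * w n 1)) * (ennreal (t powr e) * indicator {0<..<1} t)"
    let ?b = "\<lambda>t. ennreal (w n t) * (\<Sum>j. h (2 ^ Suc j * t)) * indicator {0<..<1} t"
    have "N (\<lambda>t. ennreal (w n t) * Ms f t * indicator {0<..<1} t) \<le> N (\<lambda>t. ?a t + ?b t)"
    proof (rule N_mono)
      show "AE t in half_line. ennreal (w n t) * Ms f t * indicator {0<..<1} t \<le> ?a t + ?b t"
      proof (rule AE_I2)
        fix t assume "t \<in> space half_line"
        then have t0: "0 < t" by (simp add: space_half_line)
        show "ennreal (w n t) * Ms f t * indicator {0<..<1} t \<le> ?a t + ?b t"
        proof (cases "t < 1")
          case True
          have "w n t \<le> K * (t / 1) powr e * w n 1" using t0 True by (intro decay) auto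
          then have wt: "ennreal (w n t) \<le> ennreal (K * w n 1) * ennreal (t powr e)"
            using K W0[of 1] by (subst ennreal_mult[symmetric]) (auto intro!: ennreal_leI simp: ac_simps)
          have "ennreal (w n t) * Ms f t \<le> ennreal (w n t) * (2 * nrm f + (\<Sum>j. h (2 ^ Suc j * t)))"
            by (intro mult_left_mono pt t0 True) simp
          also have "\<dots> = ennreal (w n t) * (2 * nrm f) + ennreal (w n t) * (\<Sum>j. h (2 ^ Suc j * t))"
            by (rule distrib_left)
          also have "ennreal (w n t) * (2 * nrm f) \<le> (ennreal (K * w n 1) * ennreal (t powr e)) * (2 * nrm f)"
            by (intro mult_right_mono wt) simp
          also have "\<dots> = ennreal (2 * z * (K * w n 1)) * ennreal (t powr e)"
            using z K W0[of 1] by (simp add: ennreal_mult ac_simps)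
          finally have "ennreal (w n t) * Ms f t \<le> ennreal (2 * z * (K * w n 1)) * ennreal (t powr e) + ennreal (w n t) * (\<Sum>j. h (2 ^ Suc j * t))"
            by (simp add: add_right_mono)
          then show ?thesis using t0 True by simp
        qed simp
      qed
    qed measurable
    also have "\<dots> \<le> N ?a + N ?b" by (rule N_add) measurable
    also have "N ?a \<le> ennreal (2 * z * (K * w n 1)) * N (\<lambda>t. ennreal (t powr e) * indicator {0<..<1} t)"
      using z K W0[of 1] by (intro N_cmult) auto
    also have "\<dots> = ennreal c * nrm f" using z K W0[of 1] P by (simp add: c_def ennreal_mult[symmetric] ac_simps)
    also have "N ?b \<le> ennreal C * N (\<lambda>t. ennreal (w n t) * h t)" by (rule C) auto
    also have "N (\<lambda>t. ennreal (w n t) * h t) = N (\<lambda>t. ennreal (w n t) * Os f t * indicator {0<..<1} t)"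
      by (simp add: h_def mult.assoc)
    also have "ennreal C * \<dots> \<le> ennreal C * (ennreal C' * Bs f)" by (intro mult_left_mono C' f) simp
    also have "\<dots> = ennreal (C * C') * Bs f" using C C' by (simp add: ennreal_mult mult.assoc)
    finally have "N (\<lambda>t. ennreal (w n t) * Ms f t * indicator {0<..<1} t) \<le> ennreal c * nrm f + ennreal (C * C') * Bs f"
      by (simp add: add_mono)
    also have "\<dots> \<le> ennreal (C * C' + c) * nrm f + ennreal (C * C' + c) * Bs f"
      using c0 C C' by (intro add_mono mult_right_mono ennreal_leI) auto
    also have "\<dots> = ennreal (C * C' + c) * (Bs f + nrm f)" by (simp add: distrib_left add.commute)
    finally show "N (\<lambda>t. ennreal (w n t) * Ms f t * indicator {0<..<1} t) \<le> ennreal (C * C' + c) * (Bs f + nrm f)" .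
  qed
qed

text \<open>The pairing bounds f**(t) by one R for all t in (0, 1). Since f*(t) <= R for all such t,
  the set where |f| > R has measure at most every such t, hence 0.\<close>

theorem esssup_bound:
  assumes K: "0 < K" and dual: "\<And>h. h \<in> borel_measurable half_line \<Longrightarrow>
    (\<integral>\<^sup>+ t. ennreal (1 / w n t) * indicator {0<..<1} t * h t \<partial>log_measure) \<le> ennreal K * N h"
  obtains C where "0 < C"
    "\<And>f. f \<in> L1_plus_Linf M \<Longrightarrow> esssup M (absf f) \<le> ennreal C * (Bs f + nrm f)"
proof -
  obtain C' where C': "0 < C'"
    "\<And>f. f \<in> L1_plus_Linf M \<Longrightarrow> N (\<lambda>t. ennreal (w n t) * Os f t * indicator {0<..<1} t) \<le> ennreal C' * Bs f"
    by (rule weighted_osc_bound) blast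
  \<comment> \<open>The 4 counts the norm in L1 + Linf twice for stopping at the unit scale and
    twice for the last oscillation; 4 K C' comes from the dyadic sum, whose constant is 2 c with c =
    2 by \<open>osc_le_double\<close>.\<close>
  define C where "C = 4 + 4 * (K * C')"
  show ?thesis
  proof (rule that)
    show "0 < C" using K C' by (simp add: C_def add_pos_pos)
    fix f assume f: "f \<in> L1_plus_Linf M"
    note [measurable] = Os_measurable[OF f] Ms_measurable[OF f] L1_LinfD(1)[OF f]
    note fm = L1_LinfD(2,3)[OF f]
    define R where "R = ennreal C * (Bs f + nrm f)"
    have int: "(\<integral>\<^sup>+ s. Os f s * indicator {0<..<1} s \<partial>log_measure) \<le> ennreal (K * C') * Bs f"
    proof -
      have "(\<integral>\<^sup>+ s. Os f s * indicator {0<..<1} s \<partial>log_measure)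
          = (\<integral>\<^sup>+ t. ennreal (1 / w n t) * indicator {0<..<1} t * (ennreal (w n t) * Os f t * indicator {0<..<1} t) \<partial>log_measure)"
      proof (intro nn_integral_cong)
        fix t assume "t \<in> space log_measure"
        then have "0 < w n t" by (intro w_pos) (simp add: space_log_measure)
        then have "ennreal (1 / w n t) * (ennreal (w n t) * Os f t) = Os f t"
          by (simp add: mult.assoc[symmetric] ennreal_mult[symmetric])
        then show "Os f t * indicator {0<..<1} t
            = ennreal (1 / w n t) * indicator {0<..<1} t * (ennreal (w n t) * Os f t * indicator {0<..<1} t)"
          by (auto simp: indicator_def)
      qed
      also have "\<dots> \<le> ennreal K * N (\<lambda>t. ennreal (w n t) * Os f t * indicator {0<..<1} t)"
        using n_pos by (intro dual) measurable
      also have "\<dots> \<le> ennreal K * (ennreal C' * Bs f)" by (intro mult_left_mono C' f) simp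
      also have "\<dots> = ennreal (K * C') * Bs f" using K C' by (simp add: ennreal_mult mult.assoc)
      finally show ?thesis .
    qed
    have bound: "Ms f t \<le> R" if t: "0 < t" "t < 1" for t
    proof -
      obtain J where J: "2 ^ J * t < 1" "1 / 2 \<le> 2 ^ J * t" "Ms f (2 ^ J * t) \<le> 2 * nrm f"
          "Ms f t \<le> 2 * nrm f + (\<Sum>j=1..J. Os f (2 ^ j * t))"
        using max_rearr_le_unit_scale[OF fm t] by blast
      have sum: "(\<Sum>j=1..J. Os f (2 ^ j * t)) \<le> 2 * nrm f + ennreal (4 * (K * C')) * Bs f"
      proof (cases J)
        case (Suc i)
        \<comment> \<open>The last term is bounded by f** at the same point, because the dyadic
          interval starting at 2^J t reaches beyond 1, out of the range of the integral.\<close>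
        have "Os f (2 ^ J * t) \<le> 2 * nrm f" using J(3) osc_le_max_rearr order_trans by blast
        moreover have "(\<Sum>j=1..i. Os f (2 ^ j * t)) \<le> ennreal (2 * 2) * (\<integral>\<^sup>+ s. Os f s * indicator {2 * t..<2 ^ Suc i * t} s \<partial>log_measure)"
          using osc_le_double[OF fm] t by (intro dyadic_sum_le_integral) auto
        moreover have "\<dots> \<le> ennreal (2 * 2) * (\<integral>\<^sup>+ s. Os f s * indicator {0<..<1} s \<partial>log_measure)"
          using J(1) t Suc by (intro mult_left_mono nn_integral_mono) (auto simp: indicator_def)
        moreover have "\<dots> \<le> ennreal (2 * 2) * (ennreal (K * C') * Bs f)" by (intro mult_left_mono int) simp
        moreover have "\<dots> = ennreal (4 * (K * C')) * Bs f" using K C' by (simp add: ennreal_mult mult.assoc)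
        ultimately have "(\<Sum>j=1..i. Os f (2 ^ j * t)) + Os f (2 ^ J * t) \<le> ennreal (4 * (K * C')) * Bs f + 2 * nrm f"
          by (intro add_mono) order+
        then show ?thesis using Suc by (simp add: add.commute)
      qed simp
      have "Ms f t \<le> 2 * nrm f + (2 * nrm f + ennreal (4 * (K * C')) * Bs f)"
        using J(4) sum add_left_mono order_trans by blast
      also have "\<dots> = ennreal 4 * nrm f + ennreal (4 * (K * C')) * Bs f"
        by (simp add: add.assoc[symmetric] distrib_right[symmetric])
      also have "\<dots> \<le> ennreal C * nrm f + ennreal C * Bs f"
        unfolding C_def using K C' by (intro add_mono mult_right_mono ennreal_leI) auto
      also have "\<dots> = R" by (simp add: R_def distrib_left add.commute)
      finally show ?thesis .
    qed
    have "emeasure M {x \<in> space M. R < absf f x} \<le> 0"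
    proof (rule ennreal_le_epsilon)
      fix e :: real assume e: "0 < e"
      define t where "t = min e (1 / 2)"
      have t: "0 < t" "t < 1" using e by (auto simp: t_def)
      have "rearr M (absf f) t \<le> R" using rearr_le_max_rearr[OF fm t(1)] bound[OF t] by (rule order_trans)
      then have "emeasure M {x \<in> space M. R < absf f x} \<le> ennreal t"
        using less_rearr_iff[OF fm(1), of R t] by (simp add: not_less[symmetric])
      also have "\<dots> \<le> ennreal e" by (intro ennreal_leI) (simp add: t_def)
      finally show "emeasure M {x \<in> space M. R < absf f x} \<le> 0 + ennreal e" by simp
    qed
    then have null: "emeasure M {x \<in> space M. R < absf f x} = 0" by simp
    have "AE x in M. absf f x \<le> R"
    proof (rule AE_I[OF _ null])
      show "{x \<in> space M. R < absf f x} \<in> sets M" using fm(1) by measurable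
    qed (auto simp: not_le)
    then show "esssup M (absf f) \<le> ennreal C * (Bs f + nrm f)"
      unfolding R_def by (intro esssup_I) auto
  qed
qed

end

section \<open>The limiting cases\<close>

lemma sigma_finite_half_line: "sigma_finite_measure half_line"
proof
  let ?A = "range (\<lambda>i::nat. {0<..<real i})"
  have "\<Union>?A = {0<..}"
  proof (intro equalityI subsetI)
    fix y :: real assume y: "y \<in> {0<..}"
    obtain i :: nat where "y < real i" using reals_Archimedean2 by blast
    then show "y \<in> \<Union>?A" using y by auto
  qed auto
  moreover have "emeasure half_line {0<..<real i} \<noteq> \<infinity>" for i
    by (subst emeasure_restrict_space) (auto simp: emeasure_completion)
  moreover have "{0<..<real i} \<in> sets half_line" for i
    by (auto simp: sets_restrict_space_iff)
  ultimately show "\<exists>A. countable A \<and> A \<subseteq> sets half_line \<and> \<Union>A = space half_line \<and> (\<forall>a\<in>A. emeasure half_line a \<noteq> \<infinity>)"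
    by (intro exI[of _ ?A]) (auto simp: space_half_line)
qed

lemma emeasure_half_line_interval: "0 \<le> u \<Longrightarrow> emeasure half_line {0<..<u} = ennreal u"
  by (subst emeasure_restrict_space) (auto simp: emeasure_completion)

lemma sets_half_line_interval: "{0<..<u} \<in> sets half_line"
  by (auto simp: sets_restrict_space_iff)

lemma ennreal_divide_real: "0 < u \<Longrightarrow> x / ennreal u = ennreal (1 / u) * x"
  by (simp add: divide_ennreal_def inverse_ennreal inverse_eq_divide mult.commute)

context interpolation_parameter
begin

text \<open>Hoelder's inequality by normalisation. As N h may be 0 while the supremum runs over the
  unit ball, h is divided by a number c slightly above N h.\<close>

lemma assoc_norm_duality:
  assumes g: "g \<in> borel_measurable half_line" and fin: "assoc_norm N g < \<infinity>"
  obtains K where "0 < K" "\<And>h. h \<in> borel_measurable half_line \<Longrightarrow> (\<integral>\<^sup>+ t. g t * h t \<partial>log_measure) \<le> ennreal K * N h"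
proof -
  obtain A where A: "assoc_norm N g = ennreal A" "0 \<le> A" using fin by (cases "assoc_norm N g") auto
  show ?thesis
  proof (rule that)
    show "0 < A + 1" using A by simp
    fix h :: "real \<Rightarrow> ennreal" assume h: "h \<in> borel_measurable half_line"
    have [measurable]: "h \<in> borel_measurable log_measure" "g \<in> borel_measurable log_measure" using g h by simp_all
    show "(\<integral>\<^sup>+ t. g t * h t \<partial>log_measure) \<le> ennreal (A + 1) * N h"
    proof (cases "N h < \<infinity>")
      case True
      then obtain \<nu> where \<nu>: "N h = ennreal \<nu>" "0 \<le> \<nu>" by (cases "N h") auto
      show ?thesis
      proof (rule ennreal_le_epsilon)
        fix e :: real assume e: "0 < e"
        \<comment> \<open>The excess over N h is chosen so that A times it is at most e.\<close>
        define c where "c = \<nu> + e / (A + 1)"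
        have c: "0 < c" using e A \<nu> by (simp add: c_def add_nonneg_pos)
        have "N (\<lambda>t. ennreal (1 / c) * h t) \<le> ennreal (1 / c) * N h" using c by (intro N_cmult) simp
        also have "\<dots> = ennreal (\<nu> / c)" using c \<nu> by (simp add: ennreal_mult[symmetric])
        also have "\<dots> \<le> 1" using c e A by (auto simp: c_def field_simps)
        finally have "(\<integral>\<^sup>+ t. g t * (ennreal (1 / c) * h t) \<partial>log_measure) \<le> assoc_norm N g"
          unfolding assoc_norm_def by (intro SUP_upper2[of "\<lambda>t. ennreal (1 / c) * h t"]) auto
        then have "ennreal (1 / c) * (\<integral>\<^sup>+ t. g t * h t \<partial>log_measure) \<le> ennreal A"
          by (simp add: A nn_integral_cmult[symmetric] mult.left_commute)
        then have "ennreal c * (ennreal (1 / c) * (\<integral>\<^sup>+ t. g t * h t \<partial>log_measure)) \<le> ennreal c * ennreal A"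
          by (rule mult_left_mono) simp
        also have "\<dots> = ennreal (c * A)" using c A by (intro ennreal_mult[symmetric]) auto
        also have "\<dots> \<le> ennreal ((A + 1) * \<nu> + e)"
        proof (rule ennreal_leI)
          have "e / (A + 1) * A \<le> e" using e A by (simp add: field_simps)
          then show "c * A \<le> (A + 1) * \<nu> + e" using \<nu> by (simp add: c_def algebra_simps)
        qed
        also have "\<dots> = ennreal (A + 1) * N h + ennreal e" using A \<nu> e by (simp add: ennreal_mult)
        finally show "(\<integral>\<^sup>+ t. g t * h t \<partial>log_measure) \<le> ennreal (A + 1) * N h + ennreal e"
          using c by (simp add: mult.assoc[symmetric] ennreal_mult[symmetric])
      qed
    qed (use A in \<open>simp add: not_less top_unique ennreal_mult_top\<close>)
  qed
qed

end

context besov_setting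
begin

text \<open>Quasi-monotonicity lets the weight pass to the larger argument 2^j t, so w(t) f**(t) is
  bounded by a multiple of the norm in L1 + Linf plus a multiple of the integral of w O over (t, 1)
  for ds/s. With t = exp (-u) the factor 1 + |ln t| is 1 + u, the integral is at most u G**(u), and
  Hardy's inequality on E applies.\<close>

theorem max_rearr_bound_logarithmic:
  assumes qi: "quasi_increasing_on {0<..} (w n)" and boyd: "upper_boyd_index E < 1"
  obtains C where "0 < C"
    "\<And>f. f \<in> L1_plus_Linf M \<Longrightarrow>
      N (\<lambda>t. ennreal (w n t / (1 + \<bar>ln t\<bar>)) * Ms f t * indicator {0<..<1} t) \<le> ennreal C * (Bs f + nrm f)"
proof -
  obtain C1 where C1: "0 < C1" "\<And>s t. s \<in> {0<..} \<Longrightarrow> t \<in> {0<..} \<Longrightarrow> s \<le> t \<Longrightarrow> w n s \<le> C1 * w n t"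
    using qi by (rule quasi_increasing_onD) blast
  obtain K where K: "0 < K" "\<And>g. g \<in> borel_measurable half_line \<Longrightarrow> E (max_rearr half_line g) \<le> ennreal K * E g"
    using boyd by (rule E_hardy) blast
  obtain C' where C': "0 < C'"
    "\<And>f. f \<in> L1_plus_Linf M \<Longrightarrow> N (\<lambda>t. ennreal (w n t) * Os f t * indicator {0<..<1} t) \<le> ennreal C' * Bs f"
    by (rule weighted_osc_bound) blast
  \<comment> \<open>The constant term leads to the function 1/(1 + u), and Hardy's inequality places
    it in E too: it lies below min u 1 / u, the maximal average of the indicator of (0, 1).\<close>
  define \<eta> :: "real \<Rightarrow> ennreal" where "\<eta> = indicator {0<..<1}"
  have \<eta>m [measurable]: "\<eta> \<in> borel_measurable half_line" unfolding \<eta>_def by measurable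
  have "E \<eta> < \<infinity>" unfolding \<eta>_def
    by (intro E_indicator sets_half_line_interval) (simp add: emeasure_half_line_interval)
  then obtain e0 where e0: "E \<eta> = ennreal e0" "0 \<le> e0" by (cases "E \<eta>") auto
  have \<eta>_ge: "ennreal (1 / (1 + u)) \<le> max_rearr half_line \<eta> u" if u: "0 < u" for u
  proof -
    have "ennreal (min u 1) = (\<integral>\<^sup>+ s\<in>{0<..<min u 1}. 1 \<partial>lborel)" using u by simp
    also have "\<dots> \<le> rearr_int half_line \<eta> u"
      unfolding rearr_int_def
    proof (intro nn_integral_mono)
      fix s
      show "1 * indicator {0<..<min u 1} s \<le> rearr half_line \<eta> s * indicator {0<..<u} s"
      proof (cases "s \<in> {0<..<min u 1}")
        case True
        then have "1 \<le> rearr half_line \<eta> s" unfolding \<eta>_def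
          by (intro rearr_indicator_ge_1 sets_half_line_interval)
            (simp add: emeasure_half_line_interval ennreal_less_iff del: ennreal_1 flip: ennreal_1)
        then show ?thesis using True by simp
      qed simp
    qed
    finally have "ennreal (min u 1) / ennreal u \<le> max_rearr half_line \<eta> u"
      unfolding max_rearr_eq by (rule divide_right_mono_ennreal)
    moreover have "ennreal (min u 1) / ennreal u = ennreal (min u 1 / u)" using u by (intro divide_ennreal) auto
    moreover have "1 / (1 + u) \<le> min u 1 / u" using u by (auto simp: min_def field_simps)
    ultimately show ?thesis by (metis ennreal_leI order_trans)
  qed
  define w1 where "w1 = w n 1"
  have w1: "0 < w1" unfolding w1_def by (rule w_pos) simp
  \<comment> \<open>The norm in L1 + Linf occurs with 2 C1 w1 from stopping at the unit scale and,
    after the weight has moved at the cost C1, with 2 C1 w1 from the last dyadic term. In c4 the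
    factor C1 is the same move, and the rest is the constant of the dyadic sum.\<close>
  define c3 where "c3 = 2 * (C1 * w1) + C1 * (2 * (C1 * w1))"
  define c4 where "c4 = C1 * (2 * (C1 * 2))"
  have c34: "0 < c3" "0 < c4" using C1 w1 by (auto simp: c3_def c4_def intro!: add_pos_pos)
  define C where "C = c3 * K * e0 + c4 * K * C'"
  show ?thesis
  proof (rule that)
    show "0 < C" unfolding C_def using c34 K e0 C' by (intro add_nonneg_pos mult_pos_pos mult_nonneg_nonneg) auto
    fix f assume f: "f \<in> L1_plus_Linf M"
    note [measurable] = Os_measurable[OF f] Ms_measurable[OF f] w_measurable[OF n_pos]
    note fm = L1_LinfD(2,3)[OF f]
    define g where "g t = ennreal (w n t) * Os f t" for t
    have gm [measurable]: "g \<in> borel_measurable half_line" unfolding g_def by measurable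
    define G where "G v = g (exp (- v))" for v
    have Gm [measurable]: "G \<in> borel_measurable half_line"
      using measurable_comp[OF exp_map_measurable gm] by (simp add: G_def[abs_def] comp_def)
    have w_le: "ennreal (w n s) \<le> ennreal C1 * ennreal (w n t)" if "0 < s" "s \<le> t" for s t
      using C1(2)[of s t] C1(1) that w_pos[of t n] by (subst ennreal_mult[symmetric]) (auto intro: ennreal_leI)
    have g_le: "g a \<le> ennreal (C1 * 2) * g s" if "0 < a" "a \<le> s" "s \<le> 2 * a" for a s
    proof -
      have "g a \<le> (ennreal C1 * ennreal (w n s)) * (2 * Os f s)"
        unfolding g_def using that by (intro mult_mono w_le osc_le_double[OF fm]) auto
      then show ?thesis using C1 by (simp add: g_def ennreal_mult ac_simps)
    qed
    have pt: "ennreal (w n t) * Ms f t \<le> ennreal c3 * nrm f + ennreal c4 * (\<integral>\<^sup>+ s. g s * indicator {t<..<1} s \<partial>log_measure)"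
      if t: "0 < t" "t < 1" for t
    proof -
      let ?I = "\<integral>\<^sup>+ s. g s * indicator {t<..<1} s \<partial>log_measure"
      obtain J where J: "2 ^ J * t < 1" "1 / 2 \<le> 2 ^ J * t" "Ms f (2 ^ J * t) \<le> 2 * nrm f"
          "Ms f t \<le> 2 * nrm f + (\<Sum>j=1..J. Os f (2 ^ j * t))"
        using max_rearr_le_unit_scale[OF fm t] by blast
      have wt1: "ennreal (w n s) \<le> ennreal (C1 * w1)" if "0 < s" "s < 1" for s
        using w_le[of s 1] that C1 w1 by (simp add: w1_def ennreal_mult)
      have sum: "(\<Sum>j=1..J. g (2 ^ j * t)) \<le> ennreal (2 * (C1 * 2)) * ?I + ennreal (2 * (C1 * w1)) * nrm f"
      proof (cases J)
        case (Suc i)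
        have last: "g (2 ^ J * t) \<le> ennreal (C1 * w1) * (2 * nrm f)"
          unfolding g_def using J t osc_le_max_rearr[of M "absf f" "2 ^ J * t"]
          by (intro mult_mono wt1) (auto intro: order_trans)
        have first: "(\<Sum>j=1..i. g (2 ^ j * t)) \<le> ennreal (2 * (C1 * 2)) * ?I"
        proof -
          have "(\<Sum>j=1..i. g (2 ^ j * t)) \<le> ennreal (2 * (C1 * 2)) * (\<integral>\<^sup>+ s. g s * indicator {2 * t..<2 ^ Suc i * t} s \<partial>log_measure)"
            using C1 by (intro dyadic_sum_le_integral gm t g_le) auto
          also have "\<dots> \<le> ennreal (2 * (C1 * 2)) * ?I"
            using J(1) t Suc by (intro mult_left_mono nn_integral_mono) (auto simp: indicator_def)
          finally show ?thesis .
        qed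
        have "(\<Sum>j=1..J. g (2 ^ j * t)) = (\<Sum>j=1..i. g (2 ^ j * t)) + g (2 ^ J * t)" using Suc by simp
        also have "\<dots> \<le> ennreal (2 * (C1 * 2)) * ?I + ennreal (C1 * w1) * (2 * nrm f)"
          using first last by (rule add_mono)
        also have "ennreal (C1 * w1) * (2 * nrm f) = ennreal (2 * (C1 * w1)) * nrm f"
          using C1 w1 by (simp add: ennreal_mult ac_simps)
        finally show ?thesis .
      qed simp
      have "ennreal (w n t) * Ms f t \<le> ennreal (w n t) * (2 * nrm f + (\<Sum>j=1..J. Os f (2 ^ j * t)))"
        by (intro mult_left_mono J) simp
      also have "\<dots> = ennreal (w n t) * (2 * nrm f) + (\<Sum>j=1..J. ennreal (w n t) * Os f (2 ^ j * t))"
        by (simp add: distrib_left sum_distrib_left)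
      also have "\<dots> \<le> ennreal (C1 * w1) * (2 * nrm f) + (\<Sum>j=1..J. ennreal C1 * g (2 ^ j * t))"
      proof (intro add_mono mult_right_mono wt1 t sum_mono)
        fix j
        have "t * 1 \<le> t * 2 ^ j" using t by (intro mult_left_mono) auto
        then have "ennreal (w n t) * Os f (2 ^ j * t) \<le> (ennreal C1 * ennreal (w n (2 ^ j * t))) * Os f (2 ^ j * t)"
          using t by (intro mult_right_mono w_le) (auto simp: mult.commute)
        then show "ennreal (w n t) * Os f (2 ^ j * t) \<le> ennreal C1 * g (2 ^ j * t)" by (simp add: g_def mult.assoc)
      qed simp
      also have "\<dots> = ennreal (2 * (C1 * w1)) * nrm f + ennreal C1 * (\<Sum>j=1..J. g (2 ^ j * t))"
        using C1 w1 by (simp add: ennreal_mult sum_distrib_left ac_simps)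
      also have "\<dots> \<le> ennreal (2 * (C1 * w1)) * nrm f + ennreal C1 * (ennreal (2 * (C1 * 2)) * ?I + ennreal (2 * (C1 * w1)) * nrm f)"
        by (intro add_left_mono mult_left_mono sum) simp
      also have "\<dots> = ennreal c3 * nrm f + ennreal c4 * ?I"
      proof -
        have "ennreal c3 = ennreal (2 * (C1 * w1)) + ennreal C1 * ennreal (2 * (C1 * w1))"
          unfolding c3_def using C1 w1 by (subst ennreal_plus) (auto simp: ennreal_mult)
        moreover have "ennreal c4 = ennreal C1 * ennreal (2 * (C1 * 2))"
          unfolding c4_def using C1 by (intro ennreal_mult) auto
        ultimately show ?thesis by (simp only: distrib_left distrib_right ac_simps)
      qed
      finally show ?thesis .
    qed
    \<comment> \<open>G need not be decreasing; Hardy-Littlewood replaces its integral over (0, u)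
      by that of its rearrangement, to which the Hardy bound refers.\<close>
    have I: "(\<integral>\<^sup>+ s. g s * indicator {exp (- u)<..<1} s \<partial>log_measure) \<le> rearr_int half_line G u" if u: "0 < u" for u
    proof -
      have "(\<integral>\<^sup>+ s. g s * indicator {exp (- u)<..<1} s \<partial>log_measure)
          = (\<integral>\<^sup>+ s. (g s * indicator {exp (- u)<..} s) * indicator {0<..<1} s \<partial>log_measure)"
        by (intro nn_integral_cong) (auto simp: indicator_def space_log_measure)
      also have "\<dots> = (\<integral>\<^sup>+ v. g (exp (- v)) * indicator {exp (- u)<..} (exp (- v)) \<partial>half_line)"
        by (rule exp_map_integral[symmetric]) measurable
      also have "\<dots> = (\<integral>\<^sup>+ v\<in>{0<..<u}. G v \<partial>half_line)"
        by (intro nn_integral_cong) (auto simp: G_def indicator_def space_half_line)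
      also have "\<dots> \<le> rearr_int half_line G u"
        using u by (intro hardy_littlewood_set sigma_finite_half_line sets_half_line_interval)
          (auto simp: emeasure_half_line_interval)
      finally show ?thesis .
    qed
    obtain z where z: "nrm f = ennreal z" "0 \<le> z" using fm(2) by (cases "nrm f") auto
    have [measurable]: "max_rearr half_line \<eta> \<in> borel_measurable half_line" "max_rearr half_line G \<in> borel_measurable half_line"
      by (rule borel_measurable_half_line, rule max_rearr_measurable, measurable)+
    let ?H = "\<lambda>t. ennreal (w n t / (1 + \<bar>ln t\<bar>)) * Ms f t"
    have [measurable]: "(\<lambda>t. ln t) \<in> borel_measurable half_line" by (rule borel_measurable_half_line) simp
    have Hm [measurable]: "?H \<in> borel_measurable half_line" by measurable
    have Hexp [measurable]: "(\<lambda>u. ?H (exp (- u))) \<in> borel_measurable half_line"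
      using measurable_comp[OF exp_map_measurable Hm] by (simp add: comp_def)
    have "N (\<lambda>t. ?H t * indicator {0<..<1} t) = E (\<lambda>u. ?H (exp (- u)))" by (rule N_unit_interval[OF Hm])
    also have "\<dots> \<le> E (\<lambda>u. ennreal (c3 * z) * max_rearr half_line \<eta> u + ennreal c4 * max_rearr half_line G u)"
    proof (rule E_mono[OF Hexp])
      show "AE u in half_line. ?H (exp (- u)) \<le> ennreal (c3 * z) * max_rearr half_line \<eta> u + ennreal c4 * max_rearr half_line G u"
      proof (rule AE_I2)
        fix u assume "u \<in> space half_line"
        then have u: "0 < u" by (simp add: space_half_line)
        let ?t = "exp (- u)"
        have "ennreal (w n ?t / (1 + \<bar>ln ?t\<bar>)) = ennreal (1 / (1 + u)) * ennreal (w n ?t)"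
          using u w_pos[of ?t n] by (subst ennreal_mult[symmetric]) auto
        then have "?H ?t = ennreal (1 / (1 + u)) * (ennreal (w n ?t) * Ms f ?t)" by (simp add: mult.assoc)
        also have "\<dots> \<le> ennreal (1 / (1 + u)) * (ennreal c3 * nrm f + ennreal c4 * rearr_int half_line G u)"
          using pt[of ?t] I[OF u] u by (intro mult_left_mono) (auto elim!: order_trans intro!: add_left_mono mult_left_mono)
        also have "\<dots> = ennreal (c3 * z) * ennreal (1 / (1 + u)) + ennreal c4 * (ennreal (1 / (1 + u)) * rearr_int half_line G u)"
          using z c34 by (simp add: distrib_left ennreal_mult ac_simps)
        also have "\<dots> \<le> ennreal (c3 * z) * max_rearr half_line \<eta> u + ennreal c4 * max_rearr half_line G u"
        proof (intro add_mono mult_left_mono \<eta>_ge u)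
          have "ennreal (1 / (1 + u)) * rearr_int half_line G u \<le> ennreal (1 / u) * rearr_int half_line G u"
            using u by (intro mult_right_mono ennreal_leI) (auto simp: field_simps)
          then show "ennreal (1 / (1 + u)) * rearr_int half_line G u \<le> max_rearr half_line G u"
            by (simp add: max_rearr_eq ennreal_divide_real[OF u])
        qed auto
        finally show "?H (exp (- u)) \<le> \<dots>" .
      qed
    qed measurable
    also have "\<dots> \<le> E (\<lambda>u. ennreal (c3 * z) * max_rearr half_line \<eta> u) + E (\<lambda>u. ennreal c4 * max_rearr half_line G u)"
      by (rule E_add) measurable
    also have "\<dots> = ennreal (c3 * z) * E (max_rearr half_line \<eta>) + ennreal c4 * E (max_rearr half_line G)"
      using c34 z by (simp add: E_cmult)
    also have "\<dots> \<le> ennreal (c3 * z) * (ennreal K * E \<eta>) + ennreal c4 * (ennreal K * E G)"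
      by (intro add_mono mult_left_mono K) auto
    also have "E G = N (\<lambda>t. ennreal (w n t) * Os f t * indicator {0<..<1} t)"
      using N_unit_interval[OF gm] by (simp add: G_def[abs_def] g_def)
    also have "ennreal (c3 * z) * (ennreal K * E \<eta>) + ennreal c4 * (ennreal K * N (\<lambda>t. ennreal (w n t) * Os f t * indicator {0<..<1} t))
        \<le> ennreal (c3 * z) * (ennreal K * E \<eta>) + ennreal c4 * (ennreal K * (ennreal C' * Bs f))"
      by (intro add_left_mono mult_left_mono C' f) auto
    also have "\<dots> = ennreal (c3 * K * e0) * nrm f + ennreal (c4 * K * C') * Bs f"
      using c34 z K e0 C' by (simp add: ennreal_mult ac_simps)
    also have "\<dots> \<le> ennreal C * nrm f + ennreal C * Bs f"
      unfolding C_def using c34 K e0 C' by (intro add_mono mult_right_mono ennreal_leI) auto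
    also have "\<dots> = ennreal C * (Bs f + nrm f)" by (simp add: distrib_left add.commute)
    finally show "N (\<lambda>t. ?H t * indicator {0<..<1} t) \<le> ennreal C * (Bs f + nrm f)" .
  qed
qed

section \<open>Mean oscillation over balls\<close>

lemma mean_deviation_le:
  assumes f: "f \<in> L1_plus_Linf M" and B: "B = ball z r" and r: "0 < r"
  shows "ennreal \<bar>f x - mean M B f\<bar> \<le> (\<integral>\<^sup>+ y\<in>B. ennreal \<bar>f x - f y\<bar> \<partial>M) / emeasure M B"
proof -
  note [measurable] = L1_LinfD(1)[OF f]
  have [measurable]: "B \<in> sets M" by (simp add: B)
  define m where "m = measure M B"
  have m: "emeasure M B = ennreal m" "0 < m" unfolding m_def B by (rule emeasure_ball) (rule measure_ball_pos[OF r])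
  have "(\<integral>\<^sup>+ y\<in>B. ennreal \<bar>f y\<bar> \<partial>M) \<le> rearr_int M (absf f) m"
    using m by (intro hardy_littlewood_set sigma_finite_M L1_LinfD(2)[OF f]) auto
  also have "\<dots> < \<infinity>" using m by (intro rearr_int_finite[OF L1_LinfD(2,3)[OF f]])
  \<comment> \<open>Functions in L1 + Linf are integrable on balls; without this the integral in
    \<open>mean\<close> would take its default value 0.\<close>
  finally have fin: "(\<integral>\<^sup>+ y\<in>B. ennreal \<bar>f y\<bar> \<partial>M) < \<infinity>" .
  have "(\<integral>\<^sup>+ y. ennreal (norm (indicator B y *\<^sub>R f y)) \<partial>M) = (\<integral>\<^sup>+ y\<in>B. ennreal \<bar>f y\<bar> \<partial>M)"
    by (intro nn_integral_cong) (auto simp: indicator_def)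
  then have si: "set_integrable M B f"
    unfolding set_integrable_def using fin by (intro integrableI_bounded) auto
  have sc: "set_integrable M B (\<lambda>y. f x)"
    unfolding set_integrable_def using m by (intro integrable_scaleR_left integrable_real_indicator) auto
  have "(LINT y:B|M. f x - f y) = (LINT y:B|M. f x) - (LINT y:B|M. f y)"
    using sc si by (rule set_integral_diff)
  also have "(LINT y:B|M. f x) = m * f x" by (simp add: set_lebesgue_integral_def m_def)
  finally have "f x - mean M B f = (LINT y:B|M. f x - f y) / m"
    using m by (simp add: mean_def m_def[symmetric] field_simps)
  then have "\<bar>f x - mean M B f\<bar> = \<bar>LINT y:B|M. f x - f y\<bar> / m" using m by (simp add: abs_divide)
  then have "ennreal \<bar>f x - mean M B f\<bar> = ennreal \<bar>LINT y:B|M. f x - f y\<bar> / ennreal m"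
    using m by (simp add: divide_ennreal)
  also have "\<dots> \<le> (\<integral>\<^sup>+ y\<in>B. ennreal \<bar>f x - f y\<bar> \<partial>M) / ennreal m"
  proof (rule divide_right_mono_ennreal)
    have "integrable M (\<lambda>y. indicator B y *\<^sub>R (f x - f y))"
      using set_integral_diff(1)[OF sc si] by (simp add: set_integrable_def)
    then have "ennreal (norm (LINT y|M. indicator B y *\<^sub>R (f x - f y))) \<le> (\<integral>\<^sup>+ y. ennreal (norm (indicator B y *\<^sub>R (f x - f y))) \<partial>M)"
      by (rule integral_norm_bound_ennreal)
    also have "\<dots> = (\<integral>\<^sup>+ y\<in>B. ennreal \<bar>f x - f y\<bar> \<partial>M)"
      by (intro nn_integral_cong) (auto simp: indicator_def)
    finally show "ennreal \<bar>LINT y:B|M. f x - f y\<bar> \<le> (\<integral>\<^sup>+ y\<in>B. ennreal \<bar>f x - f y\<bar> \<partial>M)"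
      by (simp add: set_lebesgue_integral_def)
  qed
  finally show ?thesis by (simp add: m)
qed

text \<open>t^-\<theta> b(t) is quasi-decreasing, so its reciprocal is quasi-increasing; the factor
  c is absorbed by the dilation bound for b.\<close>

lemma powr_div_SV_le:
  assumes c: "1 \<le> c"
  obtains V where "0 < V" "\<And>t y. 0 < t \<Longrightarrow> t \<le> c * y \<Longrightarrow> t powr \<theta> / b t \<le> V * (y powr \<theta> / b y)"
proof -
  obtain C where C: "0 < C" "\<And>s t. 0 < s \<Longrightarrow> s \<le> t \<Longrightarrow> t powr (-\<theta>) * b t \<le> C * (s powr (-\<theta>) * b s)"
    using SV_decreasing[OF b_SV \<theta>_pos] by blast
  obtain B where B: "0 < B" "\<And>t. 0 < t \<Longrightarrow> b t \<le> B * b (c * t)" using b_dilate[OF c] by blast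
  show ?thesis
  proof (rule that)
    show "0 < C * B * c powr \<theta>" using C B c by simp
    fix t y :: real assume t: "0 < t" "t \<le> c * y"
    then have "0 < c * y" by simp
    then have y: "0 < y" using c by (simp add: zero_less_mult_iff)
    have p: "0 < b t" "0 < b y" "0 < b (c * y)" using SV_pos[OF b_SV] t y c by auto
    have "(c * y) powr (-\<theta>) * b (c * y) \<le> C * (t powr (-\<theta>) * b t)" using t by (rule C(2))
    then have 1: "t powr \<theta> / b t \<le> C * ((c * y) powr \<theta> / b (c * y))"
      using p t y c by (simp add: powr_minus field_simps)
    have "1 / b (c * y) \<le> B / b y" using B(2)[OF y] p by (simp add: field_simps)
    then have "(c * y) powr \<theta> * (1 / b (c * y)) \<le> (c * y) powr \<theta> * (B / b y)" by (rule mult_left_mono) simp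
    then have "C * ((c * y) powr \<theta> / b (c * y)) \<le> C * ((c * y) powr \<theta> * (B / b y))"
      using C by (intro mult_left_mono) auto
    also have "\<dots> = C * B * c powr \<theta> * (y powr \<theta> / b y)" using c y by (simp add: powr_mult)
    finally show "t powr \<theta> / b t \<le> C * B * c powr \<theta> * (y powr \<theta> / b y)" using 1 by simp
  qed
qed

text \<open>For a ball B = B(z, r) and a radius t between 2r and 3r, each x in B has B contained in
  B(x, t) and B(x, t) contained in B(z, 4r). By doubling, the mean oscillation is at most D times
  the average over B of G, the average difference of f over B(x, t). With m the measure of B, that
  average is at most G**(m), which the fundamental function converts into the modulus at t.\<close>

theorem bmo_bound:
  assumes W: "\<And>t. 0 < t \<Longrightarrow> t \<le> 1 \<Longrightarrow> 1 / w n t \<le> W"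
  obtains C where "0 < C"
    "\<And>f. f \<in> L1_plus_Linf M \<Longrightarrow> bmo_norm M f \<le> ennreal C * (esssup log_measure (Phi f) + nrm f)"
proof -
  obtain D where D: "1 \<le> D" "\<And>x r. r > 0 \<Longrightarrow> measure M (ball x (4 * r)) \<le> D * measure M (ball x r)"
    using ball_measure_dilate[of 4] by auto
  obtain K where K: "0 < K" "\<And>x r. r > 0 \<Longrightarrow> measure M (ball x r) \<le> 1 \<Longrightarrow> r \<le> K * measure M (ball x r) powr (1 / n)"
    using radius_le_measure by blast
  \<comment> \<open>t < 3 r and r <= K m^(1/n) put t below 3 max K 1 times m^(1/n); the maximum
    makes the factor at least 1.\<close>
  obtain V where V: "0 < V" "\<And>t y. 0 < t \<Longrightarrow> t \<le> (3 * max K 1) * y \<Longrightarrow> t powr \<theta> / b t \<le> V * (y powr \<theta> / b y)"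
  proof -
    have "1 \<le> 3 * max K 1" by linarith
    then show ?thesis using that by (rule powr_div_SV_le) blast
  qed
  have "0 < 1 / w n 1" using w_pos[of 1 n] by simp
  also have "\<dots> \<le> W" by (rule W) auto
  finally have W0: "0 < W" .
  define C where "C = D * (V * W)"
  have C: "0 < C" using D V W0 by (simp add: C_def)
  show ?thesis
  proof (rule that)
    show "0 < C + 1" using C by simp
    fix f assume f: "f \<in> L1_plus_Linf M"
    note [measurable] = L1_LinfD(1)[OF f]
    note fm = L1_LinfD(2,3)[OF f]
    define \<beta> where "\<beta> = esssup log_measure (Phi f)"
    have small: "(\<integral>\<^sup>+ x\<in>B. ennreal \<bar>f x - mean M B f\<bar> \<partial>M) / emeasure M B \<le> ennreal C * \<beta>"
      if B: "B = ball z r" and r: "0 < r" and B1: "emeasure M B \<le> 1" for B z r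
    proof -
      have [measurable]: "B \<in> sets M" by (simp add: B)
      define m where "m = measure M B"
      have m: "emeasure M B = ennreal m" "0 < m" unfolding m_def B by (rule emeasure_ball) (rule measure_ball_pos[OF r])
      have m1: "m \<le> 1" using B1 m by simp
      have "AE t in log_measure. Phi f t \<le> \<beta>" unfolding \<beta>_def by (rule esssup_AE)
      then have ae: "AE t in lborel. 0 < t \<longrightarrow> Phi f t \<le> \<beta>" by (simp only: AE_log_measure_iff AE_half_line_iff)
      \<comment> \<open>The essential supremum controls almost every radius only, so a radius is
        picked from an interval of positive length.\<close>
      have "\<exists>t. 2 * r < t \<and> t < 3 * r \<and> Phi f t \<le> \<beta>"
      proof (rule ccontr)
        assume no: "\<not> ?thesis"
        have "AE t in lborel. t \<notin> {2 * r<..<3 * r}"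
          using ae by eventually_elim (use no r in auto)
        then have "{2 * r<..<3 * r} \<in> null_sets lborel"
          by (subst AE_iff_null_sets) simp_all
        then have "emeasure lborel {2 * r<..<3 * r} = 0" by (rule null_setsD1)
        then show False using r by simp
      qed
      then obtain t where t: "2 * r < t" "t < 3 * r" "Phi f t \<le> \<beta>" by blast
      have t0: "0 < t" using t r by simp
      define G where "G x = (\<integral>\<^sup>+ y\<in>ball x t. ennreal \<bar>f x - f y\<bar> \<partial>M) / emeasure M (ball x t)" for x
      have [measurable]: "G \<in> borel_measurable M" unfolding G_def by (rule ball_average_measurable) simp
      have XG: "X G = modulus M X f t" by (simp add: modulus_def G_def[abs_def])
      have pt: "ennreal \<bar>f x - mean M B f\<bar> \<le> ennreal D * G x" if x: "x \<in> B" for x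
      proof -
        define q where "q = measure M (ball x t)"
        have q: "emeasure M (ball x t) = ennreal q" "0 < q" unfolding q_def by (rule emeasure_ball) (rule measure_ball_pos[OF t0])
        have "B \<subseteq> ball x t"
        proof
          fix y assume "y \<in> B"
          then show "y \<in> ball x t" using x t dist_triangle3[of x y z] by (simp add: B)
        qed
        then have "(\<integral>\<^sup>+ y\<in>B. ennreal \<bar>f x - f y\<bar> \<partial>M) \<le> (\<integral>\<^sup>+ y\<in>ball x t. ennreal \<bar>f x - f y\<bar> \<partial>M)"
          by (intro nn_integral_mono) (auto simp: indicator_def)
        also have "\<dots> = G x * ennreal q"
          unfolding G_def q using q by (simp add: ennreal_divide_times ennreal_mult_divide_eq)
        finally have "(\<integral>\<^sup>+ y\<in>B. ennreal \<bar>f x - f y\<bar> \<partial>M) / ennreal m \<le> G x * ennreal q / ennreal m"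
          by (rule divide_right_mono_ennreal)
        also have "\<dots> = ennreal (q / m) * G x"
          using m q by (simp add: ennreal_divide_real mult.assoc[symmetric] ennreal_mult[symmetric] mult.commute)
        also have "\<dots> \<le> ennreal D * G x"
        proof (intro mult_right_mono ennreal_leI)
          have "ball x t \<subseteq> ball z (4 * r)"
          proof
            fix y assume "y \<in> ball x t"
            then show "y \<in> ball z (4 * r)" using x t dist_triangle[of z y x] by (simp add: B)
          qed
          then have "q \<le> measure M (ball z (4 * r))" unfolding q_def by (rule measure_ball_mono)
          also have "\<dots> \<le> D * m" unfolding m_def B by (rule D(2)[OF r])
          finally show "q / m \<le> D" using m by (simp add: field_simps)
        qed simp
        finally show ?thesis using mean_deviation_le[OF f B r, of x] m by (auto intro: order_trans)
      qed
      have "(\<integral>\<^sup>+ x\<in>B. ennreal \<bar>f x - mean M B f\<bar> \<partial>M) \<le> (\<integral>\<^sup>+ x. ennreal D * (G x * indicator B x) \<partial>M)"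
        using pt by (intro nn_integral_mono) (auto simp: indicator_def)
      also have "\<dots> = ennreal D * (\<integral>\<^sup>+ x\<in>B. G x \<partial>M)" by (simp add: nn_integral_cmult)
      also have "\<dots> \<le> ennreal D * rearr_int M G m"
        using m by (intro mult_left_mono hardy_littlewood_set sigma_finite_M) auto
      finally have "(\<integral>\<^sup>+ x\<in>B. ennreal \<bar>f x - mean M B f\<bar> \<partial>M) / ennreal m \<le> ennreal D * rearr_int M G m / ennreal m"
        by (rule divide_right_mono_ennreal)
      also have "\<dots> = ennreal D * max_rearr M G m" by (simp add: max_rearr_eq ennreal_times_divide)
      also have "\<dots> \<le> ennreal D * (ennreal (V * W) * \<beta>)"
      proof (rule mult_left_mono)
        have pm: "0 < \<phi> m" "0 < b t" using pos[OF m(2)] SV_pos[OF b_SV t0] by auto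
        have "max_rearr M G m = ennreal (1 / \<phi> m) * (ennreal (\<phi> m) * max_rearr M G m)"
          using pm by (simp add: mult.assoc[symmetric] ennreal_mult[symmetric])
        also have "\<dots> \<le> ennreal (1 / \<phi> m) * modulus M X f t"
          unfolding XG[symmetric] by (intro mult_left_mono fund_fun_max_rearr_le m) auto
        also have "modulus M X f t = ennreal (t powr \<theta> / b t) * Phi f t"
        proof -
          have "t powr \<theta> / b t * (t powr (- \<theta>) * b t) = 1" using pm t0 by (simp add: powr_minus)
          then show ?thesis unfolding Phi_def using pm t0
            by (simp add: mult.assoc[symmetric] ennreal_mult[symmetric])
        qed
        also have "ennreal (1 / \<phi> m) * (ennreal (t powr \<theta> / b t) * Phi f t) \<le> ennreal (1 / \<phi> m) * (ennreal (t powr \<theta> / b t) * \<beta>)"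
          by (intro mult_left_mono t(3)) auto
        also have "\<dots> = ennreal (1 / \<phi> m * (t powr \<theta> / b t)) * \<beta>"
          unfolding mult.assoc[symmetric] using pm by (subst ennreal_mult[symmetric]) simp_all
        also have "\<dots> \<le> ennreal (V * W) * \<beta>"
        proof (intro mult_right_mono ennreal_leI)
          \<comment> \<open>With this y, y^\<theta> / (b(y) \<phi>(m)) is exactly the reciprocal
            weight at m.\<close>
          define y where "y = m powr (1 / n)"
          have y: "0 < y" using m by (simp add: y_def)
          have "r \<le> K * y" using K(2)[OF r, of z] m1 by (simp add: m_def B y_def)
          also have "\<dots> \<le> max K 1 * y" using y by (intro mult_right_mono) auto
          finally have "t powr \<theta> / b t \<le> V * (y powr \<theta> / b y)" using t by (intro V t0) auto
          then have "1 / \<phi> m * (t powr \<theta> / b t) \<le> 1 / \<phi> m * (V * (y powr \<theta> / b y))"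
            using pm by (intro mult_left_mono) auto
          also have "\<dots> = V * (1 / w n m)"
            using m by (simp add: weight_def y_def powr_powr)
          also have "\<dots> \<le> V * W" using V m m1 by (intro mult_left_mono W) auto
          finally show "1 / \<phi> m * (t powr \<theta> / b t) \<le> V * W" .
        qed simp
        finally show "max_rearr M G m \<le> ennreal (V * W) * \<beta>" .
      qed simp
      also have "\<dots> = ennreal C * \<beta>" using D V W0 by (simp add: C_def ennreal_mult mult.assoc)
      finally show ?thesis by (simp add: m)
    qed
    have large: "(\<integral>\<^sup>+ x\<in>B. ennreal \<bar>f x\<bar> \<partial>M) / emeasure M B \<le> nrm f"
      if B: "B = ball z r" and r: "0 < r" and B1: "emeasure M B > 1" for B z r
    proof -
      have [measurable]: "B \<in> sets M" by (simp add: B)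
      define m where "m = measure M B"
      have m: "emeasure M B = ennreal m" "0 < m" unfolding m_def B by (rule emeasure_ball) (rule measure_ball_pos[OF r])
      have m1: "1 < m" using B1 m by (simp add: ennreal_less_iff flip: ennreal_1)
      have "(\<integral>\<^sup>+ x\<in>B. absf f x \<partial>M) / ennreal m \<le> max_rearr M (absf f) m"
        unfolding max_rearr_eq using m by (intro divide_right_mono_ennreal hardy_littlewood_set sigma_finite_M fm) auto
      also have "\<dots> \<le> max_rearr M (absf f) 1" using m1 by (intro max_rearr_antimono[OF fm]) auto
      finally show ?thesis by (simp add: m L1_plus_Linf_norm_eq(2))
    qed
    have "bmo_norm M f \<le> ennreal C * \<beta> + nrm f"
      unfolding bmo_norm_def using small large by (intro add_mono SUP_least) blast+
    also have "\<dots> \<le> ennreal (C + 1) * \<beta> + ennreal (C + 1) * nrm f"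
    proof (rule add_mono)
      show "ennreal C * \<beta> \<le> ennreal (C + 1) * \<beta>" by (intro mult_right_mono ennreal_leI) auto
      show "nrm f \<le> ennreal (C + 1) * nrm f"
      proof -
        have "ennreal 1 \<le> ennreal (C + 1)" using C by (intro ennreal_leI) simp
        then have "ennreal 1 * nrm f \<le> ennreal (C + 1) * nrm f" by (rule mult_right_mono) simp
        then show ?thesis by (simp only: ennreal_1 mult_1)
      qed
    qed
    also have "\<dots> = ennreal (C + 1) * (\<beta> + nrm f)" by (simp add: distrib_left)
    finally show "bmo_norm M f \<le> ennreal (C + 1) * (esssup log_measure (Phi f) + nrm f)" by (simp add: \<beta>_def)
  qed
qed

end

theorem theorem18:
  fixes M :: "'a::metric_space measure"
    and k n \<theta> :: real
    and E :: "(real \<Rightarrow> ennreal) \<Rightarrow> ennreal"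
    and \<F> :: "fnorm \<Rightarrow> fnorm \<Rightarrow> fnorm"
    and X :: "('a \<Rightarrow> ennreal) \<Rightarrow> ennreal"
    and b :: "real \<Rightarrow> real"
  defines "\<phi> \<equiv> fund_fun M X"
    and "Et \<equiv> tilde_norm \<F>"
    and "S \<equiv> {f \<in> L1_plus_Linf M. vanishes_at_infinity M (absf f)}"
  assumes "RD_space M k n"
    and "non_collapsing M"
    and "parameter E \<F>"
    and "b \<in> SV"
    and "0 < \<theta>" and "\<theta> < 1"
    and "ri_norm M X"
  shows
    "(\<exists>C::real. C > 0 \<and> (\<forall>f\<in>S.
        norm_on Et {0<..<1} (\<lambda>t. ennreal (weight b \<phi> \<theta> n t) * osc M (absf f) t)
        + norm_on Et {1<..} (\<lambda>t. ennreal (weight b \<phi> \<theta> k t) * osc M (absf f) t)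
        \<le> ennreal C * besov_norm M X Et \<theta> b f)) \<and>
     (lower_fund_index \<phi> > \<theta> / k \<longrightarrow>
      (\<exists>C::real. C > 0 \<and> (\<forall>f\<in>S.
        norm_on Et {0<..<1} (\<lambda>t. ennreal (weight b \<phi> \<theta> n t) * max_rearr M (absf f) t)
        + norm_on Et {1<..} (\<lambda>t. ennreal (weight b \<phi> \<theta> k t) * max_rearr M (absf f) t)
        \<le> ennreal C * besov_norm M X Et \<theta> b f))) \<and>
     (\<theta> / n < lower_fund_index \<phi> \<and> lower_fund_index \<phi> \<le> \<theta> / k \<longrightarrow>
      (\<exists>C::real. C > 0 \<and> (\<forall>f\<in>S.
        norm_on Et {0<..<1} (\<lambda>t. ennreal (weight b \<phi> \<theta> n t) * max_rearr M (absf f) t)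
        + norm_on Et {1<..} (\<lambda>t. ennreal (weight b \<phi> \<theta> k t) * osc M (absf f) t)
        \<le> ennreal C * (besov_norm M X Et \<theta> b f + L1_plus_Linf_norm M (absf f))))) \<and>
     (lower_fund_index \<phi> = \<theta> / n \<longrightarrow>
      (norm_on (assoc_norm Et) {0<..<1}
          (\<lambda>t. ennreal (t powr (\<theta> / n) / (b (t powr (1 / n)) * \<phi> t))) < \<infinity> \<longrightarrow>
       (\<exists>C::real. C > 0 \<and> (\<forall>f\<in>S.
         esssup M (absf f)
         \<le> ennreal C * (besov_norm M X Et \<theta> b f + L1_plus_Linf_norm M (absf f))))) \<and>
      (quasi_increasing_on {0<..} (weight b \<phi> \<theta> n) \<and>
       lower_boyd_index E \<in> {0<..<1} \<and> upper_boyd_index E \<in> {0<..<1} \<longrightarrow>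
       (\<exists>C::real. C > 0 \<and> (\<forall>f\<in>S.
         norm_on Et {0<..<1}
           (\<lambda>t. ennreal (weight b \<phi> \<theta> n t / (1 + \<bar>ln t\<bar>)) * max_rearr M (absf f) t)
         \<le> ennreal C * (besov_norm M X Et \<theta> b f + L1_plus_Linf_norm M (absf f))))) \<and>
      ((SUP t\<in>{0<..<1}. ennreal (t powr (\<theta> / n) / (b (t powr (1 / n)) * \<phi> t))) < \<infinity> \<longrightarrow>
       (\<exists>C::real. C > 0 \<and> (\<forall>f\<in>S.
         bmo_norm M f
         \<le> ennreal C * (besov_norm M X (esssup log_measure) \<theta> b f
                         + L1_plus_Linf_norm M (absf f)))))) \<and>
     (upper_fund_index \<phi> < \<theta> / n \<longrightarrow>
      (\<exists>C::real. C > 0 \<and> (\<forall>f\<in>S.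
        esssup M (absf f)
        \<le> ennreal C * (besov_norm M X Et \<theta> b f + L1_plus_Linf_norm M (absf f)))))"
proof -
  interpret besov_setting M k n X E \<F> b \<theta>
    using assms(4-10) by unfold_locales
  have SD: "f \<in> L1_plus_Linf M" "vanishes_at_infinity M (absf f)" if "f \<in> S" for f
    using that by (auto simp: S_def)
  have weight_recip: "t powr (\<theta> / n) / (b (t powr (1 / n)) * \<phi> t) = 1 / weight b \<phi> \<theta> n t" for t
    by (simp add: weight_def)
  note defs = \<phi>_def Et_def
  obtain C0 where C0: "0 < C0"
    "\<And>f. f \<in> L1_plus_Linf M \<Longrightarrow> N (\<lambda>t. ennreal (w n t) * Os f t * indicator {0<..<1} t) \<le> ennreal C0 * Bs f"
    "\<And>f. f \<in> L1_plus_Linf M \<Longrightarrow> N (\<lambda>t. ennreal (w k t) * Os f t * indicator {1<..} t) \<le> ennreal C0 * Bs f"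
    by (rule weighted_osc_bound) blast
  \<comment> \<open>Both boundedness conclusions reduce to a pairing bound for the reciprocal
    weight: it comes from the associate norm in one case and from power decay in the other.\<close>
  have esssup_if_dual: "\<exists>C::real. C > 0 \<and> (\<forall>f\<in>S. esssup M (absf f)
        \<le> ennreal C * (besov_norm M X Et \<theta> b f + L1_plus_Linf_norm M (absf f)))"
    if K: "0 < K" "\<And>h. h \<in> borel_measurable half_line \<Longrightarrow>
      (\<integral>\<^sup>+ t. ennreal (1 / w n t) * indicator {0<..<1} t * h t \<partial>log_measure) \<le> ennreal K * N h" for K
  proof -
    obtain C where "0 < C" "\<And>f. f \<in> L1_plus_Linf M \<Longrightarrow> esssup M (absf f) \<le> ennreal C * (Bs f + nrm f)"
      using esssup_bound[OF K] by blast
    then show ?thesis unfolding Et_def using SD by (intro exI[of _ C]) blast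
  qed
  show ?thesis
  proof (intro conjI impI)
    show "\<exists>C::real. C > 0 \<and> (\<forall>f\<in>S.
        norm_on Et {0<..<1} (\<lambda>t. ennreal (weight b \<phi> \<theta> n t) * osc M (absf f) t)
        + norm_on Et {1<..} (\<lambda>t. ennreal (weight b \<phi> \<theta> k t) * osc M (absf f) t)
        \<le> ennreal C * besov_norm M X Et \<theta> b f)"
    proof (intro exI[of _ "2 * C0"] conjI ballI)
      fix f assume "f \<in> S"
      note f = SD(1)[OF this]
      show "norm_on Et {0<..<1} (\<lambda>t. ennreal (weight b \<phi> \<theta> n t) * osc M (absf f) t)
        + norm_on Et {1<..} (\<lambda>t. ennreal (weight b \<phi> \<theta> k t) * osc M (absf f) t)
        \<le> ennreal (2 * C0) * besov_norm M X Et \<theta> b f"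
        unfolding defs norm_on_def ennreal_double[OF less_imp_le[OF C0(1)], symmetric]
        by (intro add_mono C0(2,3) f)
    qed (use C0 in simp)
  next
    assume "lower_fund_index \<phi> > \<theta> / k"
    then obtain C where "0 < C" "\<And>f. f \<in> L1_plus_Linf M \<Longrightarrow> vanishes_at_infinity M (absf f) \<Longrightarrow>
      N (\<lambda>t. ennreal (w n t) * Ms f t * indicator {0<..<1} t) + N (\<lambda>t. ennreal (w k t) * Ms f t * indicator {1<..} t)
      \<le> ennreal C * Bs f"
      unfolding defs using max_rearr_bound_large_index by blast
    then show "\<exists>C::real. C > 0 \<and> (\<forall>f\<in>S.
        norm_on Et {0<..<1} (\<lambda>t. ennreal (weight b \<phi> \<theta> n t) * max_rearr M (absf f) t)
        + norm_on Et {1<..} (\<lambda>t. ennreal (weight b \<phi> \<theta> k t) * max_rearr M (absf f) t)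
        \<le> ennreal C * besov_norm M X Et \<theta> b f)"
      unfolding defs norm_on_def using SD by blast
  next
    assume "\<theta> / n < lower_fund_index \<phi> \<and> lower_fund_index \<phi> \<le> \<theta> / k"
    then obtain C where C: "0 < C" "\<And>f. f \<in> L1_plus_Linf M \<Longrightarrow>
      N (\<lambda>t. ennreal (w n t) * Ms f t * indicator {0<..<1} t) \<le> ennreal C * (Bs f + nrm f)"
      unfolding defs using max_rearr_bound_middle_index by blast
    show "\<exists>C::real. C > 0 \<and> (\<forall>f\<in>S.
        norm_on Et {0<..<1} (\<lambda>t. ennreal (weight b \<phi> \<theta> n t) * max_rearr M (absf f) t)
        + norm_on Et {1<..} (\<lambda>t. ennreal (weight b \<phi> \<theta> k t) * osc M (absf f) t)
        \<le> ennreal C * (besov_norm M X Et \<theta> b f + L1_plus_Linf_norm M (absf f)))"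
    proof (intro exI[of _ "C + C0"] conjI ballI)
      fix f assume "f \<in> S"
      note f = SD(1)[OF this]
      have "N (\<lambda>t. ennreal (w n t) * Ms f t * indicator {0<..<1} t) + N (\<lambda>t. ennreal (w k t) * Os f t * indicator {1<..} t)
          \<le> ennreal C * (Bs f + nrm f) + ennreal C0 * Bs f"
        by (intro add_mono C C0 f)
      also have "\<dots> \<le> ennreal C * (Bs f + nrm f) + ennreal C0 * (Bs f + nrm f)"
        by (intro add_left_mono mult_left_mono) simp_all
      also have "\<dots> = ennreal (C + C0) * (Bs f + nrm f)"
        using C(1) C0(1) by (simp add: distrib_right)
      finally show "norm_on Et {0<..<1} (\<lambda>t. ennreal (weight b \<phi> \<theta> n t) * max_rearr M (absf f) t)
        + norm_on Et {1<..} (\<lambda>t. ennreal (weight b \<phi> \<theta> k t) * osc M (absf f) t)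
        \<le> ennreal (C + C0) * (besov_norm M X Et \<theta> b f + L1_plus_Linf_norm M (absf f))"
        unfolding defs norm_on_def .
    qed (use C(1) C0(1) in simp)
  next
    let ?g = "\<lambda>t. ennreal (1 / w n t) * indicator {0<..<1} t"
    assume "norm_on (assoc_norm Et) {0<..<1}
          (\<lambda>t. ennreal (t powr (\<theta> / n) / (b (t powr (1 / n)) * \<phi> t))) < \<infinity>"
    then have fin: "assoc_norm N ?g < \<infinity>"
      unfolding weight_recip norm_on_def unfolding defs .
    have "?g \<in> borel_measurable half_line"
      using w_measurable[OF n_pos] by measurable
    then obtain K where "0 < K" "\<And>h. h \<in> borel_measurable half_line \<Longrightarrow> (\<integral>\<^sup>+ t. ?g t * h t \<partial>log_measure) \<le> ennreal K * N h"
      using assoc_norm_duality[OF _ fin] by blast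
    then show "\<exists>C::real. C > 0 \<and> (\<forall>f\<in>S. esssup M (absf f)
        \<le> ennreal C * (besov_norm M X Et \<theta> b f + L1_plus_Linf_norm M (absf f)))"
      by (rule esssup_if_dual)
  next
    assume "quasi_increasing_on {0<..} (weight b \<phi> \<theta> n) \<and>
       lower_boyd_index E \<in> {0<..<1} \<and> upper_boyd_index E \<in> {0<..<1}"
    then obtain C where "0 < C" "\<And>f. f \<in> L1_plus_Linf M \<Longrightarrow>
      N (\<lambda>t. ennreal (w n t / (1 + \<bar>ln t\<bar>)) * Ms f t * indicator {0<..<1} t) \<le> ennreal C * (Bs f + nrm f)"
      unfolding defs greaterThanLessThan_iff using max_rearr_bound_logarithmic by blast
    then show "\<exists>C::real. C > 0 \<and> (\<forall>f\<in>S.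
         norm_on Et {0<..<1}
           (\<lambda>t. ennreal (weight b \<phi> \<theta> n t / (1 + \<bar>ln t\<bar>)) * max_rearr M (absf f) t)
         \<le> ennreal C * (besov_norm M X Et \<theta> b f + L1_plus_Linf_norm M (absf f)))"
      unfolding defs norm_on_def using SD by blast
  next
    assume fin: "(SUP t\<in>{0<..<1}. ennreal (t powr (\<theta> / n) / (b (t powr (1 / n)) * \<phi> t))) < \<infinity>"
    obtain W where W: "(SUP t\<in>{0<..<1}. ennreal (1 / weight b \<phi> \<theta> n t)) = ennreal W" "0 \<le> W"
      using fin[unfolded weight_recip] unfolding infinity_ennreal_def less_top_ennreal by blast
    \<comment> \<open>The supremum runs over (0, 1), while balls of measure exactly 1 also call for
      the value at t = 1; hence the maximum.\<close>
    have bound: "1 / w n t \<le> max W (1 / w n 1)" if t: "0 < t" "t \<le> 1" for t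
    proof (cases "t = 1")
      case False
      have "ennreal (1 / w n t) \<le> (SUP t\<in>{0<..<1}. ennreal (1 / w n t))"
        using t False by (intro SUP_upper) auto
      then have "1 / w n t \<le> W" using W unfolding defs by simp
      then show ?thesis by simp
    qed simp
    obtain C where "0 < C"
      "\<And>f. f \<in> L1_plus_Linf M \<Longrightarrow> bmo_norm M f \<le> ennreal C * (esssup log_measure (Phi f) + nrm f)"
      using bmo_bound[OF bound] by blast
    then show "\<exists>C::real. C > 0 \<and> (\<forall>f\<in>S. bmo_norm M f
         \<le> ennreal C * (besov_norm M X (esssup log_measure) \<theta> b f + L1_plus_Linf_norm M (absf f)))"
      unfolding besov_norm_eq using SD by blast
  next
    assume "upper_fund_index \<phi> < \<theta> / n"
    then obtain K e where K: "0 < K" "0 < e" "\<And>t. 0 < t \<Longrightarrow> t \<le> 1 \<Longrightarrow> 1 / w n t \<le> K * t powr e"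
      unfolding defs using inverse_w_decay[OF n_pos] by blast
    obtain K' where K': "0 < K'" "\<And>h. h \<in> borel_measurable half_line \<Longrightarrow>
      (\<integral>\<^sup>+ t. (ennreal (t powr e) * indicator {0<..<1} t) * h t \<partial>log_measure) \<le> ennreal K' * N h"
      using powr_unit_duality[OF K(2)] by blast
    have "(\<integral>\<^sup>+ t. ennreal (1 / w n t) * indicator {0<..<1} t * h t \<partial>log_measure) \<le> ennreal (K * K') * N h"
      if h [measurable]: "h \<in> borel_measurable half_line" for h
    proof -
      have [measurable]: "(\<lambda>t. ennreal (t powr e)) \<in> borel_measurable half_line"
        by (rule borel_measurable_half_line) measurable
      have "(\<integral>\<^sup>+ t. ennreal (1 / w n t) * indicator {0<..<1} t * h t \<partial>log_measure)
          \<le> (\<integral>\<^sup>+ t. ennreal K * ((ennreal (t powr e) * indicator {0<..<1} t) * h t) \<partial>log_measure)"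
      proof (intro nn_integral_mono)
        fix t
        show "ennreal (1 / w n t) * indicator {0<..<1} t * h t
            \<le> ennreal K * ((ennreal (t powr e) * indicator {0<..<1} t) * h t)"
        proof (cases "t \<in> {0<..<1}")
          case True
          then have "ennreal (1 / w n t) \<le> ennreal K * ennreal (t powr e)"
            using K by (subst ennreal_mult[symmetric]) (auto intro: ennreal_leI)
          then have "ennreal (1 / w n t) * h t \<le> ennreal K * ennreal (t powr e) * h t" by (rule mult_right_mono) simp
          then show ?thesis using True by (simp add: mult.assoc)
        qed simp
      qed
      also have "\<dots> = ennreal K * (\<integral>\<^sup>+ t. (ennreal (t powr e) * indicator {0<..<1} t) * h t \<partial>log_measure)"
        by (rule nn_integral_cmult) measurable
      also have "\<dots> \<le> ennreal K * (ennreal K' * N h)" by (intro mult_left_mono K'(2) h) simp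
      also have "\<dots> = ennreal (K * K') * N h" using K(1) K'(1) by (simp add: ennreal_mult mult.assoc)
      finally show ?thesis .
    qed
    then show "\<exists>C::real. C > 0 \<and> (\<forall>f\<in>S. esssup M (absf f)
        \<le> ennreal C * (besov_norm M X Et \<theta> b f + L1_plus_Linf_norm M (absf f)))"
      using K(1) K'(1) by (intro esssup_if_dual[of "K * K'"]) auto
  qed
qed

end
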